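(* In the setting described in the context, for all $v\in L^\infty(\Omega)$, $p\in H^1_{0,\Gamma_C}(\Omega)$, $\mu\in H^1_{0,\Gamma_I}(\Omega)$, one has $$\mathcal F_\varepsilon(v,p,\mu;0)\le3\left(\|\boldsymbol f(v)\|^2+\|\nabla p\|^2\right)+(2+\varepsilon^2)\|\nabla\mu\|^2$$ for every $\varepsilon\ge0$, and $$\varepsilon^2\left(\frac1{2+3\varepsilon^2}\|\boldsymbol f(v)\|^2+\frac12\|\nabla\mu\|^2\right)+\frac13\|\nabla p\|^2\le\mathcal F_\varepsilon(v,p,\mu;0)$$ for every $\varepsilon>0$.
   Context: $\Omega\subset\mathbb R^2$ (coordinates $(t,x)$) is open, bounded, simply connected with Lipschitz boundary $\Gamma$. $\nabla v=[\partial_t v,\partial_x v]$, $\nabla^\perp v=[\partial_x v,-\partial_t v]$. $\|\cdot\|$ is the norm in $L^2(\Omega)$ and in $[L^2(\Omega)]^2$. $\Gamma=\overline{\Gamma_I}\cup\overline{\Gamma_C}$, where $\Gamma_I$ (the inflow part of the boundary, regarded as given) and $\Gamma_C$ are disjoint relatively open subcurves of nonzero measure with finitely many connected components. For $\Gamma_S\subset\Gamma$, $H^1_{0,\Gamma_S}(\Omega)=\{\phi\in H^1(\Omega):\phi=0\text{ on }\Gamma_S\}$. The flux $\boldsymbol f=[f_1,f_2]:\mathbb R\to\mathbb R^2$ is locally Lipschitz (for every compact $J\subset\mathbb R$ there is $K_{\boldsymbol f,J}>0$ with $|f_i(a)-f_i(b)|\le K_{\boldsymbol f,J}|a-b|$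 for $a,b\in J$, $i=1,2$). The regularized functional is, for $v\in L^\infty(\Omega)$, $p,q\in H^1_{0,\Gamma_C}(\Omega)$, $\mu\in H^1_{0,\Gamma_I}(\Omega)$, $$\mathcal F_\varepsilon(v,p,\mu;q)=\|\boldsymbol f(v)-\nabla p-\nabla^\perp\mu\|^2+\|\nabla p-\nabla q\|^2+\varepsilon^2\|\nabla^\perp\mu\|^2,$$ and $\mathcal F_\varepsilon(v,p,\mu;0)$ is its value at $q=0$. *)

theory Defs
  imports "HOL-Analysis.Analysis"
begin

section \<open>One-dimensional Hausdorff measure\<close>

text \<open>
  Arc length on the boundary is the one-dimensional Hausdorff measure, built from countable covers
  by sets of small diameter. The boundedness condition is needed because \<^const>\<open>diameter\<close> is
  unspecified on unbounded sets.
\<close>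

definition hausdorff_content :: "real \<Rightarrow> 'a::metric_space set \<Rightarrow> ennreal" where
  "hausdorff_content \<delta> A =
     (INF U \<in> {U :: nat \<Rightarrow> 'a set. A \<subseteq> (\<Union>i. U i) \<and> (\<forall>i. bounded (U i) \<and> diameter (U i) \<le> \<delta>)}.
        \<Sum>i. ennreal (diameter (U i)))"

definition hausdorff_outer :: "'a::metric_space set \<Rightarrow> ennreal" where
  "hausdorff_outer A = (SUP \<delta> \<in> {0<..}. hausdorff_content \<delta> A)"

definition hausdorff_measure :: "'a::metric_space measure" where
  "hausdorff_measure = measure_of UNIV (sets borel) hausdorff_outer"

lemma hausdorff_content_eq_outer_measure:
  fixes \<delta> :: real
  defines "d \<equiv> (\<lambda>U :: 'a::metric_space set.
     if bounded U \<and> diameter U \<le> \<delta> then ennreal (diameter U) else top)"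
  assumes "0 < \<delta>"
  shows "hausdorff_content \<delta> = outer_measure (Pow UNIV) d"
    and "positive (Pow UNIV) d" and "increasing (Pow UNIV) d"
proof -
  show pos: "positive (Pow UNIV) d"
    using assms by (simp add: positive_def)
  show inc: "increasing (Pow UNIV) d"
    unfolding increasing_def d_def
    by (auto intro!: ennreal_leI diameter_subset intro: bounded_subset order_trans[OF diameter_subset])
  show "hausdorff_content \<delta> = outer_measure (Pow UNIV) d"
  proof (rule ext, rule antisym)
    fix A :: "'a set"
    show "hausdorff_content \<delta> A \<le> outer_measure (Pow UNIV) d A"
      unfolding outer_measure_def
    proof (rule INF_greatest)
      fix U :: "nat \<Rightarrow> 'a set"
      assume U: "U \<in> {U. range U \<subseteq> Pow UNIV \<and> disjoint_family U \<and> A \<subseteq> (\<Union>i. U i)}"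
      show "hausdorff_content \<delta> A \<le> (\<Sum>i. d (U i))"
      proof (cases "\<forall>i. bounded (U i) \<and> diameter (U i) \<le> \<delta>")
        case True
        then have "(\<Sum>i. d (U i)) = (\<Sum>i. ennreal (diameter (U i)))"
          by (simp add: d_def)
        then show ?thesis
          unfolding hausdorff_content_def using U True by (auto intro!: INF_lower2[of U])
      next
        case False
        then obtain i where "\<not> (bounded (U i) \<and> diameter (U i) \<le> \<delta>)"
          by blast
        then have "d (U i) = top"
          by (auto simp: d_def)
        moreover have "d (U i) \<le> (\<Sum>i. d (U i))"
          using sum_le_suminf[of "\<lambda>i. d (U i)" "{i}"] by auto
        ultimately have "(\<Sum>i. d (U i)) = top"
          by (simp add: top_unique)
        then show ?thesis
          by simp
      qed
    qed
    show "outer_measure (Pow UNIV) d A \<le> hausdorff_content \<delta> A"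
      unfolding hausdorff_content_def
    proof (rule INF_greatest)
      fix U :: "nat \<Rightarrow> 'a set"
      assume U: "U \<in> {U. A \<subseteq> (\<Union>i. U i) \<and> (\<forall>i. bounded (U i) \<and> diameter (U i) \<le> \<delta>)}"
      then have "outer_measure (Pow UNIV) d A \<le> (\<Sum>i. d (U i))"
        by (intro ring_of_sets.outer_measure_le[OF ring_of_sets_Pow pos inc]) auto
      also have "\<dots> = (\<Sum>i. ennreal (diameter (U i)))"
        using U by (simp add: d_def)
      finally show "outer_measure (Pow UNIV) d A \<le> (\<Sum>i. ennreal (diameter (U i)))" .
    qed
  qed
qed

lemma outer_measure_space_hausdorff_content:
  "0 < \<delta> \<Longrightarrow> outer_measure_space (Pow UNIV) (hausdorff_content \<delta>)"
  by (metis (no_types, lifting) hausdorff_content_eq_outer_measure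
      ring_of_sets.outer_measure_space_outer_measure[OF ring_of_sets_Pow])

lemma hausdorff_content_antimono:
  assumes "\<delta> \<le> \<delta>'"
  shows "hausdorff_content \<delta>' A \<le> hausdorff_content \<delta> A"
proof -
  have "diameter U \<le> \<delta> \<Longrightarrow> diameter U \<le> \<delta>'" for U :: "'a set"
    using assms by simp
  then show ?thesis
    unfolding hausdorff_content_def by (intro INF_superset_mono) auto
qed

lemma outer_measure_space_hausdorff_outer: "outer_measure_space (Pow UNIV) (hausdorff_outer :: 'a::metric_space set \<Rightarrow> ennreal)"
proof -
  note oms = outer_measure_space_hausdorff_content[unfolded outer_measure_space_def]
  have "positive (Pow UNIV) (hausdorff_outer :: 'a set \<Rightarrow> ennreal)"
  proof -
    have "hausdorff_outer ({} :: 'a set) \<le> 0"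
      unfolding hausdorff_outer_def using oms by (intro SUP_least) (auto simp: positive_def)
    then show ?thesis by (simp add: positive_def)
  qed
  moreover have "increasing (Pow UNIV) (hausdorff_outer :: 'a set \<Rightarrow> ennreal)"
    unfolding increasing_def hausdorff_outer_def
  proof (intro ballI impI SUP_mono)
    fix A B :: "'a set" and \<delta> :: real
    assume "A \<subseteq> B" "\<delta> \<in> {0<..}"
    then show "\<exists>\<delta>'\<in>{0<..}. hausdorff_content \<delta> A \<le> hausdorff_content \<delta>' B"
      using oms[of \<delta>] by (auto simp: increasing_def)
  qed
  moreover have "countably_subadditive (Pow UNIV) (hausdorff_outer :: 'a set \<Rightarrow> ennreal)"
    unfolding countably_subadditive_def
  proof (intro allI impI)
    fix A :: "nat \<Rightarrow> 'a set"
    assume dj: "disjoint_family A"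
    show "hausdorff_outer (\<Union>i. A i) \<le> (\<Sum>i. hausdorff_outer (A i))"
      unfolding hausdorff_outer_def[of "\<Union>i. A i"]
    proof (rule SUP_least)
      fix \<delta> :: real
      assume \<delta>: "\<delta> \<in> {0<..}"
      then have "hausdorff_content \<delta> (\<Union>i. A i) \<le> (\<Sum>i. hausdorff_content \<delta> (A i))"
        using oms[of \<delta>] dj by (auto simp: countably_subadditive_def)
      also have "\<dots> \<le> (\<Sum>i. hausdorff_outer (A i))"
        using \<delta> by (intro suminf_le) (auto simp: hausdorff_outer_def intro: SUP_upper)
      finally show "hausdorff_content \<delta> (\<Union>i. A i) \<le> (\<Sum>i. hausdorff_outer (A i))" .
    qed
  qed
  ultimately show ?thesis
    by (simp add: outer_measure_space_def)
qed

lemma hausdorff_outer_mono: "A \<subseteq> B \<Longrightarrow> hausdorff_outer A \<le> hausdorff_outer B"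
  using outer_measure_space_hausdorff_outer by (auto simp: outer_measure_space_def increasing_def)

lemma hausdorff_outer_empty [simp]: "hausdorff_outer {} = 0"
  using outer_measure_space_hausdorff_outer by (auto simp: outer_measure_space_def positive_def)

lemma hausdorff_outer_Un_le: "hausdorff_outer (A \<union> B) \<le> hausdorff_outer A + hausdorff_outer B"
proof -
  have "hausdorff_outer (A \<union> (B - A)) \<le> hausdorff_outer A + hausdorff_outer (B - A)"
    using outer_measure_space_hausdorff_outer
    by (intro subadditiveD[of "Pow UNIV"] 
          ring_of_sets.countably_subadditive_subadditive[OF ring_of_sets_Pow])
       (auto simp: outer_measure_space_def)
  also have "\<dots> \<le> hausdorff_outer A + hausdorff_outer B"
    by (intro add_left_mono hausdorff_outer_mono) auto
  finally show ?thesis by simp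
qed

lemma hausdorff_outer_UN_le:
  "hausdorff_outer (\<Union>i. A i) \<le> (\<Sum>i. hausdorff_outer (A (i :: nat)))"
proof -
  have "hausdorff_outer (\<Union>i. disjointed A i) \<le> (\<Sum>i. hausdorff_outer (disjointed A i))"
    using outer_measure_space_hausdorff_outer disjoint_family_disjointed[of A]
    by (auto simp: outer_measure_space_def countably_subadditive_def)
  also have "\<dots> \<le> (\<Sum>i. hausdorff_outer (A i))"
    by (intro suminf_le hausdorff_outer_mono disjointed_subset) auto
  finally show ?thesis by (simp add: UN_disjointed_eq)
qed

lemma hausdorff_content_separated:
  assumes e: "0 < e" and sep: "\<And>x y. x \<in> A \<Longrightarrow> y \<in> B \<Longrightarrow> e \<le> dist x y"
    and \<delta>: "0 < \<delta>" "\<delta> < e"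
  shows "hausdorff_content \<delta> A + hausdorff_content \<delta> B \<le> hausdorff_content \<delta> (A \<union> B)"
  unfolding hausdorff_content_def[of \<delta> "A \<union> B"]
proof (rule INF_greatest)
  fix U :: "nat \<Rightarrow> 'a set"
  assume "U \<in> {U. A \<union> B \<subseteq> (\<Union>i. U i) \<and> (\<forall>i. bounded (U i) \<and> diameter (U i) \<le> \<delta>)}"
  then have U: "A \<union> B \<subseteq> (\<Union>i. U i)" "\<And>i. bounded (U i)" "\<And>i. diameter (U i) \<le> \<delta>"
    by auto
  define V where "V S i = (if U i \<inter> S = {} then {} else U i)" for S i
  have le: "hausdorff_content \<delta> S \<le> (\<Sum>i. ennreal (diameter (V S i)))" if "S \<subseteq> A \<union> B" for S
    unfolding hausdorff_content_def
  proof (rule INF_lower, safe)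
    fix x assume "x \<in> S"
    with that U(1) have "x \<in> (\<Union>i. U i)" by blast
    then obtain i where "x \<in> U i" by blast
    with \<open>x \<in> S\<close> show "x \<in> (\<Union>i. V S i)"
      by (auto simp: V_def intro!: exI[of _ i])
  qed (use U \<delta> in \<open>auto simp: V_def\<close>)
  have one: "U i \<inter> A = {} \<or> U i \<inter> B = {}" for i
  proof (rule ccontr)
    assume "\<not> ?thesis"
    then obtain x y where "x \<in> U i" "x \<in> A" "y \<in> U i" "y \<in> B" by auto
    with sep[of x y] diameter_bounded_bound[OF U(2)[of i], of x y] U(3)[of i] \<delta> show False
      by auto
  qed
  have "hausdorff_content \<delta> A + hausdorff_content \<delta> B \<le>
      (\<Sum>i. ennreal (diameter (V A i))) + (\<Sum>i. ennreal (diameter (V B i)))"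
    by (intro add_mono le) auto
  also have "\<dots> = (\<Sum>i. ennreal (diameter (V A i)) + ennreal (diameter (V B i)))"
    by (simp add: suminf_add)
  also have "\<dots> \<le> (\<Sum>i. ennreal (diameter (U i)))"
  proof (intro suminf_le)
    fix i show "ennreal (diameter (V A i)) + ennreal (diameter (V B i)) \<le> ennreal (diameter (U i))"
      using one[of i] by (auto simp: V_def)
  qed auto
  finally show "hausdorff_content \<delta> A + hausdorff_content \<delta> B \<le> (\<Sum>i. ennreal (diameter (U i)))" .
qed

lemma hausdorff_outer_separated:
  assumes e: "0 < e" and sep: "\<And>x y. x \<in> A \<Longrightarrow> y \<in> B \<Longrightarrow> e \<le> dist x y"
  shows "hausdorff_outer A + hausdorff_outer B \<le> hausdorff_outer (A \<union> B)"
proof -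
  have "hausdorff_content a A + hausdorff_content b B \<le> hausdorff_outer (A \<union> B)"
    if "0 < a" "0 < b" for a b
  proof -
    define \<delta> where "\<delta> = min (min a b) (e / 2)"
    have \<delta>: "0 < \<delta>" "\<delta> < e" "\<delta> \<le> a" "\<delta> \<le> b"
      using that e by (auto simp: \<delta>_def min_def)
    have "hausdorff_content a A + hausdorff_content b B \<le>
        hausdorff_content \<delta> A + hausdorff_content \<delta> B"
      using \<delta> by (intro add_mono hausdorff_content_antimono)
    also have "\<dots> \<le> hausdorff_content \<delta> (A \<union> B)"
      using \<delta> by (intro hausdorff_content_separated[OF e sep])
    also have "\<dots> \<le> hausdorff_outer (A \<union> B)"
      using \<delta> by (auto simp: hausdorff_outer_def intro: SUP_upper)
    finally show ?thesis .
  qed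
  then have "(SUP a\<in>{0<..}. hausdorff_content a A + hausdorff_content b B) \<le> hausdorff_outer (A \<union> B)"
    if "0 < b" for b
    using that by (intro SUP_least) auto
  then have "hausdorff_outer A + hausdorff_content b B \<le> hausdorff_outer (A \<union> B)" if "0 < b" for b
    using that by (simp add: hausdorff_outer_def[of A] ennreal_SUP_add_left)
  then have "(SUP b\<in>{0<..}. hausdorff_outer A + hausdorff_content b B) \<le> hausdorff_outer (A \<union> B)"
    by (intro SUP_least) auto
  then show ?thesis
    by (simp add: hausdorff_outer_def[of B] ennreal_SUP_add_right)
qed

lemma sum_separated_le:
  fixes R :: "nat \<Rightarrow> 'a::metric_space set"
  assumes sep: "\<And>i j. i < j \<Longrightarrow> \<exists>e>0. \<forall>x\<in>R i. \<forall>y\<in>R j. e \<le> dist x y"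
  shows "(\<Sum>i<n. hausdorff_outer (R i)) \<le> hausdorff_outer (\<Union>i<n. R i)"
proof (induction n)
  case (Suc n)
  obtain E where E: "\<And>i. i < n \<Longrightarrow> 0 < E i \<and> (\<forall>x\<in>R i. \<forall>y\<in>R n. E i \<le> dist x y)"
    using sep[of _ n] by metis
  define e where "e = Min (insert 1 (E ` {..<n}))"
  have "0 < e"
    unfolding e_def using E by (subst Min_gr_iff) auto
  moreover have "e \<le> dist x y" if "x \<in> (\<Union>i<n. R i)" "y \<in> R n" for x y
  proof -
    from that obtain i where i: "i < n" "x \<in> R i" by auto
    have "e \<le> E i" unfolding e_def using i by (intro Min_le) auto
    with E[OF i(1)] i that show ?thesis by force
  qed
  ultimately have "hausdorff_outer (\<Union>i<n. R i) + hausdorff_outer (R n) \<le>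
      hausdorff_outer ((\<Union>i<n. R i) \<union> R n)"
    by (rule hausdorff_outer_separated)
  moreover have "(\<Union>i<n. R i) \<union> R n = (\<Union>i<Suc n. R i)"
    by (auto simp: lessThan_Suc)
  ultimately have "hausdorff_outer (\<Union>i<n. R i) + hausdorff_outer (R n) \<le>
      hausdorff_outer (\<Union>i<Suc n. R i)"
    by simp
  with add_right_mono[OF Suc.IH, of "hausdorff_outer (R n)"] show ?case
    unfolding sum.lessThan_Suc by (rule order_trans)
qed simp

lemma closed_in_lambda_system:
  fixes C :: "'a::metric_space set"
  assumes "closed C"
  shows "C \<in> lambda_system UNIV (Pow UNIV) hausdorff_outer"
proof -
  have main: "hausdorff_outer (X \<inter> C) + hausdorff_outer (X - C) \<le> hausdorff_outer X" for X :: "'a set"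
  proof (cases "C = {} \<or> hausdorff_outer X = top")
    case True
    then show ?thesis by auto
  next
    case False
    then have C: "C \<noteq> {}" and fin: "hausdorff_outer X \<noteq> top" by auto
    let ?h = hausdorff_outer
    define A where "A n = {x \<in> X. 1 / real (Suc n) \<le> infdist x C}" for n
    define R where "R n = A (Suc n) - A n" for n
    have A_mono: "A m \<subseteq> A n" if "m \<le> n" for m n
    proof -
      have "1 / real (Suc n) \<le> 1 / real (Suc m)" using that by (simp add: frac_le)
      then show ?thesis by (force simp: A_def)
    qed
    have R_sep: "\<exists>e>0. \<forall>x\<in>R i. \<forall>y\<in>R j. e \<le> dist x y" if "Suc i < j" for i j
    proof (intro exI[of _ "1 / real (Suc (Suc i)) - 1 / real (Suc j)"] conjI ballI)
      show "0 < 1 / real (Suc (Suc i)) - 1 / real (Suc j)"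
        using that by (simp add: frac_less2)
      fix x y assume "x \<in> R i" "y \<in> R j"
      then have "1 / real (Suc (Suc i)) \<le> infdist x C" "infdist y C < 1 / real (Suc j)"
        by (auto simp: R_def A_def)
      moreover have "infdist x C \<le> infdist y C + dist x y"
        by (rule infdist_triangle)
      ultimately show "1 / real (Suc (Suc i)) - 1 / real (Suc j) \<le> dist x y"
        by linarith
    qed
    have RX: "R n \<subseteq> X" for n by (auto simp: R_def A_def)
    have even: "(\<Sum>n. ?h (R (2 * n))) \<le> ?h X"
    proof (rule suminf_le_const)
      fix n
      have "(\<Sum>i<n. ?h (R (2 * i))) \<le> ?h (\<Union>i<n. R (2 * i))"
        by (rule sum_separated_le) (auto intro!: R_sep)
      also have "\<dots> \<le> ?h X" using RX by (intro hausdorff_outer_mono) auto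
      finally show "(\<Sum>i<n. ?h (R (2 * i))) \<le> ?h X" .
    qed simp
    have odd: "(\<Sum>n. ?h (R (2 * n + 1))) \<le> ?h X"
    proof (rule suminf_le_const)
      fix n
      have "(\<Sum>i<n. ?h (R (2 * i + 1))) \<le> ?h (\<Union>i<n. R (2 * i + 1))"
        by (rule sum_separated_le) (rule R_sep, auto)
      also have "\<dots> \<le> ?h X" using RX by (intro hausdorff_outer_mono) auto
      finally show "(\<Sum>i<n. ?h (R (2 * i + 1))) \<le> ?h X" .
    qed simp
    have "(\<Sum>n. ?h (R n)) \<le> ?h X + ?h X"
    proof (rule suminf_le_const)
      fix n
      have "(\<Sum>i<n. ?h (R i)) \<le> (\<Sum>i<2 * n. ?h (R i))"
        by (intro sum_mono2) auto
      also have "\<dots> = (\<Sum>i<n. ?h (R (2 * i))) + (\<Sum>i<n. ?h (R (2 * i + 1)))"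
        by (induction n) (auto simp: algebra_simps)
      also have "\<dots> \<le> (\<Sum>i. ?h (R (2 * i))) + (\<Sum>i. ?h (R (2 * i + 1)))"
        by (intro add_mono sum_le_suminf) auto
      also have "\<dots> \<le> ?h X + ?h X" using even odd by (rule add_mono)
      finally show "(\<Sum>i<n. ?h (R i)) \<le> ?h X + ?h X" .
    qed simp
    also have "\<dots> < top" using fin by (simp add: less_top)
    finally have sum_fin: "(\<Sum>n. ?h (R n)) < top" .
    have tail: "(\<lambda>n. \<Sum>i. ?h (R (i + n))) \<longlonglongrightarrow> 0"
    proof -
      obtain r where r: "\<And>n. ?h (R n) = ennreal (r n)" "\<And>n. 0 \<le> r n"
      proof (rule that[of "\<lambda>n. enn2real (?h (R n))"])
        fix n
        have "?h (R n) < top" using sum_fin by (rule ennreal_suminf_lessD)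
        then show "?h (R n) = ennreal (enn2real (?h (R n)))" by simp
      qed simp
      have sm: "summable r"
        using sum_fin r by (intro summable_suminf_not_top) auto
      have "(\<lambda>n. ennreal (\<Sum>i. r (i + n))) \<longlonglongrightarrow> ennreal 0"
        using suminf_exist_split2[OF sm] by (intro tendsto_ennrealI)
      moreover have "ennreal (\<Sum>i. r (i + n)) = (\<Sum>i. ?h (R (i + n)))" for n
        using r sm by (simp add: suminf_ennreal2 summable_iff_shift)
      ultimately show ?thesis by simp
    qed
    have diff: "X - C \<subseteq> A n \<union> (\<Union>i. R (i + n))" for n
    proof
      fix x assume x: "x \<in> X - C"
      then have "0 < infdist x C"
        using assms C by (metis DiffD2 infdist_nonneg in_closed_iff_infdist_zero order_less_le)
      then obtain m where "1 / real (Suc m) < infdist x C"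
        using nat_approx_posE by blast
      then have m: "x \<in> A m" using x by (auto simp: A_def)
      define k where "k = (LEAST k. x \<in> A k)"
      have k: "x \<in> A k" unfolding k_def using m by (rule LeastI)
      show "x \<in> A n \<union> (\<Union>i. R (i + n))"
      proof (cases "k \<le> n")
        case True
        then show ?thesis using k A_mono by auto
      next
        case False
        then obtain j where j: "k = Suc (j + n)"
          by (metis add.commute add_Suc_right less_imp_Suc_add not_le)
        then have "x \<notin> A (j + n)" using not_less_Least[of "j + n" "\<lambda>k. x \<in> A k"] k_def by auto
        then show ?thesis using k j by (auto simp: R_def)
      qed
    qed
    have le: "?h (X \<inter> C) + ?h (X - C) \<le> ?h X + (\<Sum>i. ?h (R (i + n)))" for n
    proof -
      have "?h (X - C) \<le> ?h (A n \<union> (\<Union>i. R (i + n)))"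
        using diff by (rule hausdorff_outer_mono)
      also have "\<dots> \<le> ?h (A n) + (\<Sum>i. ?h (R (i + n)))"
        by (rule order_trans[OF hausdorff_outer_Un_le add_left_mono[OF hausdorff_outer_UN_le]])
      finally have 1: "?h (X - C) \<le> ?h (A n) + (\<Sum>i. ?h (R (i + n)))" .
      have "?h (X \<inter> C) + ?h (A n) \<le> ?h ((X \<inter> C) \<union> A n)"
      proof (rule hausdorff_outer_separated)
        show "0 < 1 / real (Suc n)" by simp
        fix x y assume "x \<in> X \<inter> C" "y \<in> A n"
        then have "1 / real (Suc n) \<le> infdist y C" "infdist y C \<le> dist y x"
          by (auto simp: A_def intro: infdist_le)
        then show "1 / real (Suc n) \<le> dist x y" by (simp add: dist_commute)
      qed
      also have "\<dots> \<le> ?h X" by (rule hausdorff_outer_mono) (auto simp: A_def)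
      finally have 2: "?h (X \<inter> C) + ?h (A n) \<le> ?h X" .
      have "?h (X \<inter> C) + ?h (X - C) \<le> (?h (X \<inter> C) + ?h (A n)) + (\<Sum>i. ?h (R (i + n)))"
        using add_left_mono[OF 1, of "?h (X \<inter> C)"] by (simp add: add.assoc)
      also have "\<dots> \<le> ?h X + (\<Sum>i. ?h (R (i + n)))"
        using 2 by (rule add_right_mono)
      finally show ?thesis .
    qed
    have "(\<lambda>n. ?h X + (\<Sum>i. ?h (R (i + n)))) \<longlonglongrightarrow> ?h X + 0"
      by (intro tendsto_add tendsto_const tail)
    from LIMSEQ_le_const[OF this] le show ?thesis by simp
  qed
  have "hausdorff_outer (X \<inter> C) + hausdorff_outer (X - C) = hausdorff_outer X" for X
    using main[of X] hausdorff_outer_Un_le[of "X \<inter> C" "X - C"]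
    by (intro antisym) (auto simp: Int_Diff_Un)
  moreover have "(UNIV - C) \<inter> X = X - C" for X
    by auto
  ultimately show ?thesis
    by (simp add: lambda_system_def Int_commute[of C])
qed

text \<open>
  Borel sets are Caratheodory measurable, so the measure agrees with the outer measure on them
  (rather than collapsing to zero, as \<^const>\<open>measure_of\<close> does on set functions that are not measures).
\<close>

lemma measure_space_hausdorff_outer:
  "measure_space UNIV (sets borel) (hausdorff_outer :: 'a::metric_space set \<Rightarrow> ennreal)"
proof -
  let ?L = "lambda_system UNIV (Pow UNIV) (hausdorff_outer :: 'a set \<Rightarrow> ennreal)"
  have L: "measure_space UNIV ?L hausdorff_outer"
    by (intro sigma_algebra.caratheodory_lemma sigma_algebra_Pow outer_measure_space_hausdorff_outer)
  then interpret L: sigma_algebra UNIV ?L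
    by (simp add: measure_space_def)
  have "sets borel \<subseteq> ?L"
    unfolding borel_eq_closed
    by (subst sets_measure_of, simp, intro L.sigma_sets_subset) (auto intro: closed_in_lambda_system simp del: Pow_UNIV)
  moreover have "sigma_algebra UNIV (sets (borel :: 'a measure))"
    by (metis sets.sigma_algebra_axioms space_borel)
  ultimately show ?thesis
    using L by (intro measure_down[OF L])
qed

lemma sets_hausdorff_measure [simp, measurable_cong]: "sets hausdorff_measure = sets borel"
  and space_hausdorff_measure [simp]: "space hausdorff_measure = UNIV"
  unfolding hausdorff_measure_def
  by (simp_all add: sets.sigma_sets_eq[of borel, simplified])

lemma emeasure_hausdorff_measure:
  "A \<in> sets borel \<Longrightarrow> emeasure hausdorff_measure A = hausdorff_outer A"
  unfolding hausdorff_measure_def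
  by (rule emeasure_measure_of_sigma)
     (use measure_space_hausdorff_outer in \<open>auto simp: measure_space_def\<close>)


section \<open>Square-integrable functions\<close>

text \<open>
  Functions are total representatives of their almost-everywhere classes; only their values on
  the space of the measure matter.
\<close>

definition L2 :: "'a measure \<Rightarrow> ('a \<Rightarrow> 'b::euclidean_space) set" where
  "L2 M = {u. u \<in> borel_measurable M \<and> integrable M (\<lambda>z. (norm (u z))\<^sup>2)}"

definition L2norm :: "'a measure \<Rightarrow> ('a \<Rightarrow> 'b::euclidean_space) \<Rightarrow> real" where
  "L2norm M u = sqrt (\<integral>z. (norm (u z))\<^sup>2 \<partial>M)"

definition L2_tendsto ::
  "'a measure \<Rightarrow> (nat \<Rightarrow> 'a \<Rightarrow> 'b::euclidean_space) \<Rightarrow> ('a \<Rightarrow> 'b) \<Rightarrow> bool" where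
  "L2_tendsto M U u \<longleftrightarrow> (\<forall>n. U n \<in> L2 M) \<and> u \<in> L2 M \<and>
     (\<lambda>n. L2norm M (\<lambda>z. U n z - u z)) \<longlonglongrightarrow> 0"

definition Linf :: "'a measure \<Rightarrow> ('a \<Rightarrow> real) set" where
  "Linf M = {u. u \<in> borel_measurable M \<and> (\<exists>C. AE z in M. \<bar>u z\<bar> \<le> C)}"


section \<open>Weak gradients and the space \<open>H\<^sup>1\<close> in the plane\<close>

definition grad :: "(real \<times> real \<Rightarrow> real) \<Rightarrow> real \<times> real \<Rightarrow> real \<times> real" where
  "grad \<phi> z = (frechet_derivative \<phi> (at z) (1, 0), frechet_derivative \<phi> (at z) (0, 1))"

primrec Ck :: "nat \<Rightarrow> (real \<times> real \<Rightarrow> real) \<Rightarrow> bool" where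
  "Ck 0 \<phi> \<longleftrightarrow> continuous_on UNIV \<phi>"
| "Ck (Suc k) \<phi> \<longleftrightarrow>
     (\<forall>z. \<phi> differentiable (at z)) \<and> Ck k (\<lambda>z. fst (grad \<phi> z)) \<and> Ck k (\<lambda>z. snd (grad \<phi> z))"

definition smooth :: "(real \<times> real \<Rightarrow> real) \<Rightarrow> bool" where
  "smooth \<phi> \<longleftrightarrow> (\<forall>k. Ck k \<phi>)"

definition test_function :: "(real \<times> real) set \<Rightarrow> (real \<times> real \<Rightarrow> real) \<Rightarrow> bool" where
  "test_function \<Omega> \<phi> \<longleftrightarrow>
     smooth \<phi> \<and> compact (closure {z. \<phi> z \<noteq> 0}) \<and> closure {z. \<phi> z \<noteq> 0} \<subseteq> \<Omega>"

definition has_weak_gradient ::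
  "(real \<times> real) set \<Rightarrow> (real \<times> real \<Rightarrow> real) \<Rightarrow> (real \<times> real \<Rightarrow> real \<times> real) \<Rightarrow> bool" where
  "has_weak_gradient \<Omega> u g \<longleftrightarrow>
     (\<forall>\<phi>. test_function \<Omega> \<phi> \<longrightarrow>
        (\<integral>z. u z *\<^sub>R grad \<phi> z \<partial>lebesgue_on \<Omega>) = - (\<integral>z. \<phi> z *\<^sub>R g z \<partial>lebesgue_on \<Omega>))"

definition H1 :: "(real \<times> real) set \<Rightarrow> (real \<times> real \<Rightarrow> real) set" where
  "H1 \<Omega> = {u. u \<in> L2 (lebesgue_on \<Omega>) \<and>
               (\<exists>g. g \<in> L2 (lebesgue_on \<Omega>) \<and> has_weak_gradient \<Omega> u g)}"

text \<open>A representative of the weak gradient, which is unique up to a null set.\<close>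

definition weak_grad ::
  "(real \<times> real) set \<Rightarrow> (real \<times> real \<Rightarrow> real) \<Rightarrow> real \<times> real \<Rightarrow> real \<times> real" where
  "weak_grad \<Omega> u = (SOME g. g \<in> L2 (lebesgue_on \<Omega>) \<and> has_weak_gradient \<Omega> u g)"

definition weak_grad_perp ::
  "(real \<times> real) set \<Rightarrow> (real \<times> real \<Rightarrow> real) \<Rightarrow> real \<times> real \<Rightarrow> real \<times> real" where
  "weak_grad_perp \<Omega> u z = (snd (weak_grad \<Omega> u z), - fst (weak_grad \<Omega> u z))"


section \<open>Lipschitz boundary and traces\<close>

text \<open>
  Near each boundary point, \<open>\<Omega>\<close> is, after an orthogonal change of coordinates, the part of the
  plane strictly above the graph of a Lipschitz function.
\<close>

definition lipschitz_boundary :: "(real \<times> real) set \<Rightarrow> bool" where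
  "lipschitz_boundary \<Omega> \<longleftrightarrow>
     (\<forall>z \<in> frontier \<Omega>. \<exists>r>0. \<exists>T :: real \<times> real \<Rightarrow> real \<times> real. \<exists>\<gamma> :: real \<Rightarrow> real. \<exists>L.
        orthogonal_transformation T \<and> L-lipschitz_on UNIV \<gamma> \<and>
        (\<forall>w \<in> ball z r. w \<in> \<Omega> \<longleftrightarrow> \<gamma> (fst (T w)) < snd (T w)))"

definition boundary_measure :: "(real \<times> real) set \<Rightarrow> (real \<times> real) measure" where
  "boundary_measure \<Omega> = restrict_space hausdorff_measure (frontier \<Omega>)"

text \<open>
  On a bounded Lipschitz domain the trace operator from \<open>H\<^sup>1(\<Omega>)\<close> to \<open>L\<^sup>2(\<partial>\<Omega>)\<close> is the continuous extension
  of the restriction map on functions that are smooth up to the boundary. The predicate below is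
  the graph of that operator; such functions are dense in \<open>H\<^sup>1(\<Omega>)\<close>, so every \<open>u\<close> has a trace.
\<close>

definition has_trace ::
  "(real \<times> real) set \<Rightarrow> (real \<times> real \<Rightarrow> real) \<Rightarrow> (real \<times> real \<Rightarrow> real) \<Rightarrow> bool" where
  "has_trace \<Omega> u g \<longleftrightarrow>
     (\<exists>\<phi>. (\<forall>n. smooth (\<phi> n)) \<and>
        L2_tendsto (lebesgue_on \<Omega>) \<phi> u \<and>
        L2_tendsto (lebesgue_on \<Omega>) (\<lambda>n. grad (\<phi> n)) (weak_grad \<Omega> u) \<and>
        L2_tendsto (boundary_measure \<Omega>) \<phi> g)"

definition H1_0 :: "(real \<times> real) set \<Rightarrow> (real \<times> real) set \<Rightarrow> (real \<times> real \<Rightarrow> real) set" where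
  "H1_0 \<Omega> \<Gamma>\<^sub>S = {u \<in> H1 \<Omega>. \<exists>g. has_trace \<Omega> u g \<and> (AE z in boundary_measure \<Omega>. z \<in> \<Gamma>\<^sub>S \<longrightarrow> g z = 0)}"

definition boundary_partition ::
  "(real \<times> real) set \<Rightarrow> (real \<times> real) set \<Rightarrow> (real \<times> real) set \<Rightarrow> bool" where
  "boundary_partition \<Omega> \<Gamma>\<^sub>I \<Gamma>\<^sub>C \<longleftrightarrow>
     frontier \<Omega> = closure \<Gamma>\<^sub>I \<union> closure \<Gamma>\<^sub>C \<and> \<Gamma>\<^sub>I \<inter> \<Gamma>\<^sub>C = {} \<and>
     openin (top_of_set (frontier \<Omega>)) \<Gamma>\<^sub>I \<and> openin (top_of_set (frontier \<Omega>)) \<Gamma>\<^sub>C \<and>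
     emeasure (boundary_measure \<Omega>) \<Gamma>\<^sub>I \<noteq> 0 \<and> emeasure (boundary_measure \<Omega>) \<Gamma>\<^sub>C \<noteq> 0 \<and>
     finite (components \<Gamma>\<^sub>I) \<and> finite (components \<Gamma>\<^sub>C)"


section \<open>The flux and the regularized functional\<close>

definition locally_lipschitz_flux :: "(real \<Rightarrow> real \<times> real) \<Rightarrow> bool" where
  "locally_lipschitz_flux f \<longleftrightarrow>
     (\<forall>J. compact J \<longrightarrow> (\<exists>K>0. \<forall>a\<in>J. \<forall>b\<in>J.
        \<bar>fst (f a) - fst (f b)\<bar> \<le> K * \<bar>a - b\<bar> \<and> \<bar>snd (f a) - snd (f b)\<bar> \<le> K * \<bar>a - b\<bar>))"

definition F_reg ::
  "(real \<times> real) set \<Rightarrow> (real \<Rightarrow> real \<times> real) \<Rightarrow> real \<Rightarrow> (real \<times> real \<Rightarrow> real) \<Rightarrow> (real \<times> real \<Rightarrow> real) \<Rightarrow>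
   (real \<times> real \<Rightarrow> real) \<Rightarrow> (real \<times> real \<Rightarrow> real) \<Rightarrow> real" where
  "F_reg \<Omega> f \<epsilon> v p \<mu> q =
     (L2norm (lebesgue_on \<Omega>) (\<lambda>z. f (v z) - weak_grad \<Omega> p z - weak_grad_perp \<Omega> \<mu> z))\<^sup>2 +
     (L2norm (lebesgue_on \<Omega>) (\<lambda>z. weak_grad \<Omega> p z - weak_grad \<Omega> q z))\<^sup>2 +
     \<epsilon>\<^sup>2 * (L2norm (lebesgue_on \<Omega>) (weak_grad_perp \<Omega> \<mu>))\<^sup>2"

end

theory Submission
  imports Defs
begin

text \<open>
  Writing \<open>a = f(v)\<close>, \<open>b = \<nabla>p\<close>, \<open>c = \<nabla>\<^sup>\<bottom>\<mu>\<close>, the triangle inequality for \<open>a = (a - b - c) + b + c\<close> and a weighted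
  Cauchy-Schwarz inequality give the lower bound. The upper bound with constant 3 needs
  \<open>\<nabla>p\<close> and \<open>\<nabla>\<^sup>\<bottom>\<mu>\<close> to be orthogonal in \<open>L\<^sup>2\<close>, so that
  \<open>\<parallel>\<nabla>p + \<nabla>\<^sup>\<bottom>\<mu>\<parallel>\<^sup>2 = \<parallel>\<nabla>p\<parallel>\<^sup>2 + \<parallel>\<nabla>\<mu>\<parallel>\<^sup>2\<close>.

  For smooth approximations \<open>\<phi>\<^sub>n\<close> of \<open>p\<close> and \<open>\<psi>\<^sub>n\<close> of \<open>\<mu>\<close> the inner product is the integral of the
  Jacobian \<open>J(\<phi>\<^sub>n, \<psi>\<^sub>n)\<close>. There are functions \<open>D\<close> of two variables, with bounded first derivatives and vanishing on
  both coordinate axes up to a small error, such that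
  \<open>J(\<phi>, \<psi>) = J(D(\<phi>, \<psi>), \<psi>) - J(D(\<psi>, \<phi>), \<phi>)\<close>. The traces of \<open>p\<close> and \<open>\<mu>\<close> have product zero almost
  everywhere on the boundary (the end points of the boundary pieces are finitely many), hence the traces of
  \<open>D(\<phi>\<^sub>n, \<psi>\<^sub>n)\<close> tend to zero, while its gradients stay bounded. For fixed smooth \<open>\<psi>\<close>, Green's formula
  bounds the integral of \<open>J(w, \<psi>)\<close> by the boundary values of \<open>w\<close>. In a Lipschitz chart this only needs the
  fundamental theorem of calculus along two families of parallel lines transversal to the graph, and the fact
  that projections along such lines do not increase the one-dimensional Hausdorff measure by more than a constant factor;
  no surface measure or normal vector appears.
\<close>

subsection \<open>Square-integrable functions\<close>

text \<open>Without orthogonality the square of \<open>a - b - c\<close> costs three times each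
  square, and the separate \<nabla>p term would raise the coefficient of its own square to 4. Plain
  integration by parts does not give orthogonality: the boundary integrand would contain a
  tangential derivative of a trace, while traces are known only as L2 limits of restrictions, and
  the approximating functions need not vanish on any piece of the boundary. What survives is that
  the pair of traces takes values in the two coordinate axes. The area form of the target plane is
  the differential of D(x, y) dy - D(y, x) dx, with \<open>D\<close> chosen so that this form
  vanishes on the axes; pulled back by the pair, it gives the splitting of the Jacobian. Bounded
  derivatives suggest a \<open>D\<close> that is homogeneous of degree 1, and the small parameter
  smooths it where the axes cross. The boundary estimate for J(w, \<psi>) depends on the maximum of
  the gradient of \<psi>, which L2 convergence does not control. Hence \<psi> is frozen at one
  member of the sequence, and the exchange is paid for in L2.\<close>

lemma L2_D:
  assumes "u \<in> L2 M"
  shows "u \<in> borel_measurable M" "integrable M (\<lambda>z. (norm (u z))\<^sup>2)"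
  using assms by (auto simp: L2_def)

lemma L2norm_nonneg [simp]: "0 \<le> L2norm M u"
  by (simp add: L2norm_def)

lemma L2norm_sq: "(L2norm M u)\<^sup>2 = (\<integral>z. (norm (u z))\<^sup>2 \<partial>M)"
  by (simp add: L2norm_def)

lemma norm_add_sq_le: "(norm (a + b))\<^sup>2 \<le> 2 * (norm a)\<^sup>2 + 2 * (norm (b :: 'a::real_normed_vector))\<^sup>2"
proof -
  have "(norm (a + b))\<^sup>2 \<le> (norm a + norm b)\<^sup>2"
    by (intro power_mono norm_triangle_ineq) auto
  also have "\<dots> \<le> 2 * (norm a)\<^sup>2 + 2 * (norm b)\<^sup>2"
    using sum_squares_bound[of "norm a" "norm b"] by (simp add: power2_sum)
  finally show ?thesis .
qed

lemma L2_bounded_by: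
  assumes "h \<in> borel_measurable M" "integrable M k" "\<And>z. z \<in> space M \<Longrightarrow> (norm (h z))\<^sup>2 \<le> k z"
  shows "h \<in> L2 M"
  unfolding L2_def
proof (clarsimp simp: assms(1))
  show "integrable M (\<lambda>z. (norm (h z))\<^sup>2)"
    by (rule Bochner_Integration.integrable_bound[OF assms(2)])
      (use assms in \<open>auto intro!: AE_I2 intro: order_trans[OF assms(3) abs_ge_self]\<close>)
qed

lemma L2_add:
  assumes "u \<in> L2 M" "v \<in> L2 M"
  shows "(\<lambda>z. u z + v z) \<in> L2 M"
proof (rule L2_bounded_by)
  show "integrable M (\<lambda>z. 2 * (norm (u z))\<^sup>2 + 2 * (norm (v z))\<^sup>2)"
    using L2_D[OF assms(1)] L2_D[OF assms(2)] by auto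
qed (use L2_D[OF assms(1)] L2_D[OF assms(2)] norm_add_sq_le in auto)

lemma L2_uminus:
  assumes "u \<in> L2 M" shows "(\<lambda>z. - u z) \<in> L2 M"
  using L2_D[OF assms] by (simp add: L2_def)

lemma L2_diff:
  assumes "u \<in> L2 M" "v \<in> L2 M"
  shows "(\<lambda>z. u z - v z) \<in> L2 M"
  using L2_add[OF assms(1) L2_uminus[OF assms(2)]] by simp

lemma L2_cmult:
  assumes "u \<in> L2 M" shows "(\<lambda>z. c * u z :: real) \<in> L2 M"
  using L2_D[OF assms] by (simp add: L2_def power_mult_distrib)

lemma L2_abs:
  assumes "u \<in> L2 M" shows "(\<lambda>z. \<bar>u z :: real\<bar>) \<in> L2 M"
  using L2_D[OF assms] by (simp add: L2_def)

lemma L2_integrable_inner: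
  assumes "u \<in> L2 M" "v \<in> L2 M"
  shows "integrable M (\<lambda>z. u z \<bullet> v z)"
proof (rule Bochner_Integration.integrable_bound)
  show "integrable M (\<lambda>z. (norm (u z))\<^sup>2 + (norm (v z))\<^sup>2)"
    using L2_D[OF assms(1)] L2_D[OF assms(2)] by auto
  have "\<bar>u z \<bullet> v z\<bar> \<le> (norm (u z))\<^sup>2 + (norm (v z))\<^sup>2" for z
  proof -
    have "\<bar>u z \<bullet> v z\<bar> \<le> norm (u z) * norm (v z)" by (rule Cauchy_Schwarz_ineq2)
    moreover have "0 \<le> norm (u z) * norm (v z)" by simp
    ultimately show ?thesis using sum_squares_bound[of "norm (u z)" "norm (v z)"] by linarith
  qed
  then show "AE x in M. norm (u x \<bullet> v x) \<le> norm ((norm (u x))\<^sup>2 + (norm (v x))\<^sup>2)"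
    by (intro AE_I2) (metis abs_ge_self order_trans real_norm_def)
qed (use L2_D[OF assms(1)] L2_D[OF assms(2)] in auto)

lemma L2norm_add_sq:
  assumes "u \<in> L2 M" "v \<in> L2 M"
  shows "(L2norm M (\<lambda>z. u z + s *\<^sub>R v z))\<^sup>2 =
    (L2norm M u)\<^sup>2 + 2 * s * (\<integral>z. u z \<bullet> v z \<partial>M) + s\<^sup>2 * (L2norm M v)\<^sup>2"
proof -
  have "(norm (u z + s *\<^sub>R v z))\<^sup>2 = (norm (u z))\<^sup>2 + 2 * s * (u z \<bullet> v z) + s\<^sup>2 * (norm (v z))\<^sup>2" for z
    unfolding power2_norm_eq_inner
    by (simp add: inner_add inner_commute algebra_simps power2_eq_square)
  then show ?thesis
    unfolding L2norm_sq
    using L2_D[OF assms(1)] L2_D[OF assms(2)] L2_integrable_inner[OF assms] by simp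
qed

text \<open>The squared norm of \<open>u + s v\<close> is a nonnegative quadratic polynomial in
  \<open>s\<close>, so its discriminant cannot be positive.\<close>

lemma L2_Cauchy_Schwarz:
  assumes "u \<in> L2 M" "v \<in> L2 M"
  shows "\<bar>\<integral>z. u z \<bullet> v z \<partial>M\<bar> \<le> L2norm M u * L2norm M v"
proof -
  define A B C where "A = (L2norm M v)\<^sup>2" and "B = (\<integral>z. u z \<bullet> v z \<partial>M)" and "C = (L2norm M u)\<^sup>2"
  have q: "0 \<le> C + 2 * s * B + s\<^sup>2 * A" for s
    using L2norm_add_sq[OF assms, of s] unfolding A_def B_def C_def by (metis zero_le_power2)
  have "B\<^sup>2 \<le> C * A"
  proof (cases "A = 0")
    case True
    have "B = 0"
    proof (rule ccontr)
      assume "B \<noteq> 0"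
      \<comment> \<open>With leading coefficient 0 the polynomial is affine, and this
        \<open>s\<close> gives it the value -1.\<close>
      then show False using q[of "- (C + 1) / (2 * B)"] True by (simp add: field_simps)
    qed
    then show ?thesis using True by simp
  next
    case False
    then have "0 < A" by (simp add: A_def)
    then show ?thesis using q[of "- B / A"] by (simp add: field_simps power2_eq_square)
  qed
  then have "\<bar>B\<bar>\<^sup>2 \<le> (L2norm M u * L2norm M v)\<^sup>2" by (simp add: A_def C_def power_mult_distrib)
  then show ?thesis unfolding B_def[symmetric] by (rule power2_le_imp_le) simp
qed

lemma L2norm_triangle:
  assumes "u \<in> L2 M" "v \<in> L2 M"
  shows "L2norm M (\<lambda>z. u z + v z) \<le> L2norm M u + L2norm M v"
proof (rule power2_le_imp_le)
  have "(\<integral>z. u z \<bullet> v z \<partial>M) \<le> L2norm M u * L2norm M v"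
    using L2_Cauchy_Schwarz[OF assms] by linarith
  then show "(L2norm M (\<lambda>z. u z + v z))\<^sup>2 \<le> (L2norm M u + L2norm M v)\<^sup>2"
    using L2norm_add_sq[OF assms, of 1] by (simp add: power2_sum)
qed simp

lemma L2norm_uminus [simp]: "L2norm M (\<lambda>z. - u z) = L2norm M u"
  by (simp add: L2norm_def)

lemma L2norm_abs [simp]: "L2norm M (\<lambda>z. \<bar>u z :: real\<bar>) = L2norm M u"
  by (simp add: L2norm_def)

lemma L2norm_cmult: "0 \<le> c \<Longrightarrow> L2norm M (\<lambda>z. c * u z :: real) = c * L2norm M u"
  by (simp add: L2norm_def power_mult_distrib real_sqrt_mult)

lemma L2norm_triangle_diff:
  assumes "u \<in> L2 M" "v \<in> L2 M"
  shows "L2norm M (\<lambda>z. u z - v z) \<le> L2norm M u + L2norm M v"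
  using L2norm_triangle[OF assms(1) L2_uminus[OF assms(2)]] by simp

lemma L2norm_cong_AE:
  assumes "AE z in M. norm (u z) = norm (v z)" "u \<in> borel_measurable M" "v \<in> borel_measurable M"
  shows "L2norm M u = L2norm M v"
  unfolding L2norm_def using assms
  by (intro arg_cong[where f = sqrt] integral_cong_AE) (auto elim!: eventually_mono)

lemma L2norm_mono:
  assumes "u \<in> L2 M" "v \<in> L2 M" "\<And>z. z \<in> space M \<Longrightarrow> norm (u z) \<le> norm (v z)"
  shows "L2norm M u \<le> L2norm M v"
  unfolding L2norm_def
  using L2_D[OF assms(1)] L2_D[OF assms(2)] assms(3) by (intro real_sqrt_le_mono integral_mono) (auto intro: power_mono)

lemma L2_tendsto_D:
  assumes "L2_tendsto M U u"
  shows "U n \<in> L2 M" "u \<in> L2 M" "(\<lambda>n. L2norm M (\<lambda>z. U n z - u z)) \<longlonglongrightarrow> 0"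
  using assms by (auto simp: L2_tendsto_def)

lemma L2_tendsto_bounded:
  assumes "L2_tendsto M U u"
  obtains B where "0 \<le> B" "\<And>n. L2norm M (U n) \<le> B"
proof -
  note D = L2_tendsto_D[OF assms]
  obtain B where B: "\<And>n. \<bar>L2norm M (\<lambda>z. U n z - u z)\<bar> \<le> B"
    using convergent_imp_Bseq[OF convergentI[OF D(3)]] unfolding Bseq_def by auto
  have "L2norm M (U n) \<le> B + L2norm M u" for n
    using L2norm_triangle[OF L2_diff[OF D(1)[of n] D(2)] D(2)] B[of n] by simp
  moreover have "0 \<le> B + L2norm M u" using B[of 0] L2norm_nonneg[of M u] by linarith
  ultimately show ?thesis using that by blast
qed

lemma L2_tendsto_inner:
  assumes U: "L2_tendsto M U u" and V: "L2_tendsto M V v"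
  shows "(\<lambda>n. \<integral>z. U n z \<bullet> V n z \<partial>M) \<longlonglongrightarrow> (\<integral>z. u z \<bullet> v z \<partial>M)"
proof -
  note DU = L2_tendsto_D[OF U] and DV = L2_tendsto_D[OF V]
  obtain B where B: "0 \<le> B" "\<And>n. L2norm M (U n) \<le> B" using L2_tendsto_bounded[OF U] by blast
  let ?e = "\<lambda>n. B * L2norm M (\<lambda>z. V n z - v z) + L2norm M (\<lambda>z. U n z - u z) * L2norm M v"
  have "norm ((\<integral>z. U n z \<bullet> V n z \<partial>M) - (\<integral>z. u z \<bullet> v z \<partial>M)) \<le> ?e n" for n
  proof -
    have "(\<integral>z. U n z \<bullet> V n z \<partial>M) - (\<integral>z. u z \<bullet> v z \<partial>M) =
      (\<integral>z. U n z \<bullet> (V n z - v z) \<partial>M) + (\<integral>z. (U n z - u z) \<bullet> v z \<partial>M)"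
      using L2_integrable_inner[OF DU(1)[of n] DV(1)[of n]] L2_integrable_inner[OF DU(1)[of n] DV(2)]
        L2_integrable_inner[OF DU(2) DV(2)]
      by (simp add: inner_diff_left inner_diff_right)
    moreover have "\<bar>\<integral>z. U n z \<bullet> (V n z - v z) \<partial>M\<bar> \<le> B * L2norm M (\<lambda>z. V n z - v z)"
      using L2_Cauchy_Schwarz[OF DU(1)[of n] L2_diff[OF DV(1)[of n] DV(2)]] B(2)[of n]
        mult_right_mono[OF B(2)[of n] L2norm_nonneg[of M "\<lambda>z. V n z - v z"]] by linarith
    moreover have "\<bar>\<integral>z. (U n z - u z) \<bullet> v z \<partial>M\<bar> \<le> L2norm M (\<lambda>z. U n z - u z) * L2norm M v"
      by (rule L2_Cauchy_Schwarz[OF L2_diff[OF DU(1) DU(2)] DV(2)])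
    ultimately show ?thesis unfolding real_norm_def by linarith
  qed
  note bound = this
  have e: "?e \<longlonglongrightarrow> 0"
    using tendsto_add[OF tendsto_mult[OF tendsto_const[of B] DV(3)] tendsto_mult[OF DU(3) tendsto_const[of "L2norm M v"]]]
    by simp
  have "(\<lambda>n. (\<integral>z. U n z \<bullet> V n z \<partial>M) - (\<integral>z. u z \<bullet> v z \<partial>M)) \<longlonglongrightarrow> 0"
    by (rule Lim_null_comparison[OF always_eventually e]) (intro allI bound)
  then show ?thesis by (rule LIM_zero_cancel)
qed

subsection \<open>Classical gradients and \<open>C\<^sup>k\<close> functions\<close>

declare split_paired_All [simp del] split_paired_Ex [simp del]

lemma grad_eqI: "(\<phi> has_derivative D) (at z) \<Longrightarrow> grad \<phi> z = (D (1, 0), D (0, 1))"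
  by (simp add: grad_def frechet_derivative_at[symmetric])

lemma has_derivative_grad:
  assumes "\<phi> differentiable (at z)"
  shows "(\<phi> has_derivative (\<lambda>h. fst h * fst (grad \<phi> z) + snd h * snd (grad \<phi> z))) (at z)"
proof -
  obtain D where D: "(\<phi> has_derivative D) (at z)"
    using assms by (auto simp: differentiable_def)
  then interpret linear D
    by (rule has_derivative_linear)
  have "D h = fst h * D (1, 0) + snd h * D (0, 1)" for h
    using add[of "fst h *\<^sub>R (1, 0)" "snd h *\<^sub>R (0, 1)"] scale[of "fst h" "(1, 0)"] scale[of "snd h" "(0, 1)"]
    by simp
  then have "D = (\<lambda>h. fst h * fst (grad \<phi> z) + snd h * snd (grad \<phi> z))"
    unfolding grad_eqI[OF D] fst_conv snd_conv by (rule ext)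
  with D show ?thesis by simp
qed

lemma grad_add:
  assumes "\<phi> differentiable (at z)" "\<psi> differentiable (at z)"
  shows "grad (\<lambda>z. \<phi> z + \<psi> z) z = (fst (grad \<phi> z) + fst (grad \<psi> z), snd (grad \<phi> z) + snd (grad \<psi> z))"
  using has_derivative_add[OF has_derivative_grad[OF assms(1)] has_derivative_grad[OF assms(2)]]
  by (auto dest!: grad_eqI)

lemma grad_mult:
  assumes "\<phi> differentiable (at z)" "\<psi> differentiable (at z)"
  shows "grad (\<lambda>z. \<phi> z * \<psi> z) z =
    (\<phi> z * fst (grad \<psi> z) + fst (grad \<phi> z) * \<psi> z, \<phi> z * snd (grad \<psi> z) + snd (grad \<phi> z) * \<psi> z)"
  using has_derivative_mult[OF has_derivative_grad[OF assms(1)] has_derivative_grad[OF assms(2)]]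
  by (auto dest!: grad_eqI)

lemma grad_const [simp]: "grad (\<lambda>_. c) z = (0, 0)"
  by (rule grad_eqI[OF has_derivative_const, THEN trans]) simp

lemma Ck_continuous: "Ck k \<phi> \<Longrightarrow> continuous_on UNIV \<phi>"
  by (cases k) (auto intro!: continuous_at_imp_continuous_on differentiable_imp_continuous_within)

lemma Ck_Suc_D: "Ck (Suc k) \<phi> \<Longrightarrow> Ck k \<phi>"
proof (induction k arbitrary: \<phi>)
  case 0
  then show ?case by (simp only: Ck.simps(1)) (rule Ck_continuous)
next
  case (Suc k)
  then have "\<forall>z. \<phi> differentiable (at z)" "Ck k (\<lambda>z. fst (grad \<phi> z))" "Ck k (\<lambda>z. snd (grad \<phi> z))"
    by (metis Ck.simps(2))+
  then show ?case by simp
qed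

lemma Ck_const [simp]: "Ck k (\<lambda>_. c)"
  by (induction k arbitrary: c) auto

lemma Ck_add: "Ck k \<phi> \<Longrightarrow> Ck k \<psi> \<Longrightarrow> Ck k (\<lambda>z. \<phi> z + \<psi> z)"
proof (induction k arbitrary: \<phi> \<psi>)
  case 0
  then show ?case by (auto intro: continuous_intros)
next
  case (Suc k)
  then show ?case by (auto simp: grad_add)
qed

lemma Ck_mult: "Ck k \<phi> \<Longrightarrow> Ck k \<psi> \<Longrightarrow> Ck k (\<lambda>z. \<phi> z * \<psi> z)"
proof (induction k arbitrary: \<phi> \<psi>)
  case 0
  then show ?case by (auto intro: continuous_intros)
next
  case (Suc k)
  then have "Ck k \<phi>" "Ck k \<psi>" by (metis Ck_Suc_D)+
  with Suc show ?case by (auto simp: grad_mult intro!: Ck_add)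
qed

lemma Ck_diff: "Ck k \<phi> \<Longrightarrow> Ck k \<psi> \<Longrightarrow> Ck k (\<lambda>z. \<phi> z - \<psi> z)"
  using Ck_add[of k \<phi> "\<lambda>z. - 1 * \<psi> z"] Ck_mult[of k "\<lambda>_. - 1" \<psi>] by simp

lemma Ck_prod: "finite A \<Longrightarrow> (\<And>i. i \<in> A \<Longrightarrow> Ck k (\<phi> i)) \<Longrightarrow> Ck k (\<lambda>z. \<Prod>i\<in>A. \<phi> i z)"
  by (induction A rule: finite_induct) (auto intro: Ck_mult)

text \<open>A whole sequence of successive derivatives is given because each differentiation
  replaces \<open>P j\<close> by \<open>P (Suc j)\<close>; the induction on \<open>k\<close>
  therefore runs over all \<open>j\<close> at once.\<close>

lemma Ck_affine_compose:
  assumes "\<And>j x. (P j has_real_derivative P (Suc j) x) (at x)"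
  shows "Ck k (\<lambda>z. P j (a * fst z + b * snd z + c))"
proof (induction k arbitrary: j)
  case 0
  have "isCont (P j) x" for x
    using assms[of j x] by (rule DERIV_isCont)
  then have "continuous_on UNIV (P j)"
    by (simp add: continuous_at_imp_continuous_on)
  then show ?case
    by (auto intro!: continuous_on_compose2[of UNIV "P j"] continuous_intros)
next
  case (Suc k)
  have "((\<lambda>z. P j (a * fst z + b * snd z + c)) has_derivative
      (\<lambda>h. P (Suc j) (a * fst z + b * snd z + c) * (a * fst h + b * snd h))) (at z)" for z :: "real \<times> real"
    by (rule has_derivative_compose[where g = "P j", OF _ assms[unfolded has_field_derivative_def]])
       (auto intro!: derivative_eq_intros)
  note D = this
  have "Ck k (\<lambda>z. P (Suc j) (a * fst z + b * snd z + c) * x)" for x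
    by (intro Ck_mult Suc.IH) simp
  with D show ?case
    by (auto simp: grad_eqI[OF D] differentiable_def)
qed

subsection \<open>Smooth bump functions\<close>

text \<open>The derivative of p(1/x) exp(-1/x) is (p - p')(1/x) (1/x)^2 exp(-1/x), whence the
  recursion.\<close>

primrec flat_poly :: "nat \<Rightarrow> real poly" where
  "flat_poly 0 = 1"
| "flat_poly (Suc j) = (flat_poly j - pderiv (flat_poly j)) * monom 1 2"

text \<open>The \<open>j\<close>-th derivative of the flat function \<open>x \<mapsto> exp (- 1 / x)\<close>, extended by zero to \<open>x \<le> 0\<close>.\<close>

definition flat :: "nat \<Rightarrow> real \<Rightarrow> real" where
  "flat j x = (if 0 < x then poly (flat_poly j) (1 / x) * exp (- 1 / x) else 0)"

lemma tendsto_poly_exp_0: "((\<lambda>y. poly p y * exp (- y)) \<longlongrightarrow> (0::real)) at_top"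
proof -
  have "((\<lambda>y. y ^ k * exp (- y)) \<longlongrightarrow> (0::real)) at_top" for k
    using tendsto_power_div_exp_0[of k] by (simp add: exp_minus divide_inverse)
  then have "((\<lambda>y. \<Sum>k\<le>degree p. coeff p k * (y ^ k * exp (- y))) \<longlongrightarrow> (\<Sum>k\<le>degree p. coeff p k * 0)) at_top"
    by (intro tendsto_intros)
  then show ?thesis
    by (simp add: poly_altdef sum_distrib_right mult.assoc)
qed

text \<open>Away from 0 this is the recursion for \<open>flat_poly\<close> or the derivative of
  zero. The point 0 is the issue: there the exponential beats every power of 1/x.\<close>

lemma flat_has_derivative: "(flat j has_real_derivative flat (Suc j) x) (at x)"
proof (cases "x = 0")
  case False
  show ?thesis
  proof (cases "0 < x")
    case True
    have "((\<lambda>x. poly (flat_poly j) (1 / x) * exp (- 1 / x)) has_real_derivative flat (Suc j) x) (at x)"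
      using True by (auto intro!: derivative_eq_intros DERIV_compose_FDERIV[where f="poly _"] DERIV_chain2[OF poly_DERIV]
          simp: flat_def power2_eq_square poly_monom field_simps)
    then show ?thesis
      by (rule has_field_derivative_transform_within_open[of _ _ _ "{0<..}"]) (use True in \<open>auto simp: flat_def\<close>)
  next
    case F: False
    have "((\<lambda>x. 0) has_real_derivative flat (Suc j) x) (at x)"
      using F by (simp add: flat_def)
    then show ?thesis
      by (rule has_field_derivative_transform_within_open[of _ _ _ "{..<0}"]) (use F False in \<open>auto simp: flat_def\<close>)
  qed
next
  case True
  have right: "((\<lambda>h. flat j h / h) \<longlongrightarrow> 0) (at_right 0)"
  proof -
    \<comment> \<open>The factor \<open>monom 1 1\<close> stands for the division by
      \<open>h\<close> in the difference quotient.\<close>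
    have "((\<lambda>h. poly (flat_poly j * monom 1 1) (inverse h) * exp (- (inverse h))) \<longlongrightarrow> 0) (at_right 0)"
      by (rule filterlim_compose[OF tendsto_poly_exp_0 filterlim_inverse_at_top_right])
    then show ?thesis
      by (rule Lim_transform_eventually) (auto simp: eventually_at_right_less flat_def poly_monom field_simps
          intro!: eventually_mono[OF eventually_at_right_less])
  qed
  have left: "((\<lambda>h. flat j h / h) \<longlongrightarrow> 0) (at_left 0)"
    by (rule Lim_transform_eventually[OF tendsto_const])
      (auto simp: flat_def eventually_at_left_field intro!: exI[of _ "-1"])
  have "((\<lambda>h. flat j h / h) \<longlongrightarrow> 0) (at 0)"
    using left right by (rule filterlim_split_at)
  then show ?thesis
    using True by (simp add: has_field_derivative_iff flat_def)
qed

lemma flat_0_zero: "x \<le> 0 \<Longrightarrow> flat 0 x = 0"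
  and flat_0_bounds: "0 \<le> flat 0 x" "flat 0 x \<le> 1"
  by (auto simp: flat_def)

lemma flat_0_scaled_tendsto:
  assumes "0 < x" shows "(\<lambda>n. flat 0 (real (Suc n) * x)) \<longlonglongrightarrow> 1"
proof -
  have "(\<lambda>n. exp (- (1 / x) * inverse (real (Suc n)))) \<longlonglongrightarrow> exp (- (1 / x) * 0)"
    by (intro tendsto_intros LIMSEQ_inverse_real_of_nat)
  moreover have "flat 0 (real (Suc n) * x) = exp (- (1 / x) * inverse (real (Suc n)))" for n
    using assms by (simp add: flat_def divide_inverse mult.commute del: of_nat_Suc)
  ultimately show ?thesis by simp
qed

definition box_bump :: "nat \<Rightarrow> real \<times> real \<Rightarrow> real \<times> real \<Rightarrow> real \<times> real \<Rightarrow> real" where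
  "box_bump n a b z =
     flat 0 (real (Suc n) * (fst z - fst a)) * flat 0 (real (Suc n) * (fst b - fst z)) *
     (flat 0 (real (Suc n) * (snd z - snd a)) * flat 0 (real (Suc n) * (snd b - snd z)))"

lemma smooth_box_bump: "Ck k (box_bump n a b)"
proof -
  have "Ck k (\<lambda>z. flat 0 (s * fst z + t * snd z + c))" for s t c
    by (rule Ck_affine_compose[where P = flat, OF flat_has_derivative])
  from this[of "real (Suc n)" 0 "- real (Suc n) * fst a"] this[of "- real (Suc n)" 0 "real (Suc n) * fst b"]
    this[of 0 "real (Suc n)" "- real (Suc n) * snd a"] this[of 0 "- real (Suc n)" "real (Suc n) * snd b"]
  have "Ck k (\<lambda>z. flat 0 (real (Suc n) * (fst z - fst a)))" "Ck k (\<lambda>z. flat 0 (real (Suc n) * (fst b - fst z)))"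
    "Ck k (\<lambda>z. flat 0 (real (Suc n) * (snd z - snd a)))" "Ck k (\<lambda>z. flat 0 (real (Suc n) * (snd b - snd z)))"
    by (simp_all add: right_diff_distrib del: of_nat_Suc)
  then show ?thesis
    unfolding box_bump_def by (intro Ck_mult)
qed

lemma box_bump_bounds: "0 \<le> box_bump n a b z" "box_bump n a b z \<le> 1"
  unfolding box_bump_def using flat_0_bounds by (auto intro!: mult_le_one mult_nonneg_nonneg)

lemma mem_box_pair: "z \<in> box a b \<longleftrightarrow> fst a < fst z \<and> fst z < fst b \<and> snd a < snd z \<and> snd z < snd (b :: real \<times> real)"
  by (auto simp: box_def Basis_prod_def inner_prod_def)

lemma box_bump_zero: "z \<notin> box a b \<Longrightarrow> box_bump n a b z = 0"
proof -
  assume z: "z \<notin> box a b"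
  have "flat 0 (real (Suc n) * y) = 0" if "y \<le> 0" for y
    by (rule flat_0_zero) (use that in \<open>simp add: mult_le_0_iff\<close>)
  with z show ?thesis
    by (auto simp: box_bump_def mem_box_pair not_less simp del: of_nat_Suc)
qed

lemma box_bump_tendsto:
  assumes "z \<in> box a b" shows "(\<lambda>n. box_bump n a b z) \<longlonglongrightarrow> 1"
proof -
  have "(\<lambda>n. box_bump n a b z) \<longlonglongrightarrow> 1 * 1 * (1 * 1)"
    unfolding box_bump_def using assms by (intro tendsto_mult flat_0_scaled_tendsto) (auto simp: mem_box_pair)
  then show ?thesis by simp
qed

subsection \<open>Almost everywhere uniqueness of the weak gradient of zero\<close>

text \<open>\<open>U\<close> is a countable union of open boxes whose closed versions lie in
  \<open>U\<close>, and 1 - \<phi> is the product of 1 - bump over the boxes of index below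
  \<open>n\<close>. Finitely many boxes enter at stage \<open>n\<close>, so the support is compact
  in \<open>U\<close>; at a point of the \<open>k\<close>-th box the product is at most its
  \<open>k\<close>-th factor, which tends to 0.\<close>

lemma test_function_approx_open:
  fixes U :: "(real \<times> real) set"
  assumes "open U"
  obtains \<phi> where "\<And>n. test_function U (\<phi> n)" "\<And>n z. 0 \<le> \<phi> n z" "\<And>n z. \<phi> n z \<le> 1"
    "\<And>z. (\<lambda>n. \<phi> n z) \<longlonglongrightarrow> indicator U z"
proof -
  define F where "F = {box a b | a b :: real \<times> real. cbox a b \<subseteq> U}"
  have "\<Union>F = U"
  proof
    show "\<Union>F \<subseteq> U" using box_subset_cbox by (fastforce simp: F_def)
    show "U \<subseteq> \<Union>F"
    proof
      fix x assume "x \<in> U"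
      then obtain e where e: "0 < e" "cball x e \<subseteq> U"
        using assms open_contains_cball by blast
      obtain a b where ab: "x \<in> box a b" "box a b \<subseteq> ball x e"
        using rational_boxes[OF e(1), of x] by blast
      then have "cbox a b \<subseteq> cball x e"
        using closure_mono[OF ab(2)] closure_box[of a b] e by (metis closure_ball empty_iff less_irrefl)
      then show "x \<in> \<Union>F" using e ab unfolding F_def by blast
    qed
  qed
  moreover obtain F' where F': "F' \<subseteq> F" "countable F'" "\<Union>F' = \<Union>F"
    by (rule Lindelof[of F]) (auto simp: F_def)
  ultimately have "\<Union>F' = U" by simp
  \<comment> \<open>The empty box makes the family nonempty, so that it can be enumerated even when
    \<open>U\<close> is empty.\<close>
  define G where "G = insert {} F'"
  have "box (1, 1) (0, 0) = ({} :: (real \<times> real) set)" "cbox (1, 1) (0, 0) = ({} :: (real \<times> real) set)"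
    by (auto simp: mem_box_pair cbox_Pair_eq)
  then have "{} \<in> F"
    unfolding F_def by (metis (mono_tags, lifting) empty_subsetI mem_Collect_eq)
  then have G: "countable G" "G \<noteq> {}" "G \<subseteq> F" "\<Union>G = U"
    using F' \<open>\<Union>F' = U\<close> by (auto simp: G_def)
  have "\<exists>c. from_nat_into G k = box (fst c) (snd c) \<and> cbox (fst c) (snd c) \<subseteq> U" for k
  proof -
    obtain a b where "from_nat_into G k = box a b" "cbox a b \<subseteq> U"
      using from_nat_into[OF G(2), of k] G(3) unfolding F_def by blast
    then show ?thesis by (intro exI[of _ "(a, b)"]) simp
  qed
  then obtain c where c: "\<And>k. from_nat_into G k = box (fst (c k)) (snd (c k)) \<and> cbox (fst (c k)) (snd (c k)) \<subseteq> U"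
    by metis
  define a b where "a = (\<lambda>k. fst (c k))" and "b = (\<lambda>k. snd (c k))"
  have ab: "\<And>k. from_nat_into G k = box (a k) (b k)" "\<And>k. cbox (a k) (b k) \<subseteq> U"
    using c by (auto simp: a_def b_def)
  have U: "(\<Union>k. box (a k) (b k)) = U"
    using G range_from_nat_into[of G] by (simp flip: ab(1))
  define \<phi> where "\<phi> n z = 1 - (\<Prod>k<n. 1 - box_bump n (a k) (b k) z)" for n z
  have p01: "0 \<le> (\<Prod>k\<in>A. 1 - box_bump n (a k) (b k) z)" "(\<Prod>k\<in>A. 1 - box_bump n (a k) (b k) z) \<le> 1" for A n z
    by (auto intro!: prod_nonneg prod_le_1 simp: box_bump_bounds)
  have supp: "{z. \<phi> n z \<noteq> 0} \<subseteq> (\<Union>k<n. cbox (a k) (b k))" for n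
  proof (rule ccontr)
    assume "\<not> ?thesis"
    then obtain z where z: "\<phi> n z \<noteq> 0" "\<And>k. k < n \<Longrightarrow> z \<notin> cbox (a k) (b k)" by auto
    then have "\<And>k. k < n \<Longrightarrow> box_bump n (a k) (b k) z = 0"
      using box_bump_zero box_subset_cbox by blast
    then show False using z(1) by (simp add: \<phi>_def)
  qed
  have "compact (\<Union>k<n. cbox (a k) (b k))" for n by auto
  then have cl: "closure {z. \<phi> n z \<noteq> 0} \<subseteq> (\<Union>k<n. cbox (a k) (b k))" for n
    by (intro closure_minimal supp compact_imp_closed)
  show ?thesis
  proof
    fix n
    have "Ck k (\<phi> n)" for k
      unfolding \<phi>_def[abs_def] by (intro Ck_diff Ck_prod smooth_box_bump Ck_const) auto
    moreover have "compact (closure {z. \<phi> n z \<noteq> 0})"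
      by (rule compact_closure[THEN iffD2], rule bounded_subset[OF _ supp]) (auto intro!: bounded_UN)
    ultimately show "test_function U (\<phi> n)"
      using cl[of n] ab(2) by (auto simp: test_function_def smooth_def)
  next
    fix n z show "0 \<le> \<phi> n z" "\<phi> n z \<le> 1" by (auto simp: \<phi>_def p01)
  next
    fix z
    show "(\<lambda>n. \<phi> n z) \<longlonglongrightarrow> indicator U z"
    proof (cases "z \<in> U")
      case True
      then obtain k where k: "z \<in> box (a k) (b k)" using U by auto
      have "(\<lambda>n. \<Prod>k<n. 1 - box_bump n (a k) (b k) z) \<longlonglongrightarrow> 0"
      proof (rule tendsto_sandwich[of "\<lambda>_. 0" _ _ "\<lambda>n. 1 - box_bump n (a k) (b k) z"])
        show "(\<lambda>n. 1 - box_bump n (a k) (b k) z) \<longlonglongrightarrow> 0"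
          using tendsto_diff[OF tendsto_const[of 1] box_bump_tendsto[OF k]] by simp
        show "\<forall>\<^sub>F n in sequentially. (\<Prod>k<n. 1 - box_bump n (a k) (b k) z) \<le> 1 - box_bump n (a k) (b k) z"
          using eventually_gt_at_top[of k]
        proof eventually_elim
          case (elim n)
          then have "(\<Prod>k<n. 1 - box_bump n (a k) (b k) z) =
              (1 - box_bump n (a k) (b k) z) * (\<Prod>k\<in>{..<n} - {k}. 1 - box_bump n (a k) (b k) z)"
            by (intro prod.remove) auto
          also have "\<dots> \<le> (1 - box_bump n (a k) (b k) z) * 1"
            by (intro mult_left_mono p01) (auto simp: box_bump_bounds)
          finally show ?case by simp
        qed
      qed (auto simp: p01)
      from tendsto_diff[OF tendsto_const[of 1] this] show ?thesis
        using True by (simp add: \<phi>_def)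
    next
      case False
      then have "\<phi> n z = 0" for n
        using supp[of n] ab(2) by auto
      then show ?thesis using False by simp
    qed
  qed
qed

lemma L2_integrable:
  assumes "finite_measure M" "u \<in> L2 M"
  shows "integrable M u"
proof (rule Bochner_Integration.integrable_bound)
  interpret finite_measure M by fact
  show "integrable M (\<lambda>z. 1 + (norm (u z))\<^sup>2)"
    using L2_D[OF assms(2)] by auto
  have "norm (u z) \<le> 1 + (norm (u z))\<^sup>2" for z
    using sum_squares_bound[of 1 "norm (u z)"] norm_ge_zero[of "u z"] unfolding one_power2 by linarith
  then show "AE z in M. norm (u z) \<le> norm (1 + (norm (u z))\<^sup>2)"
    by (intro AE_I2) (metis abs_ge_self order_trans real_norm_def)
qed (use L2_D[OF assms(2)] in auto)

lemma finite_measure_lebesgue_on_open: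
  assumes "open \<Omega>" "bounded (\<Omega> :: 'a::euclidean_space set)" shows "finite_measure (lebesgue_on \<Omega>)"
  using assms by (intro finite_measure_lebesgue_on lmeasurable_open)

text \<open>Needed because \<open>weak_grad\<close> is a choice of representative: even for the zero
  function its values are determined only up to a null set, and the functional at q = 0 contains
  them. Approximating indicators by test functions shows that \<open>g\<close> has integral zero
  over open sets, then over Borel and Lebesgue sets.\<close>

lemma weak_gradient_zero_AE:
  assumes \<Omega>: "open \<Omega>" "bounded \<Omega>" and g: "g \<in> L2 (lebesgue_on \<Omega>)"
    and zero: "has_weak_gradient \<Omega> (\<lambda>_. 0) g"
  shows "AE z in lebesgue_on \<Omega>. g z = 0"
proof (rule sigma_finite_measure.density_zero)
  let ?M = "lebesgue_on \<Omega>"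
  interpret finite_measure ?M using finite_measure_lebesgue_on_open[OF \<Omega>] .
  show "sigma_finite_measure ?M" ..
  show int: "integrable ?M g" by (rule L2_integrable[OF finite_measure_axioms g])
  have meas: "A \<in> sets ?M" if "A \<subseteq> \<Omega>" "A \<in> sets borel" for A
    using that \<Omega>(1) by (subst sets_restrict_space_iff) auto
  have imeas: "(\<lambda>z. indicator A z :: real) \<in> borel_measurable ?M" if "A \<in> sets borel" for A
    using that by (intro measurable_restrict_space1) (auto intro!: borel_measurable_indicator)
  have iint: "integrable ?M (\<lambda>z. indicator A z *\<^sub>R g z)" if "A \<in> sets borel" for A
    by (rule Bochner_Integration.integrable_bound[OF int])
      (use int imeas[OF that] in \<open>auto simp: indicator_def intro!: borel_measurable_scaleR\<close>)
  have open0: "(\<integral>z. indicator U z *\<^sub>R g z \<partial>?M) = 0" if "open U" for U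
  proof -
    have "open (U \<inter> \<Omega>)" using that \<Omega> by auto
    from test_function_approx_open[OF this] obtain \<phi> where
      \<phi>: "\<And>n. test_function (U \<inter> \<Omega>) (\<phi> n)" "\<And>n z. 0 \<le> \<phi> n z" "\<And>n z. \<phi> n z \<le> 1"
      "\<And>z. (\<lambda>n. \<phi> n z) \<longlonglongrightarrow> indicator (U \<inter> \<Omega>) z" by metis
    have "test_function \<Omega> (\<phi> n)" for n using \<phi>(1)[of n] by (auto simp: test_function_def)
    then have "(\<integral>z. \<phi> n z *\<^sub>R g z \<partial>?M) = 0" for n
      using zero by (auto simp: has_weak_gradient_def)
    moreover have "(\<lambda>n. \<integral>z. \<phi> n z *\<^sub>R g z \<partial>?M) \<longlonglongrightarrow> (\<integral>z. indicator (U \<inter> \<Omega>) z *\<^sub>R g z \<partial>?M)"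
    proof (rule integral_dominated_convergence[where w = "\<lambda>z. norm (g z)"])
      have "\<phi> n \<in> borel_measurable ?M" for n
      proof (rule measurable_restrict_space1, rule measurable_completion)
        show "\<phi> n \<in> borel_measurable lborel"
          using \<phi>(1)[of n] Ck_continuous[of 0 "\<phi> n"]
          by (auto simp: test_function_def smooth_def simp del: Ck.simps intro!: borel_measurable_continuous_onI)
      qed
      then show "(\<lambda>z. \<phi> n z *\<^sub>R g z) \<in> borel_measurable ?M" for n
        using int by auto
      show "AE z in ?M. (\<lambda>n. \<phi> n z *\<^sub>R g z) \<longlonglongrightarrow> indicator (U \<inter> \<Omega>) z *\<^sub>R g z"
        by (intro AE_I2 tendsto_intros \<phi>)
      show "AE z in ?M. norm (\<phi> n z *\<^sub>R g z) \<le> norm (g z)" for n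
        by (intro AE_I2) (auto intro!: mult_left_le_one_le simp: \<phi>(2,3))
    qed (use int iint[of "U \<inter> \<Omega>"] that \<Omega> in auto)
    ultimately have "(\<integral>z. indicator (U \<inter> \<Omega>) z *\<^sub>R g z \<partial>?M) = 0"
      by (simp add: LIMSEQ_const_iff)
    then show ?thesis
      by (subst (asm) Bochner_Integration.integral_cong[OF refl, of ?M _ "\<lambda>z. indicator U z *\<^sub>R g z"])
        (auto simp: indicator_def)
  qed
  \<comment> \<open>Open sets are an intersection-stable generator, and the sets with integral zero
    are closed under complements and countable disjoint unions.\<close>
  have borel0: "(\<integral>z. indicator A z *\<^sub>R g z \<partial>?M) = 0" if "A \<in> sets borel" for A
  proof -
    have "Int_stable {S :: (real \<times> real) set. open S}" "{S :: (real \<times> real) set. open S} \<subseteq> Pow UNIV"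
      "A \<in> sigma_sets UNIV {S. open S}"
      using that by (auto simp: borel_def Int_stable_def)
    then show ?thesis
    proof (induction A rule: sigma_sets_induct_disjoint)
      case (basic A)
      then show ?case by (simp add: open0)
    next
      case empty
      then show ?case by simp
    next
      case (compl A)
      then have A: "A \<in> sets borel" by (simp add: borel_def)
      have "(\<integral>z. indicator (UNIV - A) z *\<^sub>R g z \<partial>?M) = (\<integral>z. indicator UNIV z *\<^sub>R g z - indicator A z *\<^sub>R g z \<partial>?M)"
        by (intro Bochner_Integration.integral_cong) (auto simp: indicator_def)
      also have "\<dots> = 0"
        using iint[OF A] iint[of UNIV] compl open0[of UNIV] by (subst Bochner_Integration.integral_diff) auto
      finally show ?case .
    next
      case (union A)
      then have A: "\<And>i. A i \<in> sets borel" by (auto simp: borel_def)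
      have m: "A i \<inter> \<Omega> \<in> sets ?M" for i using meas[of "A i \<inter> \<Omega>"] A \<Omega>(1) by auto
      have eq: "(\<integral>z. indicator B z *\<^sub>R g z \<partial>?M) = set_lebesgue_integral ?M (B \<inter> \<Omega>) g" for B
        unfolding set_lebesgue_integral_def
        by (intro Bochner_Integration.integral_cong) (auto simp: indicator_def)
      have "set_lebesgue_integral ?M (\<Union>i. A i \<inter> \<Omega>) g = (\<Sum>i. set_lebesgue_integral ?M (A i \<inter> \<Omega>) g)"
      proof (rule lebesgue_integral_countable_add[OF m])
        show "i \<noteq> j \<Longrightarrow> A i \<inter> \<Omega> \<inter> (A j \<inter> \<Omega>) = {}" for i j
          using union(1) by (fastforce simp: disjoint_family_on_def)
        have "(\<Union>i. A i) \<in> sets borel" using A by auto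
        from iint[OF this] show "set_integrable ?M (\<Union>i. A i \<inter> \<Omega>) g"
          unfolding set_integrable_def
          by (subst (asm) Bochner_Integration.integrable_cong[OF refl, of ?M _ "\<lambda>z. indicator (\<Union>i. A i \<inter> \<Omega>) z *\<^sub>R g z"])
            (auto simp: indicator_def)
      qed
      with union(3) show ?case
        unfolding eq by (simp add: Int_UN_distrib2)
    qed
  qed
  fix A assume "A \<in> sets ?M"
  then have A: "A \<in> sets lebesgue" "A \<subseteq> \<Omega>"
    using \<Omega>(1) by (auto simp: sets_restrict_space_iff)
  \<comment> \<open>A Lebesgue set agrees with a Borel set up to a null set, which the integral does
    not see.\<close>
  let ?B = "main_part lborel A"
  have B: "?B \<in> sets borel" using A by (metis main_part_sets sets_lborel)
  have "AE x in lebesgue. x \<in> ?B \<longleftrightarrow> x \<in> A"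
    using AE_in_main_part[OF A(1)] by (rule AE_completion)
  then have "AE x in ?M. x \<in> ?B \<longleftrightarrow> x \<in> A"
    using \<Omega>(1) by (subst AE_restrict_space_iff) (auto elim: eventually_mono)
  then have "set_lebesgue_integral ?M A g = (\<integral>z. indicator ?B z *\<^sub>R g z \<partial>?M)"
    unfolding set_lebesgue_integral_def
    using int iint[OF B] \<open>A \<in> sets ?M\<close>
    by (intro integral_cong_AE) (auto elim!: eventually_mono simp: indicator_def intro!: borel_measurable_scaleR)
  then show "set_lebesgue_integral ?M A g = 0" using borel0[OF B] by simp
qed

section \<open>Symmetry of mixed second derivatives\<close>

lemma has_real_derivative_line:
  assumes "u differentiable (at (p + t * a, r + t * b))"
  shows "((\<lambda>t. u (p + t * a, r + t * b)) has_real_derivative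
    a * fst (grad u (p + t * a, r + t * b)) + b * snd (grad u (p + t * a, r + t * b))) (at t)"
proof -
  have "((\<lambda>t. (p + t * a, r + t * b)) has_derivative (\<lambda>h. (h * a, h * b))) (at t)"
    by (auto intro!: derivative_eq_intros)
  from has_derivative_compose[OF this has_derivative_grad[OF assms]] show ?thesis
    unfolding has_field_derivative_def
    by (rule has_derivative_eq_rhs) (auto simp: algebra_simps)
qed

text \<open>The mean value theorem is applied in the first variable to a difference in the second,
  and then in the second variable to the derivative so obtained.\<close>

lemma second_difference_mean_value:
  assumes \<psi>: "\<And>z. \<psi> differentiable (at z)" "\<And>z. (\<lambda>z. fst (grad \<psi> z)) differentiable (at z)" and h: "0 < h"
  obtains s y where "t < s" "s < t + h" "x < y" "y < x + h"
    "\<psi> (t + h, x + h) - \<psi> (t + h, x) - \<psi> (t, x + h) + \<psi> (t, x) = h * (h * snd (grad (\<lambda>z. fst (grad \<psi> z)) (s, y)))"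
proof -
  let ?a = "\<lambda>z. fst (grad \<psi> z)"
  have D: "((\<lambda>s. \<psi> (s, y)) has_real_derivative ?a (s, y)) (at s)" for s y
    using has_real_derivative_line[of \<psi> 0 s 1 y 0] \<psi>(1) by simp
  have D2: "((\<lambda>y. ?a (s, y)) has_real_derivative snd (grad ?a (s, y))) (at y)" for s y
    using has_real_derivative_line[of ?a s y 0 0 1] \<psi>(2) by simp
  have "\<exists>s>t. s < t + h \<and> (\<psi> (t + h, x + h) - \<psi> (t + h, x)) - (\<psi> (t, x + h) - \<psi> (t, x)) =
      (t + h - t) * (?a (s, x + h) - ?a (s, x))"
    by (rule MVT2) (use h D in \<open>auto intro: DERIV_diff\<close>)
  then obtain s where s: "t < s" "s < t + h"
    "(\<psi> (t + h, x + h) - \<psi> (t + h, x)) - (\<psi> (t, x + h) - \<psi> (t, x)) = (t + h - t) * (?a (s, x + h) - ?a (s, x))"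
    by blast
  have "\<exists>y>x. y < x + h \<and> ?a (s, x + h) - ?a (s, x) = (x + h - x) * snd (grad ?a (s, y))"
    by (rule MVT2) (use h D2 in auto)
  then obtain y where y: "x < y" "y < x + h" "?a (s, x + h) - ?a (s, x) = (x + h - x) * snd (grad ?a (s, y))"
    by blast
  show ?thesis using that[OF s(1,2) y(1,2)] s(3) y(3) by (simp add: algebra_simps)
qed

lemma grad_swap:
  fixes u :: "real \<times> real \<Rightarrow> real"
  assumes "u differentiable (at (snd w, fst w))"
  shows "grad (\<lambda>z. u (snd z, fst z)) w = (snd (grad u (snd w, fst w)), fst (grad u (snd w, fst w)))"
proof -
  have "((\<lambda>z. (snd z, fst z)) has_derivative (\<lambda>h. (snd h, fst h))) (at w)"
    by (auto intro!: derivative_eq_intros)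
  from has_derivative_compose[OF this has_derivative_grad[OF assms]] show ?thesis
    by (auto dest!: grad_eqI)
qed

lemma differentiable_swap:
  fixes u :: "real \<times> real \<Rightarrow> real"
  assumes "u differentiable (at (snd w, fst w))"
  shows "(\<lambda>z. u (snd z, fst z)) differentiable (at w)"
proof -
  have "((\<lambda>z. (snd z, fst z)) has_derivative (\<lambda>h. (snd h, fst h))) (at w)"
    by (auto intro!: derivative_eq_intros)
  from has_derivative_compose[OF this has_derivative_grad[OF assms]] show ?thesis
    by (auto simp: differentiable_def)
qed

text \<open>The second difference over a square of side \<open>h\<close> is unchanged when the
  variables trade places, so each mixed derivative attains the same value somewhere in the square;
  continuity settles the limit of small \<open>h\<close>.\<close>

lemma mixed_partials:
  assumes "Ck 2 \<psi>"
  shows "snd (grad (\<lambda>z. fst (grad \<psi> z)) z) = fst (grad (\<lambda>z. snd (grad \<psi> z)) z)"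
proof -
  let ?a = "\<lambda>z. fst (grad \<psi> z)" and ?b = "\<lambda>z. snd (grad \<psi> z)"
  let ?A = "\<lambda>z. snd (grad ?a z)" and ?B = "\<lambda>z. fst (grad ?b z)"
  have d: "\<And>z. \<psi> differentiable (at z)" "\<And>z. ?a differentiable (at z)" "\<And>z. ?b differentiable (at z)"
    and c: "continuous_on UNIV ?A" "continuous_on UNIV ?B"
    using assms by (auto simp: numeral_2_eq_2)
  obtain t x where z: "z = (t, x)" by (cases z)
  define h where "h n = inverse (real (Suc n))" for n
  have h: "0 < h n" for n by (simp add: h_def)
  have "\<exists>p q. dist p z \<le> 2 * h n \<and> dist q z \<le> 2 * h n \<and> ?A p = ?B q" for n
  proof -
    obtain s y where 1: "t < s" "s < t + h n" "x < y" "y < x + h n"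
      "\<psi> (t + h n, x + h n) - \<psi> (t + h n, x) - \<psi> (t, x + h n) + \<psi> (t, x) = h n * (h n * ?A (s, y))"
      by (rule second_difference_mean_value[OF d(1,2) h])
    \<comment> \<open>Exchanging the coordinates of \<psi> exchanges the order of differentiation,
      so the same mean value lemma serves both orders.\<close>
    let ?s = "\<lambda>z. \<psi> (snd z, fst z)"
    have g: "(\<lambda>z. fst (grad ?s z)) = (\<lambda>z. ?b (snd z, fst z))"
      using d by (auto simp: grad_swap)
    have ds: "?s differentiable (at w)" "(\<lambda>z. fst (grad ?s z)) differentiable (at w)" for w
      unfolding g using differentiable_swap[of \<psi> w] differentiable_swap[of ?b w] d by auto
    obtain y' s' where 2: "x < y'" "y' < x + h n" "t < s'" "s' < t + h n"
      "?s (x + h n, t + h n) - ?s (x + h n, t) - ?s (x, t + h n) + ?s (x, t) =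
        h n * (h n * snd (grad (\<lambda>z. fst (grad ?s z)) (y', s')))"
      by (rule second_difference_mean_value[OF ds h])
    have e: "snd (grad (\<lambda>z. fst (grad ?s z)) (y', s')) = ?B (s', y')"
      unfolding g using d grad_swap[of ?b "(y', s')"] by simp
    then have "h n * (h n * ?A (s, y)) = h n * (h n * ?B (s', y'))"
      using 1(5) 2(5)[unfolded e fst_conv snd_conv] by linarith
    then have "?A (s, y) = ?B (s', y')" using h[of n] by simp
    moreover have "dist (s, y) z \<le> 2 * h n" "dist (s', y') z \<le> 2 * h n"
      using 1 2 sqrt_sum_squares_le_sum_abs[of "dist s t" "dist y x"] sqrt_sum_squares_le_sum_abs[of "dist s' t" "dist y' x"]
      by (auto simp: z dist_Pair_Pair dist_real_def)
    ultimately show ?thesis by blast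
  qed
  then obtain p q where pq: "\<And>n. dist (p n) z \<le> 2 * h n" "\<And>n. dist (q n) z \<le> 2 * h n" "\<And>n. ?A (p n) = ?B (q n)"
    by metis
  have h0: "(\<lambda>n. 2 * h n) \<longlonglongrightarrow> 0"
    unfolding h_def using tendsto_mult[OF tendsto_const[of 2] LIMSEQ_inverse_real_of_nat] by simp
  have "p \<longlonglongrightarrow> z" "q \<longlonglongrightarrow> z"
    using pq by (auto intro!: metric_tendsto_imp_tendsto[OF h0, of _ z] always_eventually simp: h_def)
  then have "(\<lambda>n. ?A (p n)) \<longlonglongrightarrow> ?A z" "(\<lambda>n. ?B (q n)) \<longlonglongrightarrow> ?B z"
    using continuous_on_tendsto_compose[OF c(1), of p z] continuous_on_tendsto_compose[OF c(2), of q z] by simp_all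
  then show ?thesis
    using pq(3) LIMSEQ_unique by auto
qed

subsection \<open>A splitting of the Jacobian\<close>

definition Jac :: "(real \<times> real \<Rightarrow> real) \<Rightarrow> (real \<times> real \<Rightarrow> real) \<Rightarrow> real \<times> real \<Rightarrow> real" where
  "Jac u v z = fst (grad u z) * snd (grad v z) - snd (grad u z) * fst (grad v z)"

text \<open>
  With \<open>S = - x y (x\<^sup>2 - y\<^sup>2) / (2 (x\<^sup>2 + y\<^sup>2 + d\<^sup>2))\<close>, \<open>axis_cut d x y\<close> is \<open>x / 2 + \<partial>\<^sub>y S\<close>. The planar field
  \<open>(axis_cut d x y, axis_cut d y x)\<close> has divergence 1 because \<open>S\<close> is antisymmetric, it vanishes on both axes up to
  an error \<open>d\<close>, and its derivatives are bounded uniformly in \<open>d\<close>.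
\<close>

definition cut_num :: "real \<Rightarrow> real \<Rightarrow> real \<Rightarrow> real" where
  "cut_num d x y = 6 * x\<^sup>2 * y\<^sup>2 + 2 * y ^ 4 + d\<^sup>2 * x\<^sup>2 + 5 * d\<^sup>2 * y\<^sup>2 + d ^ 4"

definition cut_den :: "real \<Rightarrow> real \<Rightarrow> real \<Rightarrow> real" where
  "cut_den d x y = x\<^sup>2 + y\<^sup>2 + d\<^sup>2"

definition axis_cut :: "real \<Rightarrow> real \<Rightarrow> real \<Rightarrow> real" where
  "axis_cut d x y = x * cut_num d x y / (2 * (cut_den d x y)\<^sup>2)"

definition axis_cut_x :: "real \<Rightarrow> real \<Rightarrow> real \<Rightarrow> real" where
  "axis_cut_x d x y = (cut_num d x y + x * (12 * x * y\<^sup>2 + 2 * d\<^sup>2 * x)) / (2 * (cut_den d x y)\<^sup>2)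
     - 2 * x\<^sup>2 * cut_num d x y / (cut_den d x y) ^ 3"

definition axis_cut_y :: "real \<Rightarrow> real \<Rightarrow> real \<Rightarrow> real" where
  "axis_cut_y d x y = x * (12 * x\<^sup>2 * y + 8 * y ^ 3 + 10 * d\<^sup>2 * y) / (2 * (cut_den d x y)\<^sup>2)
     - 2 * x * y * cut_num d x y / (cut_den d x y) ^ 3"

lemma cut_den_pos: "0 < d \<Longrightarrow> 0 < cut_den d x y"
  unfolding cut_den_def by (intro add_nonneg_pos add_nonneg_nonneg) auto

text \<open>Both sides are quadratic forms in the nonnegative quantities x^2, y^2, d^2 and are
  compared coefficient by coefficient; the term 6 x^2 y^2 against 2 x^2 y^2 in the square of
  \<open>cut_den\<close> dictates the factor 3.\<close>

lemma cut_num_bounds: "0 \<le> cut_num d x y" "cut_num d x y \<le> 3 * (cut_den d x y)\<^sup>2"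
proof -
  define X Y e where "X = x\<^sup>2" and "Y = y\<^sup>2" and "e = d\<^sup>2"
  have nn: "0 \<le> X" "0 \<le> Y" "0 \<le> e" by (auto simp: X_def Y_def e_def)
  have n: "cut_num d x y = 6 * (X * Y) + 2 * Y\<^sup>2 + e * X + 5 * (e * Y) + e\<^sup>2"
    by (simp add: cut_num_def X_def Y_def e_def flip: power_mult)
  have q: "3 * (cut_den d x y)\<^sup>2 = 3 * X\<^sup>2 + 3 * Y\<^sup>2 + 3 * e\<^sup>2 + 6 * (X * Y) + 6 * (e * X) + 6 * (e * Y)"
    unfolding cut_den_def X_def[symmetric] Y_def[symmetric] e_def[symmetric] by (simp add: power2_eq_square algebra_simps)
  have "0 \<le> X * Y" "0 \<le> e * X" "0 \<le> e * Y" "0 \<le> X\<^sup>2" "0 \<le> Y\<^sup>2" "0 \<le> e\<^sup>2" using nn by auto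
  then show "0 \<le> cut_num d x y" "cut_num d x y \<le> 3 * (cut_den d x y)\<^sup>2"
    unfolding n q by linarith+
qed

lemma axis_cut_divergence:
  assumes "0 < d" shows "axis_cut_x d x y + axis_cut_x d y x = 1"
proof -
  let ?q = "cut_den d x y"
  have q: "cut_den d y x = ?q" by (simp add: cut_den_def)
  have "0 < ?q" using cut_den_pos[OF assms] .
  \<comment> \<open>Over the common denominator 2 q^3 the claim becomes the polynomial identity
    \<open>n\<close>, which \<open>algebra\<close> decides.\<close>
  have e: "a / (2 * q\<^sup>2) - 2 * b / q ^ 3 = (q * a - 4 * b) / (2 * q ^ 3)" if "0 < q" for a b q :: real
    using that by (simp add: field_simps power2_eq_square power3_eq_cube)
  have n: "?q * (cut_num d x y + x * (12 * x * y\<^sup>2 + 2 * d\<^sup>2 * x)) - 4 * (x\<^sup>2 * cut_num d x y) +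
     (?q * (cut_num d y x + y * (12 * y * x\<^sup>2 + 2 * d\<^sup>2 * y)) - 4 * (y\<^sup>2 * cut_num d y x)) = 2 * ?q ^ 3"
    unfolding cut_num_def cut_den_def by algebra
  show ?thesis
    unfolding axis_cut_x_def q mult.assoc e[OF \<open>0 < ?q\<close>] add_divide_distrib[symmetric] n[unfolded mult.assoc]
    using \<open>0 < ?q\<close> by simp
qed

lemma abs_le_half_cut_den: "\<bar>x * y\<bar> \<le> cut_den d x y / 2" "\<bar>x * d\<bar> \<le> cut_den d x y / 2"
proof -
  have "\<bar>x * y\<bar> \<le> (x\<^sup>2 + y\<^sup>2) / 2" for x y :: real
    using sum_squares_bound[of "\<bar>x\<bar>" "\<bar>y\<bar>"] by (simp add: abs_mult)
  from this[of x y] this[of x d] show "\<bar>x * y\<bar> \<le> cut_den d x y / 2" "\<bar>x * d\<bar> \<le> cut_den d x y / 2"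
    unfolding cut_den_def by (smt (verit) zero_le_power2 divide_right_mono)+
qed

text \<open>Both quotients are homogeneous of degree 0 in (x, y, d), so a bound free of
  \<open>d\<close> is possible; they contribute 5 and 6. The derivative in the other variable is
  smaller, and the constant 11 is shared.\<close>

lemma abs_axis_cut_x_le:
  assumes "0 < d" shows "\<bar>axis_cut_x d x y\<bar> \<le> 11"
proof -
  let ?q = "cut_den d x y" and ?n = "cut_num d x y"
  have q: "0 < ?q" using cut_den_pos[OF assms] .
  have x: "x\<^sup>2 \<le> ?q" by (simp add: cut_den_def)
  have "x * (12 * x * y\<^sup>2 + 2 * d\<^sup>2 * x) = 12 * (x * y)\<^sup>2 + 2 * (x * d)\<^sup>2" by (simp add: power2_eq_square algebra_simps)
  moreover have "(x * y)\<^sup>2 \<le> ?q\<^sup>2 / 4" "(x * d)\<^sup>2 \<le> ?q\<^sup>2 / 4"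
    using power_mono[OF abs_le_half_cut_den(1)[of x y d], of 2] power_mono[OF abs_le_half_cut_den(2)[of x d y], of 2]
    by (simp_all add: power_divide)
  ultimately have "\<bar>?n + x * (12 * x * y\<^sup>2 + 2 * d\<^sup>2 * x)\<bar> \<le> 10 * ?q\<^sup>2"
    using cut_num_bounds[of d x y] by (simp add: abs_le_iff)
  then have "\<bar>(?n + x * (12 * x * y\<^sup>2 + 2 * d\<^sup>2 * x)) / (2 * ?q\<^sup>2)\<bar> \<le> 5"
    using q by (simp add: abs_divide divide_le_eq)
  moreover have "x\<^sup>2 * ?n \<le> ?q * (3 * ?q\<^sup>2)"
    by (intro mult_mono x cut_num_bounds) (use q in auto)
  then have "\<bar>2 * x\<^sup>2 * ?n / ?q ^ 3\<bar> \<le> 6"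
    using q cut_num_bounds(1)[of d x y] by (simp add: abs_divide abs_mult divide_le_eq power3_eq_cube power2_eq_square)
  ultimately show ?thesis unfolding axis_cut_x_def by linarith
qed

lemma abs_axis_cut_y_le:
  assumes "0 < d" shows "\<bar>axis_cut_y d x y\<bar> \<le> 11"
proof -
  let ?q = "cut_den d x y" and ?n = "cut_num d x y"
  have q: "0 < ?q" using cut_den_pos[OF assms] .
  have "x * (12 * x\<^sup>2 * y + 8 * y ^ 3 + 10 * d\<^sup>2 * y) = (x * y) * (12 * x\<^sup>2 + 8 * y\<^sup>2 + 10 * d\<^sup>2)"
    by (simp add: power2_eq_square power3_eq_cube algebra_simps)
  note e = this
  have "\<bar>(x * y) * (12 * x\<^sup>2 + 8 * y\<^sup>2 + 10 * d\<^sup>2)\<bar> \<le> (?q / 2) * (12 * ?q)"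
    unfolding abs_mult by (intro mult_mono abs_le_half_cut_den(1)[unfolded abs_mult]) (use q in \<open>auto simp: cut_den_def\<close>)
  then have "\<bar>x * (12 * x\<^sup>2 * y + 8 * y ^ 3 + 10 * d\<^sup>2 * y) / (2 * ?q\<^sup>2)\<bar> \<le> 3"
    unfolding e using q by (simp add: abs_divide divide_le_eq power2_eq_square)
  moreover have "\<bar>x * y\<bar> * ?n \<le> (?q / 2) * (3 * ?q\<^sup>2)"
    by (intro mult_mono abs_le_half_cut_den cut_num_bounds) (use q in auto)
  then have "\<bar>2 * x * y * ?n / ?q ^ 3\<bar> \<le> 3"
    using q cut_num_bounds(1)[of d x y] by (simp add: abs_divide abs_mult divide_le_eq power3_eq_cube power2_eq_square)
  ultimately show ?thesis unfolding axis_cut_y_def by linarith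
qed

text \<open>Two estimates are combined: 3/2 |x|, good near the axis x = 0, and 3/2 |y| + d/4, good
  near the axis y = 0.\<close>

lemma abs_axis_cut_le:
  assumes "0 < d" shows "\<bar>axis_cut d x y\<bar> \<le> d + 2 * min \<bar>x\<bar> \<bar>y\<bar>"
proof -
  let ?q = "cut_den d x y" and ?n = "cut_num d x y"
  have q: "0 < ?q" using cut_den_pos[OF assms] .
  have "\<bar>x\<bar> * ?n \<le> \<bar>x\<bar> * (3 * ?q\<^sup>2)"
    by (intro mult_left_mono cut_num_bounds) auto
  then have 1: "\<bar>axis_cut d x y\<bar> \<le> 3 / 2 * \<bar>x\<bar>"
    using q cut_num_bounds(1)[of d x y] by (simp add: axis_cut_def abs_divide abs_mult divide_le_eq power2_eq_square)
  \<comment> \<open>Terms of the numerator that contain \<open>y\<close> give up one factor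
    \<open>y\<close>; the remaining ones contain d^2 and give up one factor
    \<open>d\<close>.\<close>
  have "x * ?n = y * ((x * y) * (6 * x\<^sup>2 + 2 * y\<^sup>2 + 5 * d\<^sup>2)) + d * ((x * d) * (x\<^sup>2 + d\<^sup>2))"
    unfolding cut_num_def by algebra
  moreover have "\<bar>y * ((x * y) * (6 * x\<^sup>2 + 2 * y\<^sup>2 + 5 * d\<^sup>2))\<bar> \<le> \<bar>y\<bar> * ((?q / 2) * (6 * ?q))"
    unfolding abs_mult by (intro mult_mono abs_le_half_cut_den(1)[unfolded abs_mult]) (use q in \<open>auto simp: cut_den_def\<close>)
  moreover have "\<bar>d * ((x * d) * (x\<^sup>2 + d\<^sup>2))\<bar> \<le> d * ((?q / 2) * ?q)"
    unfolding abs_mult by (intro mult_mono abs_le_half_cut_den(2)[unfolded abs_mult]) (use q assms in \<open>auto simp: cut_den_def\<close>)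
  moreover have "\<bar>y\<bar> * ((?q / 2) * (6 * ?q)) + d * ((?q / 2) * ?q) = (3 * \<bar>y\<bar> + d / 2) * ?q\<^sup>2"
    by algebra
  ultimately have "\<bar>x * ?n\<bar> \<le> (3 * \<bar>y\<bar> + d / 2) * ?q\<^sup>2"
    by linarith
  then have "\<bar>axis_cut d x y\<bar> \<le> (3 * \<bar>y\<bar> + d / 2) / 2"
    using q unfolding axis_cut_def by (simp add: abs_divide divide_le_eq)
  with 1 assms show ?thesis by (auto simp: min_def)
qed

lemma axis_cut_has_derivative:
  assumes "0 < d"
  shows "((\<lambda>(x, y). axis_cut d x y) has_derivative (\<lambda>(h, k). axis_cut_x d x y * h + axis_cut_y d x y * k)) (at (x, y))"
proof -
  have q: "cut_den d x y \<noteq> 0" using cut_den_pos[OF assms, of x y] by simp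
  have N: "((\<lambda>z. fst z * cut_num d (fst z) (snd z)) has_derivative
      (\<lambda>h. (cut_num d x y + x * (12 * x * y\<^sup>2 + 2 * d\<^sup>2 * x)) * fst h + x * (12 * x\<^sup>2 * y + 8 * y ^ 3 + 10 * d\<^sup>2 * y) * snd h)) (at (x, y))"
    unfolding cut_num_def
    by (auto intro!: derivative_eq_intros simp: algebra_simps power2_eq_square power3_eq_cube power4_eq_xxxx)
  have Q: "((\<lambda>z. 2 * (cut_den d (fst z) (snd z))\<^sup>2) has_derivative
      (\<lambda>h. 8 * cut_den d x y * (x * fst h + y * snd h))) (at (x, y))"
    unfolding cut_den_def
    by (auto intro!: derivative_eq_intros simp: algebra_simps power2_eq_square)
  have "((\<lambda>z. axis_cut d (fst z) (snd z)) has_derivative (\<lambda>h. axis_cut_x d x y * fst h + axis_cut_y d x y * snd h)) (at (x, y))"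
    unfolding axis_cut_def
    by (rule has_derivative_eq_rhs[OF has_derivative_divide'[OF N Q]])
      (use q in \<open>auto simp: axis_cut_x_def axis_cut_y_def field_simps power2_eq_square power3_eq_cube\<close>)
  then show ?thesis by (simp add: case_prod_unfold)
qed

lemma continuous_axis_cut_derivs:
  assumes "0 < d" "continuous_on S f" "continuous_on S g"
  shows "continuous_on S (\<lambda>z. axis_cut_x d (f z) (g z))" "continuous_on S (\<lambda>z. axis_cut_y d (f z) (g z))"
proof -
  have "0 < cut_den d x y" for x y by (rule cut_den_pos[OF assms(1)])
  then have q: "cut_den d x y \<noteq> 0" for x y by (metis less_irrefl)
  have N: "continuous_on S (\<lambda>z. cut_num d (f z) (g z))" and Q: "continuous_on S (\<lambda>z. cut_den d (f z) (g z))"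
    unfolding cut_num_def cut_den_def by (intro continuous_intros assms)+
  show "continuous_on S (\<lambda>z. axis_cut_x d (f z) (g z))" "continuous_on S (\<lambda>z. axis_cut_y d (f z) (g z))"
    unfolding axis_cut_x_def axis_cut_y_def using q by (intro continuous_intros N Q assms ballI; simp)+
qed

lemma axis_cut_compose_has_derivative:
  assumes "0 < d" "\<phi> differentiable (at z)" "\<psi> differentiable (at z)"
  shows "((\<lambda>z. axis_cut d (\<phi> z) (\<psi> z)) has_derivative
    (\<lambda>h. axis_cut_x d (\<phi> z) (\<psi> z) * (fst h * fst (grad \<phi> z) + snd h * snd (grad \<phi> z)) +
         axis_cut_y d (\<phi> z) (\<psi> z) * (fst h * fst (grad \<psi> z) + snd h * snd (grad \<psi> z)))) (at z)"
  using has_derivative_compose[OF has_derivative_Pair[OF has_derivative_grad[OF assms(2)] has_derivative_grad[OF assms(3)]]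
     axis_cut_has_derivative[OF assms(1), of "\<phi> z" "\<psi> z"]] by simp

lemma grad_axis_cut:
  assumes "0 < d" "\<phi> differentiable (at z)" "\<psi> differentiable (at z)"
  shows "grad (\<lambda>z. axis_cut d (\<phi> z) (\<psi> z)) z =
    (axis_cut_x d (\<phi> z) (\<psi> z) * fst (grad \<phi> z) + axis_cut_y d (\<phi> z) (\<psi> z) * fst (grad \<psi> z),
     axis_cut_x d (\<phi> z) (\<psi> z) * snd (grad \<phi> z) + axis_cut_y d (\<phi> z) (\<psi> z) * snd (grad \<psi> z))"
  using grad_eqI[OF axis_cut_compose_has_derivative[OF assms]] by simp

lemma C1_axis_cut:
  assumes "0 < d" "Ck 1 \<phi>" "Ck 1 \<psi>"
  shows "Ck 1 (\<lambda>z. axis_cut d (\<phi> z) (\<psi> z))"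
proof -
  have D: "\<phi> differentiable (at z)" "\<psi> differentiable (at z)" for z using assms by auto
  have c: "continuous_on UNIV \<phi>" "continuous_on UNIV \<psi>" using assms Ck_continuous by blast+
  show ?thesis
    using axis_cut_compose_has_derivative[OF assms(1) D] assms(2,3)
    by (auto simp: grad_axis_cut[OF assms(1) D] differentiable_def
        intro!: continuous_intros continuous_axis_cut_derivs[OF assms(1) c])
qed

lemma norm_grad_axis_cut_le:
  assumes "0 < d" "\<phi> differentiable (at z)" "\<psi> differentiable (at z)"
  shows "norm (grad (\<lambda>z. axis_cut d (\<phi> z) (\<psi> z)) z) \<le> 11 * norm (grad \<phi> z) + 11 * norm (grad \<psi> z)"
proof -
  have "grad (\<lambda>z. axis_cut d (\<phi> z) (\<psi> z)) z =
    axis_cut_x d (\<phi> z) (\<psi> z) *\<^sub>R grad \<phi> z + axis_cut_y d (\<phi> z) (\<psi> z) *\<^sub>R grad \<psi> z"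
    by (simp add: grad_axis_cut[OF assms] prod_eq_iff)
  then show ?thesis
    by (auto intro!: norm_triangle_le add_mono mult_right_mono abs_axis_cut_x_le abs_axis_cut_y_le assms)
qed

text \<open>In the Jacobian of \<open>axis_cut d \<phi> \<psi>\<close> with \<psi> the part along
  the gradient of \<psi> drops out, leaving \<open>axis_cut_x\<close> times the Jacobian of \<phi>
  and \<psi>. The mirrored term has the opposite sign, and the two factors add up to the divergence
  1.\<close>

lemma Jac_split:
  assumes "0 < d" "\<phi> differentiable (at z)" "\<psi> differentiable (at z)"
  shows "Jac \<phi> \<psi> z =
    Jac (\<lambda>z. axis_cut d (\<phi> z) (\<psi> z)) \<psi> z - Jac (\<lambda>z. axis_cut d (\<psi> z) (\<phi> z)) \<phi> z"
proof -
  have "Jac (\<lambda>z. axis_cut d (\<phi> z) (\<psi> z)) \<psi> z - Jac (\<lambda>z. axis_cut d (\<psi> z) (\<phi> z)) \<phi> z =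
     (axis_cut_x d (\<phi> z) (\<psi> z) + axis_cut_x d (\<psi> z) (\<phi> z)) * Jac \<phi> \<psi> z"
    by (simp add: Jac_def grad_axis_cut[OF assms(1,2,3)] grad_axis_cut[OF assms(1,3,2)] algebra_simps)
  then show ?thesis by (simp add: axis_cut_divergence[OF assms(1)])
qed

subsection \<open>Integration of directional derivatives along lines\<close>

lemma integrable_bounded_support:
  fixes F :: "'a::euclidean_space \<Rightarrow> real"
  assumes "F \<in> borel_measurable borel" "bounded S" "\<And>z. z \<notin> S \<Longrightarrow> F z = 0" "\<And>z. \<bar>F z\<bar> \<le> B"
  shows "integrable lborel F"
proof -
  obtain a b where ab: "S \<subseteq> cbox a b"
    using bounded_subset_cbox_symmetric[OF assms(2)] by metis
  have "integrable lborel (\<lambda>z. B * indicator (cbox a b) z :: real)"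
    using emeasure_bounded_finite[OF bounded_cbox, of a b]
    by (intro integrable_mult_right integrable_real_indicator) (auto simp: less_top)
  then show ?thesis
  proof (rule Bochner_Integration.integrable_bound)
    have "norm (F z) \<le> norm (B * indicator (cbox a b) z)" for z
      using assms(3)[of z] assms(4)[of z] ab by (cases "z \<in> cbox a b") auto
    then show "AE z in lborel. norm (F z) \<le> norm (B * indicator (cbox a b) z)" by simp
  qed (use assms in auto)
qed

text \<open>The coordinates (t, c) with x = c + m t preserve area, and bounded support justifies
  exchanging the order of integration.\<close>

lemma integral_shear:
  fixes F :: "real \<times> real \<Rightarrow> real"
  assumes F: "F \<in> borel_measurable borel" and S: "\<And>z. z \<notin> cball 0 R \<Longrightarrow> F z = 0" and B: "\<And>z. \<bar>F z\<bar> \<le> B"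
  shows "(\<integral>z. F z \<partial>lborel) = (\<integral>c. (\<integral>t. F (t, c + m * t) \<partial>lborel) \<partial>lborel)"
proof -
  have "integrable lborel F"
    by (rule integrable_bounded_support[OF F bounded_cball S B])
  then have 1: "integrable (lborel \<Otimes>\<^sub>M lborel) (\<lambda>(t, x). F (t, x))"
    by (simp add: lborel_prod)
  let ?H = "\<lambda>(t, c). F (t, c + m * t)"
  have H: "integrable (lborel \<Otimes>\<^sub>M lborel) ?H"
    unfolding lborel_prod
  \<comment> \<open>If (t, c + m t) lies in the ball of radius \<open>R\<close>, then |t| is at most
    R and |c| at most R (1 + |m|).\<close>
  proof (rule integrable_bounded_support[of _ "cball 0 (R + R * (1 + \<bar>m\<bar>))"])
    have "(\<lambda>z. F (fst z, snd z + m * fst z)) \<in> borel_measurable borel"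
      by (rule measurable_compose[OF _ F]) (intro borel_measurable_continuous_onI continuous_intros)
    then show "?H \<in> borel_measurable borel" by (simp add: case_prod_unfold)
    fix z :: "real \<times> real"
    show "\<bar>?H z\<bar> \<le> B" using B by (simp add: case_prod_unfold)
    assume z: "z \<notin> cball 0 (R + R * (1 + \<bar>m\<bar>))"
    show "?H z = 0"
    proof (rule ccontr)
      assume "?H z \<noteq> 0"
      then have "norm (fst z, snd z + m * fst z) \<le> R"
        using S[of "(fst z, snd z + m * fst z)"] by (auto simp: case_prod_unfold)
      then have a: "\<bar>fst z\<bar> \<le> R" "\<bar>snd z + m * fst z\<bar> \<le> R"
        using norm_fst_le[of "fst z" "snd z + m * fst z"] norm_snd_le[of "snd z + m * fst z" "fst z"] by auto
      then have "\<bar>m * fst z\<bar> \<le> \<bar>m\<bar> * R" by (simp add: abs_mult mult_left_mono)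
      with a have "\<bar>snd z\<bar> \<le> R + \<bar>m\<bar> * R" by linarith
      then have "norm z \<le> R + (R + \<bar>m\<bar> * R)"
        using norm_Pair_le[of "fst z" "snd z"] a(1) by simp
      with z show False by (simp add: algebra_simps)
    qed
  qed simp
  have "(\<integral>z. F z \<partial>lborel) = (\<integral>t. (\<integral>x. F (t, x) \<partial>lborel) \<partial>lborel)"
    using lborel_pair.integral_fst[OF 1] by (simp add: lborel_prod)
  also have "(\<lambda>t. \<integral>x. F (t, x) \<partial>lborel) = (\<lambda>t. \<integral>c. F (t, c + m * t) \<partial>lborel)"
  proof
    show "(\<integral>x. F (t, x) \<partial>lborel) = (\<integral>c. F (t, c + m * t) \<partial>lborel)" for t
      using lborel_integral_real_affine[of 1 "\<lambda>x. F (t, x)" "m * t"] by (simp add: add.commute)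
  qed
  also have "(\<integral>t. (\<integral>c. F (t, c + m * t) \<partial>lborel) \<partial>lborel) = (\<integral>c. (\<integral>t. F (t, c + m * t) \<partial>lborel) \<partial>lborel)"
    using lborel_pair.Fubini_integral[OF H] by simp
  finally show ?thesis .
qed

text \<open>The direction (1, m) is not normalised: on the line x = c + m t this is the plain
  derivative in \<open>t\<close>, so the fundamental theorem of calculus brings no extra
  factor.\<close>

definition slope_deriv :: "real \<Rightarrow> (real \<times> real \<Rightarrow> real) \<Rightarrow> real \<times> real \<Rightarrow> real" where
  "slope_deriv m u z = fst (grad u z) + m * snd (grad u z)"

lemma grad_zero_outside:
  fixes u :: "real \<times> real \<Rightarrow> real"
  assumes "\<And>z. z \<notin> S \<Longrightarrow> u z = 0" "closed S" "z \<notin> S"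
  shows "grad u z = (0, 0)"
proof -
  have "(u has_derivative (\<lambda>_. 0)) (at z)"
    by (rule has_derivative_transform_within_open[where f = "\<lambda>_. 0" and s = "- S"])
      (use assms in \<open>auto simp: open_Compl\<close>)
  then show ?thesis by (simp add: grad_eqI)
qed

lemma continuous_slope_deriv:
  assumes "Ck 1 u" shows "continuous_on UNIV (slope_deriv m u)"
  using assms unfolding slope_deriv_def[abs_def] by (auto intro!: continuous_intros)

lemma slope_deriv_bounded:
  assumes "Ck 1 u" "\<And>z. z \<notin> cball 0 R \<Longrightarrow> u z = 0"
  obtains B where "\<And>z. \<bar>slope_deriv m u z\<bar> \<le> B"
proof -
  have "bounded (slope_deriv m u ` cball 0 R)"
    by (intro compact_imp_bounded compact_continuous_image continuous_on_subset[OF continuous_slope_deriv[OF assms(1)]]) auto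
  then obtain B where B: "0 < B" "\<And>z. z \<in> cball 0 R \<Longrightarrow> \<bar>slope_deriv m u z\<bar> \<le> B"
    unfolding bounded_pos by auto
  have "slope_deriv m u z = 0" if "z \<notin> cball 0 R" for z
    using grad_zero_outside[OF assms(2) closed_cball that] by (simp add: slope_deriv_def)
  then have "\<bar>slope_deriv m u z\<bar> \<le> B" for z
    using B by (cases "z \<in> cball 0 R") auto
  then show ?thesis by (rule that)
qed

lemma slope_deriv_DERIV:
  assumes "Ck 1 u"
  shows "((\<lambda>t. u (t, c + m * t)) has_real_derivative slope_deriv m u (t, c + m * t)) (at t)"
  using has_real_derivative_line[of u 0 t 1 c m] assms by (simp add: slope_deriv_def mult.commute)

text \<open>On each line of slope \<open>m\<close> the set \<open>G\<close> is, up to one point, the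
  half-line t > \<tau> c. The fundamental theorem of calculus leaves only the value at its lower
  end, which explains the sign.\<close>

lemma integral_slope_deriv_above:
  assumes u: "Ck 1 u" "\<And>z. z \<notin> cball 0 R \<Longrightarrow> u z = 0" and G: "G \<in> sets borel"
    and \<tau>: "\<And>c t. \<tau> c < t \<Longrightarrow> (t, c + m * t) \<in> G" "\<And>c t. t < \<tau> c \<Longrightarrow> (t, c + m * t) \<notin> G"
  shows "(\<integral>z. indicator G z * slope_deriv m u z \<partial>lborel) = - (\<integral>c. u (\<tau> c, c + m * \<tau> c) \<partial>lborel)"
proof -
  obtain B where B: "\<And>z. \<bar>slope_deriv m u z\<bar> \<le> B" using slope_deriv_bounded[OF u] by blast
  then have "0 \<le> B" by (meson abs_ge_zero order_trans)
  have X0: "slope_deriv m u z = 0" if "z \<notin> cball 0 R" for z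
    using grad_zero_outside[OF u(2) closed_cball that] by (simp add: slope_deriv_def)
  have sm: "slope_deriv m u \<in> borel_measurable borel"
    using continuous_slope_deriv[OF u(1)] by (rule borel_measurable_continuous_onI)
  have "(\<integral>z. indicator G z * slope_deriv m u z \<partial>lborel) =
    (\<integral>c. (\<integral>t. indicator G (t, c + m * t) * slope_deriv m u (t, c + m * t) \<partial>lborel) \<partial>lborel)"
    by (rule integral_shear[of _ R B]) (use G sm X0 B \<open>0 \<le> B\<close> in \<open>auto simp: indicator_def\<close>)
  also have "(\<lambda>c. \<integral>t. indicator G (t, c + m * t) * slope_deriv m u (t, c + m * t) \<partial>lborel) = (\<lambda>c. - u (\<tau> c, c + m * \<tau> c))"
  proof
    fix c
    \<comment> \<open>Not before \<tau> c and strictly beyond the support, so the upper end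
      contributes 0.\<close>
    define T where "T = max R (\<tau> c) + 1"
    have T: "\<tau> c \<le> T" "R < T" by (auto simp: T_def)
    have out: "(t, c + m * t) \<notin> cball 0 R" if "T \<le> t" for t
      using that T norm_fst_le[of t "c + m * t"] by auto
    let ?g = "\<lambda>t. slope_deriv m u (t, c + m * t)"
    have g: "isCont ?g t" for t
      by (intro continuous_intros continuous_on_interior[OF continuous_on_compose2[OF continuous_slope_deriv[OF u(1)]], of UNIV])
        (auto intro!: continuous_intros)
    have gm: "?g \<in> borel_measurable borel"
      using g by (intro borel_measurable_continuous_onI continuous_at_imp_continuous_on) auto
    have Gm: "(\<lambda>t. indicator G (t, c + m * t) :: real) \<in> borel_measurable borel"
      by (rule measurable_compose[OF _ borel_measurable_indicator[OF G]])
        (intro borel_measurable_continuous_onI continuous_intros)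
    have "(\<integral>t. indicator G (t, c + m * t) * ?g t \<partial>lborel) = (\<integral>t. ?g t * indicator {\<tau> c..T} t \<partial>lborel)"
    proof (rule integral_cong_AE)
      have eq: "indicator G (t, c + m * t) * ?g t = ?g t * indicator {\<tau> c..T} t" if "t \<noteq> \<tau> c" for t
        using \<tau>[of c t] \<tau>(2)[of t c] that X0[OF out, of t] by (auto simp: indicator_def not_le)
      show "AE t in lborel. indicator G (t, c + m * t) * ?g t = ?g t * indicator {\<tau> c..T} t"
        using AE_lborel_singleton[of "\<tau> c"] by eventually_elim (rule eq)
    qed (use gm Gm in auto)
    also have "\<dots> = u (T, c + m * T) - u (\<tau> c, c + m * \<tau> c)"
      by (rule integral_FTC_Icc_real[OF T(1) slope_deriv_DERIV[OF u(1)] g])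
    finally show "(\<integral>t. indicator G (t, c + m * t) * ?g t \<partial>lborel) = - u (\<tau> c, c + m * \<tau> c)"
      using u(2)[OF out, of T] by simp
  qed
  finally show ?thesis by simp
qed

lemma integral_slope_deriv_UNIV:
  assumes u: "Ck 1 u" "\<And>z. z \<notin> cball 0 R \<Longrightarrow> u z = 0"
  shows "(\<integral>z. slope_deriv m u z \<partial>lborel) = 0"
proof -
  obtain B where B: "\<And>z. \<bar>slope_deriv m u z\<bar> \<le> B" using slope_deriv_bounded[OF u] by blast
  have X0: "slope_deriv m u z = 0" if "z \<notin> cball 0 R" for z
    using grad_zero_outside[OF u(2) closed_cball that] by (simp add: slope_deriv_def)
  have sm: "slope_deriv m u \<in> borel_measurable borel"
    using continuous_slope_deriv[OF u(1)] by (rule borel_measurable_continuous_onI)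
  \<comment> \<open>A half-plane that contains the support and whose edge avoids it reduces the
    integral over the plane to the case of half-lines. The absolute value covers negative
    \<open>R\<close>.\<close>
  define G :: "(real \<times> real) set" where "G = {z. - \<bar>R\<bar> - 1 < fst z}"
  have "open G" unfolding G_def by (intro open_Collect_less continuous_intros)
  then have G: "G \<in> sets borel" by auto
  have out: "z \<notin> cball 0 R" if "fst z \<le> - \<bar>R\<bar> - 1" for z :: "real \<times> real"
    using that norm_fst_le[of "fst z" "snd z"] by auto
  have "slope_deriv m u z = indicator G z * slope_deriv m u z" for z
    using X0[OF out, of z] by (auto simp: G_def indicator_def)
  then have "(\<integral>z. slope_deriv m u z \<partial>lborel) = (\<integral>z. indicator G z * slope_deriv m u z \<partial>lborel)"
    by (rule Bochner_Integration.integral_cong[OF refl])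
  also have "\<dots> = - (\<integral>c. u (- \<bar>R\<bar> - 1, c + m * (- \<bar>R\<bar> - 1)) \<partial>lborel)"
    by (rule integral_slope_deriv_above[OF u G, where \<tau> = "\<lambda>_. - \<bar>R\<bar> - 1"]) (auto simp: G_def)
  also have "\<dots> = 0"
    using u(2)[OF out] by simp
  finally show ?thesis .
qed

text \<open>The complement of \<open>G\<close> consists of the upper half-lines, and the integral
  over the whole plane is zero.\<close>

lemma integral_slope_deriv_below:
  assumes u: "Ck 1 u" "\<And>z. z \<notin> cball 0 R \<Longrightarrow> u z = 0" and G: "G \<in> sets borel"
    and \<tau>: "\<And>c t. t < \<tau> c \<Longrightarrow> (t, c + m * t) \<in> G" "\<And>c t. \<tau> c < t \<Longrightarrow> (t, c + m * t) \<notin> G"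
  shows "(\<integral>z. indicator G z * slope_deriv m u z \<partial>lborel) = (\<integral>c. u (\<tau> c, c + m * \<tau> c) \<partial>lborel)"
proof -
  obtain B where B: "\<And>z. \<bar>slope_deriv m u z\<bar> \<le> B" using slope_deriv_bounded[OF u] by blast
  then have "0 \<le> B" by (meson abs_ge_zero order_trans)
  have X0: "slope_deriv m u z = 0" if "z \<notin> cball 0 R" for z
    using grad_zero_outside[OF u(2) closed_cball that] by (simp add: slope_deriv_def)
  have sm: "slope_deriv m u \<in> borel_measurable borel"
    using continuous_slope_deriv[OF u(1)] by (rule borel_measurable_continuous_onI)
  have int: "integrable lborel (\<lambda>z. indicator A z * slope_deriv m u z)" if "A \<in> sets borel" for A
    by (rule integrable_bounded_support[of _ "cball 0 R" B]) (use that sm X0 B \<open>0 \<le> B\<close> in \<open>auto simp: indicator_def\<close>)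
  have "(\<integral>z. slope_deriv m u z \<partial>lborel) =
      (\<integral>z. indicator G z * slope_deriv m u z + indicator (- G) z * slope_deriv m u z \<partial>lborel)"
    by (intro Bochner_Integration.integral_cong) (auto simp: indicator_def)
  also have "\<dots> = (\<integral>z. indicator G z * slope_deriv m u z \<partial>lborel) + (\<integral>z. indicator (- G) z * slope_deriv m u z \<partial>lborel)"
    using G by (intro Bochner_Integration.integral_add int) auto
  also have "(\<integral>z. indicator (- G) z * slope_deriv m u z \<partial>lborel) = - (\<integral>c. u (\<tau> c, c + m * \<tau> c) \<partial>lborel)"
    using G \<tau> by (intro integral_slope_deriv_above[OF u]) auto
  finally show ?thesis using integral_slope_deriv_UNIV[OF u] by simp
qed

subsection \<open>Boundary integrals along a transversal family of lines\<close>

text \<open>The projection along lines of slope \<open>m\<close> is Lipschitz with constant 1 + |m|,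
  so a cover of \<open>A\<close> yields a cover of \<open>S\<close> by intervals of comparable
  length. No smallness of the cover is used, hence the content at scale 1 is enough.\<close>

lemma emeasure_slope_projection_le:
  fixes A :: "(real \<times> real) set"
  assumes S: "\<And>c. c \<in> S \<Longrightarrow> \<exists>z\<in>A. snd z - m * fst z = c"
  shows "emeasure lborel S \<le> ennreal (2 * (1 + \<bar>m\<bar>)) * hausdorff_outer A"
proof -
  define K where "K = 2 * (1 + \<bar>m\<bar>)"
  have K: "0 < K" by (simp add: K_def)
  let ?\<pi> = "\<lambda>z :: real \<times> real. snd z - m * fst z"
  have \<pi>: "\<bar>?\<pi> z - ?\<pi> w\<bar> \<le> K / 2 * dist z w" for z w
  proof -
    have "\<bar>?\<pi> z - ?\<pi> w\<bar> \<le> \<bar>snd z - snd w\<bar> + \<bar>m\<bar> * \<bar>fst z - fst w\<bar>"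
      unfolding abs_mult[symmetric] by (simp add: algebra_simps)
    also have "\<dots> \<le> dist z w + \<bar>m\<bar> * dist z w"
      using dist_fst_le[of z w] dist_snd_le[of z w] by (intro add_mono mult_left_mono) (auto simp: dist_real_def)
    finally show ?thesis by (simp add: K_def algebra_simps)
  qed
  have "emeasure lborel S / ennreal K \<le> hausdorff_content 1 A"
    unfolding hausdorff_content_def
  proof (rule INF_greatest)
    fix U :: "nat \<Rightarrow> (real \<times> real) set"
    assume "U \<in> {U. A \<subseteq> (\<Union>i. U i) \<and> (\<forall>i. bounded (U i) \<and> diameter (U i) \<le> 1)}"
    then have U: "A \<subseteq> (\<Union>i. U i)" "\<And>i. bounded (U i)" by auto
    \<comment> \<open>The image of a covering set need not be measurable. It is enclosed in an
      interval centred at the image of one of its points, which costs the factor 2.\<close>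
    define V where "V i = (if U i = {} then {} else
      {?\<pi> (SOME z. z \<in> U i) - K / 2 * diameter (U i) .. ?\<pi> (SOME z. z \<in> U i) + K / 2 * diameter (U i)})" for i
    have d: "0 \<le> diameter (U i)" for i by (rule diameter_ge_0[OF U(2)])
    have VS: "?\<pi> z \<in> V i" if "z \<in> U i" for z i
    proof -
      have "(SOME z. z \<in> U i) \<in> U i" using that by (rule someI)
      then have "dist z (SOME z. z \<in> U i) \<le> diameter (U i)"
        using diameter_bounded_bound[OF U(2) that] by blast
      then have "K / 2 * dist z (SOME z. z \<in> U i) \<le> K / 2 * diameter (U i)"
        using K by (intro mult_left_mono) auto
      then have "\<bar>?\<pi> z - ?\<pi> (SOME z. z \<in> U i)\<bar> \<le> K / 2 * diameter (U i)"
        using \<pi>[of z "SOME z. z \<in> U i"] by linarith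
      then show ?thesis using that unfolding V_def abs_le_iff by auto
    qed
    have Vm: "V i \<in> sets lborel" for i by (simp add: V_def)
    have "S \<subseteq> (\<Union>i. V i)"
    proof
      fix c assume "c \<in> S"
      then obtain z where z: "z \<in> A" "?\<pi> z = c" using S by blast
      then obtain i where "z \<in> U i" using U(1) by blast
      then show "c \<in> (\<Union>i. V i)" using VS z(2) by blast
    qed
    then have "emeasure lborel S \<le> emeasure lborel (\<Union>i. V i)"
      using Vm by (intro emeasure_mono) auto
    also have "\<dots> \<le> (\<Sum>i. emeasure lborel (V i))"
      using Vm by (intro emeasure_subadditive_countably) auto
    also have "\<dots> \<le> (\<Sum>i. ennreal K * ennreal (diameter (U i)))"
    proof (intro suminf_le)
      show "emeasure lborel (V i) \<le> ennreal K * ennreal (diameter (U i))" for i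
        using d[of i] K unfolding V_def by (auto simp: ennreal_mult'[symmetric] field_simps)
    qed auto
    also have "\<dots> = ennreal K * (\<Sum>i. ennreal (diameter (U i)))"
      by (rule ennreal_suminf_cmult)
    finally show "emeasure lborel S / ennreal K \<le> (\<Sum>i. ennreal (diameter (U i)))"
      using K by (intro divide_le_posI_ennreal) auto
  qed
  also have "\<dots> \<le> hausdorff_outer A"
    unfolding hausdorff_outer_def by (rule SUP_upper) auto
  finally have "ennreal K * (emeasure lborel S / ennreal K) \<le> ennreal K * hausdorff_outer A"
    by (rule mult_left_mono) simp
  moreover have "ennreal K * (emeasure lborel S / ennreal K) = emeasure lborel S"
    using K by (simp add: ennreal_times_divide mult.commute[of "ennreal K"] mult_divide_eq_ennreal)
  ultimately show ?thesis by (simp add: K_def)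
qed

lemma sets_boundary_measure: "sets (boundary_measure \<Omega>) = sets (restrict_space borel (frontier \<Omega>))"
  unfolding boundary_measure_def by (rule sets_restrict_space_cong) simp

lemma space_boundary_measure [simp]: "space (boundary_measure \<Omega>) = frontier \<Omega>"
  by (simp add: boundary_measure_def space_restrict_space)

lemma emeasure_boundary_measure:
  assumes "A \<in> sets (boundary_measure \<Omega>)"
  shows "emeasure (boundary_measure \<Omega>) A = hausdorff_outer A"
proof -
  have f: "frontier \<Omega> \<inter> space hausdorff_measure \<in> sets hausdorff_measure"
    by (simp add: borel_closed frontier_closed)
  have "A \<subseteq> frontier \<Omega>" "A \<in> sets borel"
    using assms borel_closed[OF frontier_closed, of \<Omega>] by (auto simp: sets_boundary_measure sets_restrict_space_iff)
  then show ?thesis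
    unfolding boundary_measure_def by (subst emeasure_restrict_space[OF f]) (auto simp: emeasure_hausdorff_measure)
qed

lemma borel_measurable_boundary:
  "w \<in> borel_measurable borel \<Longrightarrow> w \<in> borel_measurable (boundary_measure \<Omega>)"
  unfolding measurable_cong_sets[OF sets_boundary_measure refl] by (rule measurable_restrict_space1)

lemma ennreal_power2_le_imp_le:
  assumes "x\<^sup>2 \<le> (ennreal b)\<^sup>2" "0 \<le> b" shows "x \<le> ennreal b"
proof (cases x)
  case (real a)
  then show ?thesis using assms by (auto simp: ennreal_power intro: power2_le_imp_le ennreal_leI)
next
  case top
  then show ?thesis using assms by (simp add: ennreal_power top_unique)
qed

text \<open>Lebesgue measure on the parameters \<open>c\<close> whose points lie in the ball is
  pushed forward to a measure \<open>N\<close> on the boundary; the projection estimate says that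
  \<open>N\<close> is at most a constant times the boundary measure. The constant depends only on
  the curve and the ball and is therefore chosen before \<open>w\<close>, \<delta> and
  \<open>k\<close>.\<close>

lemma boundary_line_integral_bound:
  fixes \<Omega> :: "(real \<times> real) set"
  assumes \<tau>: "\<tau> \<in> borel_measurable borel"
    and front: "\<And>c. (\<tau> c, c + m * \<tau> c) \<in> ball z0 r \<Longrightarrow> (\<tau> c, c + m * \<tau> c) \<in> frontier \<Omega>"
  shows "\<exists>K\<ge>0. \<forall>w \<delta> k. w \<in> borel_measurable borel \<longrightarrow> 0 \<le> \<delta> \<longrightarrow> k \<in> L2 (boundary_measure \<Omega>) \<longrightarrow>
    (AE z in boundary_measure \<Omega>. \<bar>w z\<bar> \<le> \<delta> + k z) \<longrightarrow> (\<forall>z. z \<notin> ball z0 r \<longrightarrow> w z = (0::real)) \<longrightarrow>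
    \<bar>\<integral>c. w (\<tau> c, c + m * \<tau> c) \<partial>lborel\<bar> \<le> K * (\<delta> + L2norm (boundary_measure \<Omega>) k)"
proof -
  let ?P = "\<lambda>c. (\<tau> c, c + m * \<tau> c)" and ?M = "boundary_measure \<Omega>"
  define I where "I = ?P -` ball z0 r"
  have P[measurable]: "?P \<in> borel_measurable borel"
    using \<tau> unfolding borel_prod[symmetric] by measurable
  have I: "I \<in> sets borel"
    unfolding I_def using measurable_sets[OF P, of "ball z0 r"] by simp
  \<comment> \<open>Boundedness gives the parameter set a finite length \<open>L\<close>, and this
    length is what multiplies \<delta> below.\<close>
  have "bounded I"
  proof (rule boundedI)
    fix c assume "c \<in> I"
    then have "?P c \<in> ball z0 r" by (simp add: I_def)
    then have "norm (?P c) \<le> norm z0 + r"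
      using norm_triangle_sub[of "?P c" z0] unfolding mem_ball dist_norm norm_minus_commute[of z0] by linarith
    then have "\<bar>\<tau> c\<bar> \<le> norm z0 + r" "\<bar>c + m * \<tau> c\<bar> \<le> norm z0 + r"
      using norm_fst_le[of "\<tau> c" "c + m * \<tau> c"] norm_snd_le[of "c + m * \<tau> c" "\<tau> c"] by auto
    moreover from this(1) have "\<bar>m * \<tau> c\<bar> \<le> \<bar>m\<bar> * (norm z0 + r)"
      unfolding abs_mult by (intro mult_left_mono) auto
    ultimately show "norm c \<le> norm z0 + r + \<bar>m\<bar> * (norm z0 + r)" by simp
  qed
  then have Ifin: "emeasure lborel I < \<infinity>" by (rule emeasure_bounded_finite)
  define L where "L = measure lborel I"
  have L: "emeasure lborel I = ennreal L" "0 \<le> L"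
    using Ifin by (auto simp: L_def emeasure_eq_ennreal_measure)
  define C where "C = 2 * (1 + \<bar>m\<bar>)"
  have C: "0 \<le> C" by (simp add: C_def)
  define N where "N = distr (restrict_space lborel I) ?M ?P"
  have PN: "?P \<in> measurable (restrict_space lborel I) ?M"
    unfolding measurable_cong_sets[OF refl sets_boundary_measure]
    by (intro measurable_restrict_space2 measurable_restrict_space1) (use front I_def in \<open>auto simp: space_restrict_space\<close>)
  have le: "emeasure N A \<le> ennreal C * emeasure ?M A" if "A \<in> sets ?M" for A
  proof -
    have "emeasure N A = emeasure lborel (?P -` A \<inter> I)"
      unfolding N_def using that PN I measurable_sets[OF PN that]
      by (subst emeasure_distr[OF PN that], subst emeasure_restrict_space) (auto simp: space_restrict_space)
    also have "\<dots> \<le> ennreal C * hausdorff_outer A"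
      unfolding C_def by (rule emeasure_slope_projection_le) force
    finally show ?thesis using emeasure_boundary_measure[OF that] by simp
  qed
  have "N \<le> scale_measure (ennreal C) ?M"
    by (subst le_measure) (use le in \<open>auto simp: N_def\<close>)
  then have nn_le: "nn_integral N f \<le> ennreal C * nn_integral ?M f" if "f \<in> borel_measurable ?M" for f
    using nn_integral_mono_measure[of N "scale_measure (ennreal C) ?M" f] nn_integral_scale_measure[OF that, of "ennreal C"]
    by (simp add: N_def)
  have fM: "frontier \<Omega> \<in> sets ?M" using sets.top[of ?M] by simp
  have Nsp: "emeasure N (space N) = ennreal L"
    unfolding N_def L(1)[symmetric]
    by (subst emeasure_distr[OF PN]) (use measurable_space[OF PN] I fM in
      \<open>auto simp: space_restrict_space emeasure_restrict_space intro!: arg_cong[of _ _ "emeasure lborel"]\<close>)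
  show ?thesis
  proof (intro exI[of _ "L + sqrt (C * L)"] conjI allI impI)
    show "0 \<le> L + sqrt (C * L)" using C L by simp
    fix w :: "real \<times> real \<Rightarrow> real" and \<delta> k
    assume w: "w \<in> borel_measurable borel" and \<delta>: "0 \<le> \<delta>" and k: "k \<in> L2 ?M"
      and ae: "AE z in ?M. \<bar>w z\<bar> \<le> \<delta> + k z" and w0: "\<forall>z. z \<notin> ball z0 r \<longrightarrow> w z = 0"
    have wM: "w \<in> borel_measurable ?M" using w by (rule borel_measurable_boundary)
    have km[measurable]: "k \<in> borel_measurable ?M" using L2_D(1)[OF k] .
    have kN[measurable]: "k \<in> borel_measurable N" using km by (simp add: N_def)
    have "AE z in N. \<bar>w z\<bar> \<le> \<delta> + k z"
    proof -
      have "{z \<in> space ?M. \<not> \<bar>w z\<bar> \<le> \<delta> + k z} \<in> null_sets ?M"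
        using ae by (subst (asm) AE_iff_null) (use wM km in measurable)
      then have "{z \<in> space ?M. \<not> \<bar>w z\<bar> \<le> \<delta> + k z} \<in> null_sets N"
        using le by (fastforce simp: null_sets_def N_def)
      then show ?thesis by (rule AE_I') (simp add: N_def)
    qed
    then have ae': "AE z in N. ennreal \<bar>w z\<bar> \<le> ennreal \<delta> + ennreal \<bar>k z\<bar>"
      by eventually_elim (use \<delta> in \<open>auto simp: ennreal_plus[symmetric] simp del: ennreal_plus intro!: ennreal_leI\<close>)
    \<comment> \<open>Cauchy-Schwarz against the constant 1 turns the integral of |k| into its L2
      norm for \<open>N\<close>, which the boundary norm dominates.\<close>
    have "(\<integral>\<^sup>+z. ennreal \<bar>k z\<bar> * 1 \<partial>N)\<^sup>2 \<le> (\<integral>\<^sup>+z. (ennreal \<bar>k z\<bar>)\<^sup>2 \<partial>N) * (\<integral>\<^sup>+z. 1\<^sup>2 \<partial>N)"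
      by (rule Cauchy_Schwarz_nn_integral) measurable
    also have "\<dots> = (\<integral>\<^sup>+z. ennreal ((norm (k z))\<^sup>2) \<partial>N) * ennreal L"
      by (simp add: Nsp ennreal_power)
    also have "\<dots> \<le> (ennreal C * (\<integral>\<^sup>+z. ennreal ((norm (k z))\<^sup>2) \<partial>?M)) * ennreal L"
      by (intro mult_right_mono nn_le) measurable
    also have "(\<integral>\<^sup>+z. ennreal ((norm (k z))\<^sup>2) \<partial>?M) = ennreal ((L2norm ?M k)\<^sup>2)"
      unfolding L2norm_sq using L2_D(2)[OF k] by (intro nn_integral_eq_integral) auto
    also have "ennreal C * ennreal ((L2norm ?M k)\<^sup>2) * ennreal L = ennreal ((sqrt (C * L) * L2norm ?M k)\<^sup>2)"
      using C L by (simp add: ennreal_mult[symmetric] power_mult_distrib mult_ac)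
    also have "\<dots> = (ennreal (sqrt (C * L) * L2norm ?M k))\<^sup>2"
      using C L by (simp add: ennreal_power)
    finally have k1: "(\<integral>\<^sup>+z. ennreal \<bar>k z\<bar> \<partial>N) \<le> ennreal (sqrt (C * L) * L2norm ?M k)"
      unfolding mult_1_right by (rule ennreal_power2_le_imp_le) (use C L in simp)
    have "(\<integral>\<^sup>+c. ennreal (norm (w (?P c))) \<partial>lborel) = (\<integral>\<^sup>+c. ennreal \<bar>w (?P c)\<bar> * indicator I c \<partial>lborel)"
      by (intro nn_integral_cong) (use w0 in \<open>auto simp: I_def indicator_def\<close>)
    also have "\<dots> = (\<integral>\<^sup>+c. ennreal \<bar>w (?P c)\<bar> \<partial>restrict_space lborel I)"
      by (subst nn_integral_restrict_space) (use I in auto)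
    also have "\<dots> = (\<integral>\<^sup>+z. ennreal \<bar>w z\<bar> \<partial>N)"
      unfolding N_def using wM by (intro nn_integral_distr[OF PN, symmetric]) measurable
    also have "\<dots> \<le> (\<integral>\<^sup>+z. ennreal \<delta> + ennreal \<bar>k z\<bar> \<partial>N)"
      by (rule nn_integral_mono_AE[OF ae'])
    also have "\<dots> = ennreal \<delta> * ennreal L + (\<integral>\<^sup>+z. ennreal \<bar>k z\<bar> \<partial>N)"
      by (subst nn_integral_add) (simp_all add: Nsp)
    also have "\<dots> \<le> ennreal \<delta> * ennreal L + ennreal (sqrt (C * L) * L2norm ?M k)"
      by (intro add_left_mono k1)
    also have "\<dots> = ennreal (\<delta> * L + sqrt (C * L) * L2norm ?M k)"
      using \<delta> L C by (simp add: ennreal_mult ennreal_plus)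
    finally have *: "(\<integral>\<^sup>+c. ennreal (norm (w (?P c))) \<partial>lborel) \<le> ennreal (\<delta> * L + sqrt (C * L) * L2norm ?M k)" .
    have nn: "0 \<le> \<delta> * L + sqrt (C * L) * L2norm ?M k" using \<delta> L C by simp
    have "(\<lambda>c. w (?P c)) \<in> borel_measurable lborel"
      using measurable_compose[OF P w] by simp
    then have int: "integrable lborel (\<lambda>c. w (?P c))"
      by (rule integrableI_bounded) (rule le_less_trans[OF * ennreal_less_top[folded infinity_ennreal_def]])
    have "ennreal (norm (\<integral>c. w (?P c) \<partial>lborel)) \<le> (\<integral>\<^sup>+c. ennreal (norm (w (?P c))) \<partial>lborel)"
      by (rule integral_norm_bound_ennreal[OF int])
    from order_trans[OF this *] have "\<bar>\<integral>c. w (?P c) \<partial>lborel\<bar> \<le> \<delta> * L + sqrt (C * L) * L2norm ?M k"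
      unfolding ennreal_le_iff[OF nn] real_norm_def .
    also have "\<dots> \<le> (L + sqrt (C * L)) * (\<delta> + L2norm ?M k)"
      using \<delta> L C by (simp add: algebra_simps)
    finally show "\<bar>\<integral>c. w (?P c) \<partial>lborel\<bar> \<le> (L + sqrt (C * L)) * (\<delta> + L2norm ?M k)" .
  qed
qed

subsection \<open>Transversal slopes at a Lipschitz boundary\<close>

text \<open>
  Allowing the bound \<open>\<delta> + k\<close> instead of \<open>k\<close> takes care of the error \<open>d\<close> in \<open>axis_cut d\<close> without knowing that
  the boundary has finite length.
\<close>

definition slope_bound :: "(real \<times> real) set \<Rightarrow> real \<times> real \<Rightarrow> real \<Rightarrow> real \<Rightarrow> bool" where
  "slope_bound \<Omega> z0 s m \<longleftrightarrow> (\<exists>K\<ge>0. \<forall>u \<delta> k. Ck 1 u \<longrightarrow> (\<forall>z. z \<notin> cball z0 s \<longrightarrow> u z = 0) \<longrightarrow> 0 \<le> \<delta> \<longrightarrow>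
     k \<in> L2 (boundary_measure \<Omega>) \<longrightarrow> (AE z in boundary_measure \<Omega>. \<bar>u z\<bar> \<le> \<delta> + k z) \<longrightarrow>
     \<bar>\<integral>z. slope_deriv m u z \<partial>lebesgue_on \<Omega>\<bar> \<le> K * (\<delta> + L2norm (boundary_measure \<Omega>) k))"

text \<open>A chart describes \<Omega> only near \<open>z0\<close>, whereas integration along whole
  lines needs a global set. As \<open>u\<close> lives where the two agree, \<Omega> may be traded
  for \<open>G\<close>.\<close>

lemma integral_slope_deriv_local:
  assumes \<Omega>: "open \<Omega>" and G: "G \<in> sets borel" and eq: "\<And>z. z \<in> cball z0 s \<Longrightarrow> z \<in> \<Omega> \<longleftrightarrow> z \<in> G"
    and u: "Ck 1 u" "\<And>z. z \<notin> cball z0 s \<Longrightarrow> u z = 0"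
  shows "(\<integral>z. slope_deriv m u z \<partial>lebesgue_on \<Omega>) = (\<integral>z. indicator G z * slope_deriv m u z \<partial>lborel)"
proof -
  have sm: "slope_deriv m u \<in> borel_measurable borel"
    using continuous_slope_deriv[OF u(1)] by (rule borel_measurable_continuous_onI)
  have "(\<integral>z. slope_deriv m u z \<partial>lebesgue_on \<Omega>) = (\<integral>z. indicator \<Omega> z * slope_deriv m u z \<partial>lebesgue)"
    using \<Omega> by (subst integral_restrict_space) auto
  also have "\<dots> = (\<integral>z. indicator G z * slope_deriv m u z \<partial>lebesgue)"
  proof (rule Bochner_Integration.integral_cong[OF refl])
    fix z show "indicator \<Omega> z * slope_deriv m u z = indicator G z * slope_deriv m u z"
    proof (cases "z \<in> cball z0 s")
      case True
      then show ?thesis using eq[of z] by (simp add: indicator_def)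
    next
      case False
      from grad_zero_outside[OF u(2) closed_cball this] show ?thesis by (simp add: slope_deriv_def)
    qed
  qed
  also have "\<dots> = (\<integral>z. indicator G z * slope_deriv m u z \<partial>lborel)"
    using sm G by (intro integral_completion) auto
  finally show ?thesis .
qed

lemma vanishing_outside_cball:
  fixes z0 :: "'a::real_normed_vector"
  assumes "\<And>z. z \<notin> cball z0 s \<Longrightarrow> u z = 0" "z \<notin> cball 0 (norm z0 + s)"
  shows "u z = 0"
proof (rule assms(1))
  show "z \<notin> cball z0 s"
    using assms(2) norm_triangle_sub[of z z0] by (auto simp: dist_norm norm_minus_commute)
qed

lemma slope_bound_interior:
  assumes "open \<Omega>" "cball z0 s \<subseteq> \<Omega>"
  shows "slope_bound \<Omega> z0 s m"
  unfolding slope_bound_def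
proof (intro exI[of _ 0] conjI allI impI)
  fix u :: "real \<times> real \<Rightarrow> real"
  assume u: "Ck 1 u" "\<forall>z. z \<notin> cball z0 s \<longrightarrow> u z = 0"
  have "(\<integral>z. slope_deriv m u z \<partial>lebesgue_on \<Omega>) = (\<integral>z. indicator UNIV z * slope_deriv m u z \<partial>lborel)"
    by (rule integral_slope_deriv_local[OF assms(1), of UNIV z0 s]) (use assms u in auto)
  also have "\<dots> = 0"
    using integral_slope_deriv_UNIV[OF u(1) vanishing_outside_cball[of z0 s u]] u(2) by simp
  finally show "\<bar>\<integral>z. slope_deriv m u z \<partial>lebesgue_on \<Omega>\<bar> \<le> 0 * (\<delta> + L2norm (boundary_measure \<Omega>) k)" for \<delta> k
    by simp
qed simp

lemma strictly_increasing_zero: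
  fixes h :: "real \<Rightarrow> real"
  assumes "continuous_on UNIV h" "0 < \<kappa>" and inc: "\<And>t t'. t' \<le> t \<Longrightarrow> \<kappa> * (t - t') \<le> h t - h t'"
  obtains \<tau> where "h \<tau> = 0" "\<And>t. \<tau> < t \<Longrightarrow> 0 < h t" "\<And>t. t < \<tau> \<Longrightarrow> h t < 0"
proof -
  define T where "T = \<bar>h 0\<bar> / \<kappa>"
  have T: "0 \<le> T" "\<kappa> * T = \<bar>h 0\<bar>" using assms(2) by (auto simp: T_def)
  have "0 \<le> h T" "h (- T) \<le> 0" using inc[of 0 T] inc[of "- T" 0] T by auto
  then obtain \<tau> where \<tau>: "h \<tau> = 0"
    using IVT'[of h "- T" 0 T] T(1) continuous_on_subset[OF assms(1)] by force
  have "0 < h t" if "\<tau> < t" for t using inc[of \<tau> t] mult_pos_pos[of \<kappa> "t - \<tau>"] \<tau> that assms(2) by linarith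
  moreover have "h t < 0" if "t < \<tau>" for t using inc[of t \<tau>] mult_pos_pos[of \<kappa> "\<tau> - t"] \<tau> that assms(2) by linarith
  ultimately show ?thesis using \<tau> that by blast
qed

lemma frontier_pointI:
  fixes z :: "real \<times> real"
  assumes z: "z \<notin> \<Omega>" and seq: "\<And>t. 0 < t \<Longrightarrow> z + t *\<^sub>R e \<in> G" and B: "open B" "z \<in> B" "\<And>w. w \<in> B \<Longrightarrow> w \<in> \<Omega> \<longleftrightarrow> w \<in> G"
  shows "z \<in> frontier \<Omega>"
proof -
  have lim: "((\<lambda>t. z + t *\<^sub>R e) \<longlongrightarrow> z + 0 *\<^sub>R e) (at_right 0)"
    by (intro tendsto_intros)
  then have "\<forall>\<^sub>F t in at_right 0. z + t *\<^sub>R e \<in> B"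
    using B by (intro topological_tendstoD) auto
  then have "\<forall>\<^sub>F t in at_right 0. z + t *\<^sub>R e \<in> \<Omega>"
    using eventually_at_right_less[of "0::real"] by eventually_elim (use seq B in auto)
  then have "z \<in> closure \<Omega>"
    using lim by (intro Lim_in_closed_set[OF closed_closure, of "\<lambda>t. z + t *\<^sub>R e" _ "at_right 0"])
      (auto elim!: eventually_mono intro: closure_subset[THEN subsetD])
  then show ?thesis using z interior_subset by (auto simp: frontier_def)
qed

text \<open>Along every line of slope \<open>m\<close> the function \<sigma> g grows at least at
  rate \<kappa>, so the line crosses the zero set of \<open>g\<close> exactly once, at \<tau> c. The
  sign \<sigma> records whether \<Omega> lies after or before the crossing.\<close>

lemma slope_bound_monotone_lines:
  fixes g :: "real \<times> real \<Rightarrow> real"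
  assumes \<Omega>: "open \<Omega>" and s: "s < r" and g: "continuous_on UNIV g"
    and eq: "\<And>z. z \<in> ball z0 r \<Longrightarrow> z \<in> \<Omega> \<longleftrightarrow> 0 < g z"
    and \<kappa>: "0 < \<kappa>" and \<sigma>: "\<sigma> = 1 \<or> \<sigma> = - 1"
    and mono: "\<And>c t t'. t' \<le> t \<Longrightarrow> \<kappa> * (t - t') \<le> \<sigma> * g (t, c + m * t) - \<sigma> * g (t', c + m * t')"
  shows "slope_bound \<Omega> z0 s m"
proof -
  have gc: "continuous_on UNIV (\<lambda>x. g (f x))" if "continuous_on UNIV f" for f :: "real \<Rightarrow> real \<times> real"
    by (rule continuous_on_compose2[OF g that]) auto
  have "\<exists>\<tau>. \<sigma> * g (\<tau>, c + m * \<tau>) = 0 \<and> (\<forall>t>\<tau>. 0 < \<sigma> * g (t, c + m * t)) \<and> (\<forall>t<\<tau>. \<sigma> * g (t, c + m * t) < 0)" for c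
  proof -
    have "continuous_on UNIV (\<lambda>t. \<sigma> * g (t, c + m * t))"
      by (intro continuous_intros gc)
    then obtain \<tau> where "\<sigma> * g (\<tau>, c + m * \<tau>) = 0" "\<And>t. \<tau> < t \<Longrightarrow> 0 < \<sigma> * g (t, c + m * t)"
      "\<And>t. t < \<tau> \<Longrightarrow> \<sigma> * g (t, c + m * t) < 0"
      using strictly_increasing_zero[OF _ \<kappa> mono] by blast
    then show ?thesis by (intro exI[of _ \<tau>]) simp
  qed
  then obtain \<tau> where \<tau>: "\<And>c. g (\<tau> c, c + m * \<tau> c) = 0" "\<And>c t. \<tau> c < t \<Longrightarrow> 0 < \<sigma> * g (t, c + m * t)"
     "\<And>c t. t < \<tau> c \<Longrightarrow> \<sigma> * g (t, c + m * t) < 0"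
    using \<sigma> by (metis mult_eq_0_iff zero_neq_neg_one zero_neq_one)
  have "\<tau> \<in> borel_measurable borel"
  proof (rule borel_measurable_iff_less[THEN iffD2], intro allI)
    fix a
    \<comment> \<open>The crossing comes before \<open>a\<close> exactly if \<sigma> g is already
      positive at some q < a; this is an open condition on \<open>c\<close>, so \<tau> is
      measurable.\<close>
    have "{c. \<tau> c < a} = (\<Union>q\<in>{..<a}. {c. 0 < \<sigma> * g (q, c + m * q)})"
    proof (intro equalityI subsetI)
      fix c assume "c \<in> {c. \<tau> c < a}"
      then obtain q where "\<tau> c < q" "q < a" using dense by auto
      then show "c \<in> (\<Union>q\<in>{..<a}. {c. 0 < \<sigma> * g (q, c + m * q)})" using \<tau>(2) by auto
    next
      fix c assume "c \<in> (\<Union>q\<in>{..<a}. {c. 0 < \<sigma> * g (q, c + m * q)})"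
      then obtain q where q: "q < a" "0 < \<sigma> * g (q, c + m * q)" by auto
      have "\<not> q \<le> \<tau> c" using \<tau>(1)[of c] \<tau>(3)[of q c] q(2) by (cases "q = \<tau> c") auto
      then show "c \<in> {c. \<tau> c < a}" using q(1) by simp
    qed
    moreover have "open {c. 0 < \<sigma> * g (q, c + m * q)}" for q
      by (intro open_Collect_less continuous_intros gc)
    ultimately have "open {c. \<tau> c < a}" by auto
    then show "{w \<in> space borel. \<tau> w < a} \<in> sets borel" by simp
  qed
  note \<tau>m = this
  define G where "G = {z. 0 < g z}"
  have "open G" unfolding G_def by (intro open_Collect_less continuous_intros g)
  then have G: "G \<in> sets borel" by auto
  have eqG: "z \<in> ball z0 r \<Longrightarrow> z \<in> \<Omega> \<longleftrightarrow> z \<in> G" for z using eq by (simp add: G_def)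
  have front: "(\<tau> c, c + m * \<tau> c) \<in> frontier \<Omega>" if "(\<tau> c, c + m * \<tau> c) \<in> ball z0 r" for c
  \<comment> \<open>Moving from the crossing in the direction \<sigma> (1, m) enters
    \<open>G\<close>, so the crossing is a limit of points of \<Omega> outside \<Omega>.\<close>
  proof (rule frontier_pointI[OF _ _ open_ball that eqG])
    show "(\<tau> c, c + m * \<tau> c) \<notin> \<Omega>" using eq[OF that] \<tau>(1) by simp
    fix t :: real assume "0 < t"
    then have "0 < g (\<tau> c + \<sigma> * t, c + m * (\<tau> c + \<sigma> * t))"
      using \<sigma> \<tau>(2)[of c "\<tau> c + t"] \<tau>(3)[of "\<tau> c - t" c] by auto
    then show "(\<tau> c, c + m * \<tau> c) + t *\<^sub>R (\<sigma>, m * \<sigma>) \<in> G"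
      by (simp add: G_def algebra_simps)
  qed
  obtain K where K: "0 \<le> K" "\<And>w \<delta> k. w \<in> borel_measurable borel \<Longrightarrow> 0 \<le> \<delta> \<Longrightarrow> k \<in> L2 (boundary_measure \<Omega>) \<Longrightarrow>
    (AE z in boundary_measure \<Omega>. \<bar>w z\<bar> \<le> \<delta> + k z) \<Longrightarrow> (\<forall>z. z \<notin> ball z0 r \<longrightarrow> w z = (0::real)) \<Longrightarrow>
    \<bar>\<integral>c. w (\<tau> c, c + m * \<tau> c) \<partial>lborel\<bar> \<le> K * (\<delta> + L2norm (boundary_measure \<Omega>) k)"
    using boundary_line_integral_bound[OF \<tau>m front] by blast
  show ?thesis
    unfolding slope_bound_def
  proof (intro exI[of _ K] conjI allI impI K(1))
    fix u \<delta> k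
    assume u: "Ck 1 u" "\<forall>z. z \<notin> cball z0 s \<longrightarrow> u z = 0" and \<delta>: "0 \<le> \<delta>" and k: "k \<in> L2 (boundary_measure \<Omega>)"
      and ae: "AE z in boundary_measure \<Omega>. \<bar>u z\<bar> \<le> \<delta> + k z"
    have um: "u \<in> borel_measurable borel"
      using Ck_continuous[OF u(1)] by (rule borel_measurable_continuous_onI)
    have sub: "cball z0 s \<subseteq> ball z0 r" using s by auto
    have e: "(\<integral>z. slope_deriv m u z \<partial>lebesgue_on \<Omega>) = (\<integral>z. indicator G z * slope_deriv m u z \<partial>lborel)"
      by (rule integral_slope_deriv_local[OF \<Omega> G, of z0 s]) (use u sub eqG in auto)
    have van: "z \<notin> cball 0 (norm z0 + s) \<Longrightarrow> u z = 0" for z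
      using vanishing_outside_cball[of z0 s u] u(2) by blast
    have "\<bar>\<integral>z. slope_deriv m u z \<partial>lebesgue_on \<Omega>\<bar> = \<bar>\<integral>c. u (\<tau> c, c + m * \<tau> c) \<partial>lborel\<bar>"
      using \<sigma>
    proof
      assume "\<sigma> = 1"
      then show ?thesis
        unfolding e using \<tau> by (subst integral_slope_deriv_above[OF u(1) van G, where \<tau> = \<tau>]) (auto simp: G_def not_less less_imp_le)
    next
      assume "\<sigma> = - 1"
      then show ?thesis
        unfolding e using \<tau> by (subst integral_slope_deriv_below[OF u(1) van G, where \<tau> = \<tau>]) (auto simp: G_def not_less less_imp_le)
    qed
    also have "\<dots> \<le> K * (\<delta> + L2norm (boundary_measure \<Omega>) k)"
      by (rule K(2)[OF um \<delta> k ae]) (use u(2) sub in blast)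
    finally show "\<bar>\<integral>z. slope_deriv m u z \<partial>lebesgue_on \<Omega>\<bar> \<le> K * (\<delta> + L2norm (boundary_measure \<Omega>) k)" .
  qed
qed

text \<open>The assumption on \<open>m\<close> says that in chart coordinates the line is steeper
  than the graph. The height above the graph is then monotone along it, at rate |b| - L |a| and in
  the direction given by the sign of \<open>b\<close>.\<close>

lemma slope_bound_graph:
  fixes T :: "real \<times> real \<Rightarrow> real \<times> real"
  assumes \<Omega>: "open \<Omega>" and s: "s < r" and T: "linear T" and \<gamma>: "L-lipschitz_on UNIV \<gamma>"
    and eq: "\<And>w. w \<in> ball z0 r \<Longrightarrow> w \<in> \<Omega> \<longleftrightarrow> \<gamma> (fst (T w)) < snd (T w)"
    and m: "L * \<bar>fst (T (1, m))\<bar> < \<bar>snd (T (1, m))\<bar>"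
  shows "slope_bound \<Omega> z0 s m"
proof (rule slope_bound_monotone_lines[OF \<Omega> s])
  let ?g = "\<lambda>z. snd (T z) - \<gamma> (fst (T z))"
  let ?a = "fst (T (1, m))" and ?b = "snd (T (1, m))"
  interpret linear T by fact
  have Tc: "continuous_on UNIV T"
    using T by (intro linear_continuous_on) (simp add: linear_conv_bounded_linear)
  have \<gamma>c: "continuous_on UNIV \<gamma>" using \<gamma> by (rule lipschitz_on_continuous_on)
  show "continuous_on UNIV ?g"
    by (intro continuous_intros Tc continuous_on_compose2[OF \<gamma>c]) auto
  show "z \<in> \<Omega> \<longleftrightarrow> 0 < ?g z" if "z \<in> ball z0 r" for z
    using eq[OF that] by simp
  show "0 < \<bar>?b\<bar> - L * \<bar>?a\<bar>" using m by simp
  have "0 \<le> L * \<bar>?a\<bar>" using lipschitz_on_nonneg[OF \<gamma>] by simp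
  then have b0: "?b \<noteq> 0" using m by auto
  then show "sgn ?b = 1 \<or> sgn ?b = - 1" by (auto simp: sgn_real_def)
  fix c t t' :: real assume t: "t' \<le> t"
  have "T (x, c + m * x) = T (0, c) + x *\<^sub>R T (1, m)" for x
    using add[of "(0, c)" "x *\<^sub>R (1, m)"] scale[of x "(1, m)"] by (simp add: mult.commute)
  note Tx = this
  have "\<bar>\<gamma> (fst (T (t, c + m * t))) - \<gamma> (fst (T (t', c + m * t')))\<bar> \<le> L * \<bar>fst (T (t, c + m * t)) - fst (T (t', c + m * t'))\<bar>"
    using lipschitz_onD[OF \<gamma>, of "fst (T (t, c + m * t))" "fst (T (t', c + m * t'))"] by (simp add: dist_real_def)
  also have "fst (T (t, c + m * t)) - fst (T (t', c + m * t')) = (t - t') * ?a"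
    by (simp add: Tx algebra_simps)
  also have "L * \<bar>(t - t') * ?a\<bar> = L * \<bar>?a\<bar> * (t - t')"
    using t by (simp add: abs_mult)
  finally have 1: "\<bar>\<gamma> (fst (T (t, c + m * t))) - \<gamma> (fst (T (t', c + m * t')))\<bar> \<le> L * \<bar>?a\<bar> * (t - t')" .
  have 2: "snd (T (t, c + m * t)) - snd (T (t', c + m * t')) = (t - t') * ?b"
    by (simp add: Tx algebra_simps)
  define D where "D = t - t'"
  have pos: "Y - X \<le> (s1 - g1) - (s2 - g2)" and neg: "- Y - X \<le> - (s1 - g1) + (s2 - g2)"
    if "\<bar>g1 - g2\<bar> \<le> X" "s1 - s2 = Y" for g1 g2 X s1 s2 Y :: real
    using that by linarith+
  have 3: "(\<bar>?b\<bar> - L * \<bar>?a\<bar>) * D = \<bar>?b\<bar> * D - L * \<bar>?a\<bar> * D"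
    by (rule left_diff_distrib)
  have "(\<bar>?b\<bar> - L * \<bar>?a\<bar>) * D \<le> sgn ?b * ?g (t, c + m * t) - sgn ?b * ?g (t', c + m * t')"
  proof (cases "0 < ?b")
    case True
    then have e: "sgn ?b = 1" "D * ?b = \<bar>?b\<bar> * D" by auto
    show ?thesis
      using pos[OF 1 2, folded D_def] unfolding 3 e by simp
  next
    case False
    then have "?b < 0" using b0 by simp
    then have e: "sgn ?b = - 1" "- (D * ?b) = \<bar>?b\<bar> * D" by auto
    show ?thesis
      using neg[OF 1 2, folded D_def] unfolding 3 e by simp
  qed
  then show "(\<bar>?b\<bar> - L * \<bar>?a\<bar>) * (t - t') \<le> sgn ?b * ?g (t, c + m * t) - sgn ?b * ?g (t', c + m * t')"
    by (simp only: D_def)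
qed

text \<open>Two slopes are wanted because two directions recover both partial derivatives. One comes
  from the vertical direction of the chart; transversality is an open condition, so a neighbouring
  slope serves as the second.\<close>

lemma transversal_slopes:
  fixes T :: "real \<times> real \<Rightarrow> real \<times> real"
  assumes T: "orthogonal_transformation T" and L: "0 \<le> L"
  obtains m1 m2 where "m1 \<noteq> m2" "L * \<bar>fst (T (1, m1))\<bar> < \<bar>snd (T (1, m1))\<bar>" "L * \<bar>fst (T (1, m2))\<bar> < \<bar>snd (T (1, m2))\<bar>"
proof -
  interpret linear T using T by (rule orthogonal_transformation_linear)
  have Tm: "T (1, m) = T (1, 0) + m *\<^sub>R T (0, 1)" for m
    using add[of "(1, 0)" "m *\<^sub>R (0, 1)"] scale[of m "(0, 1)"] by simp
  obtain e where e: "T e = (0, 1)"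
    using orthogonal_transformation_surj[OF T] by (metis surjD)
  have ex: "\<exists>m. L * \<bar>fst (T (1, m))\<bar> < \<bar>snd (T (1, m))\<bar>"
  proof (cases "fst e = 0")
    case False
    have "T (1, snd e / fst e) = (1 / fst e) *\<^sub>R T e"
      using False by (subst scale[symmetric]) (simp add: scaleR_prod_def)
    then show ?thesis using False e by (intro exI[of _ "snd e / fst e"]) simp
  next
    case True
    have "snd e \<noteq> 0"
    proof
      assume "snd e = 0"
      with True have "e = 0" by (simp add: prod_eq_iff)
      with e zero show False by (simp add: zero_prod_def)
    qed
    have "e = snd e *\<^sub>R (0, 1)" using True by (simp add: prod_eq_iff)
    then have "T e = snd e *\<^sub>R T (0, 1)" by (metis scale)
    then have T01: "T (0, 1) = (0, 1 / snd e)"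
      using e \<open>snd e \<noteq> 0\<close> by (auto simp: prod_eq_iff field_simps)
    \<comment> \<open>Here the chart's vertical is parallel to the second axis and has no finite
      slope. Changing the slope now moves only the second chart coordinate, which is set to exceed L
      times the first in absolute value by 1.\<close>
    let ?m = "snd e * (L * \<bar>fst (T (1, 0))\<bar> + 1 - snd (T (1, 0)))"
    have "fst (T (1, ?m)) = fst (T (1, 0))" "snd (T (1, ?m)) = L * \<bar>fst (T (1, 0))\<bar> + 1"
      unfolding Tm[of ?m] T01 using \<open>snd e \<noteq> 0\<close> by auto
    moreover have "0 \<le> L * \<bar>fst (T (1, 0))\<bar>" using L by simp
    ultimately show ?thesis by (intro exI[of _ ?m]) simp
  qed
  then obtain m0 where m0: "m0 \<in> {m. L * \<bar>fst (T (1, m))\<bar> < \<bar>snd (T (1, m))\<bar>}" by blast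
  have "(\<lambda>m. T (1, m)) = (\<lambda>m. T (1, 0) + m *\<^sub>R T (0, 1))" by (rule ext) (rule Tm)
  then have Tc: "continuous_on UNIV (\<lambda>m. T (1, m))"
    by (rule ssubst) (intro continuous_intros)
  have "open {m. L * \<bar>fst (T (1, m))\<bar> < \<bar>snd (T (1, m))\<bar>}"
    by (intro open_Collect_less continuous_intros Tc)
  then obtain \<epsilon> where \<epsilon>: "0 < \<epsilon>" "ball m0 \<epsilon> \<subseteq> {m. L * \<bar>fst (T (1, m))\<bar> < \<bar>snd (T (1, m))\<bar>}"
    using m0 by (meson open_contains_ball)
  then have "m0 + \<epsilon> / 2 \<in> ball m0 \<epsilon>" by (simp add: dist_real_def)
  with \<epsilon>(2) have "m0 + \<epsilon> / 2 \<in> {m. L * \<bar>fst (T (1, m))\<bar> < \<bar>snd (T (1, m))\<bar>}" by blast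
  with m0 \<epsilon>(1) show ?thesis by (intro that[of m0 "m0 + \<epsilon> / 2"]) auto
qed

lemma two_slope_bounds:
  assumes \<Omega>: "open \<Omega>" "lipschitz_boundary \<Omega>" and z0: "z0 \<in> closure \<Omega>"
  obtains s m1 m2 where "0 < s" "m1 \<noteq> m2" "slope_bound \<Omega> z0 s m1" "slope_bound \<Omega> z0 s m2"
proof (cases "z0 \<in> \<Omega>")
  case True
  then obtain s where "0 < s" "cball z0 s \<subseteq> \<Omega>"
    using \<Omega>(1) open_contains_cball by blast
  \<comment> \<open>A ball inside \<Omega> does not see the boundary, so any two slopes do.\<close>
  then show ?thesis
    using that[of s 0 1] slope_bound_interior[OF \<Omega>(1)] by auto
next
  case False
  then have "z0 \<in> frontier \<Omega>" using z0 \<Omega>(1) by (simp add: frontier_def interior_open)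
  from bspec[OF \<Omega>(2)[unfolded lipschitz_boundary_def] this]
  obtain r T and \<gamma> :: "real \<Rightarrow> real" and L where c: "0 < r" "orthogonal_transformation T" "L-lipschitz_on UNIV \<gamma>"
    and chart: "\<forall>w\<in>ball z0 r. w \<in> \<Omega> \<longleftrightarrow> \<gamma> (fst (T w)) < snd (T w)"
    by (elim exE conjE) (rule that)
  obtain m1 m2 where m: "m1 \<noteq> m2" "L * \<bar>fst (T (1, m1))\<bar> < \<bar>snd (T (1, m1))\<bar>"
    "L * \<bar>fst (T (1, m2))\<bar> < \<bar>snd (T (1, m2))\<bar>"
    using transversal_slopes[OF c(2) lipschitz_on_nonneg[OF c(3)]] by blast
  \<comment> \<open>The closed support ball has to fit into the open chart ball.\<close>
  have "r / 2 < r" using c(1) by simp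
  note sb = slope_bound_graph[OF \<Omega>(1) this orthogonal_transformation_linear[OF c(2)] c(3)]
  have "slope_bound \<Omega> z0 (r / 2) m1"
    by (rule sb) (rule chart[rule_format], assumption, rule m(2))
  moreover have "slope_bound \<Omega> z0 (r / 2) m2"
    by (rule sb) (rule chart[rule_format], assumption, rule m(3))
  moreover have "0 < r / 2" using c(1) by simp
  ultimately show ?thesis
    using m(1) by (intro that[of "r / 2" m1 m2])
qed

subsection \<open>Green's formula as a bound for integrals of Jacobians\<close>

lemma Ck_fst [simp]: "Ck k fst" and Ck_snd [simp]: "Ck k snd"
proof -
  have "(fst has_derivative fst) (at z)" "(snd has_derivative snd) (at z)" for z :: "real \<times> real"
    by (auto intro!: derivative_eq_intros)
  note D = this
  show "Ck k fst" "Ck k snd"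
    by (cases k; auto simp: grad_eqI[OF D(1)] grad_eqI[OF D(2)] differentiable_def intro: D continuous_intros)+
qed

section \<open>Continuously differentiable cutoffs on balls\<close>

lemma C1_compose:
  assumes p: "\<And>x. (p has_real_derivative p' x) (at x)" and p': "continuous_on UNIV p'" and u: "Ck 1 u"
  shows "Ck 1 (\<lambda>z. p (u z))"
proof -
  have d: "u differentiable (at z)" for z using u by simp
  have D: "((\<lambda>z. p (u z)) has_derivative
      (\<lambda>h. p' (u z) * (fst h * fst (grad u z) + snd h * snd (grad u z)))) (at z)" for z
    using has_derivative_compose[OF has_derivative_grad[OF d[of z]] p[unfolded has_field_derivative_def]] .
  have "continuous_on UNIV (\<lambda>z. p' (u z))"
    by (rule continuous_on_compose2[OF p' Ck_continuous[OF u]]) auto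
  then show ?thesis
    using D u by (auto simp: grad_eqI[OF D] differentiable_def intro!: continuous_intros)
qed

text \<open>The squared positive part is \<open>Ck 1\<close>, which is all that Green's formula asks
  of the cutoffs.\<close>

definition pos_sq :: "real \<Rightarrow> real" where "pos_sq x = (max 0 x)\<^sup>2"

lemma pos_sq_has_derivative: "(pos_sq has_real_derivative 2 * max 0 x) (at x)"
proof -
  consider "0 < x" | "x < 0" | "x = 0" by linarith
  then show ?thesis
  proof cases
    case 1
    have "((\<lambda>x. x\<^sup>2) has_real_derivative 2 * max 0 x) (at x)"
      using 1 by (auto intro!: derivative_eq_intros)
    then show ?thesis
      by (rule has_field_derivative_transform_within_open[of _ _ _ "{0<..}"]) (use 1 in \<open>auto simp: pos_sq_def\<close>)
  next
    case 2
    have "((\<lambda>x. 0) has_real_derivative 2 * max 0 x) (at x)"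
      using 2 by simp
    then show ?thesis
      by (rule has_field_derivative_transform_within_open[of _ _ _ "{..<0}"]) (use 2 in \<open>auto simp: pos_sq_def\<close>)
  next
    case 3
    have "(\<lambda>h. max 0 h) \<midarrow>0\<rightarrow> max 0 (0::real)"
      by (intro tendsto_intros)
    moreover have "(pos_sq (0 + h) - pos_sq 0) / h = max 0 h" if "h \<noteq> 0" for h
      using that by (auto simp: pos_sq_def power2_eq_square max_def)
    ultimately show ?thesis
      using 3 by (simp add: DERIV_def cong: LIM_cong)
  qed
qed

text \<open>The inner \<open>pos_sq\<close> vanishes outside the ball of radius \<open>s\<close>;
  the outer map t to 1 - pos_sq (1 - t) sends 0 to 0 and every t from 1 on to 1. On the half ball
  the inner value is at least 9/16 s^4, so the scale 2 / s^4 lifts it above 1.\<close>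

definition ball_bump :: "real \<times> real \<Rightarrow> real \<Rightarrow> real \<times> real \<Rightarrow> real" where
  "ball_bump a s z = 1 - pos_sq (1 - pos_sq (s\<^sup>2 - ((fst z - fst a)\<^sup>2 + (snd z - snd a)\<^sup>2)) * (2 / s ^ 4))"

lemma C1_ball_bump: "Ck 1 (ball_bump a s)"
proof -
  have P: "Ck 1 (\<lambda>z. pos_sq (u z))" if "Ck 1 u" for u
    by (rule C1_compose[OF pos_sq_has_derivative _ that]) (intro continuous_intros)
  show ?thesis
    unfolding ball_bump_def[abs_def] power2_eq_square
    by (intro Ck_diff Ck_const P Ck_mult Ck_add Ck_fst Ck_snd)
qed

lemma ball_bump_bounds: "0 \<le> ball_bump a s z" "ball_bump a s z \<le> 1"
proof -
  have "0 \<le> pos_sq (s\<^sup>2 - ((fst z - fst a)\<^sup>2 + (snd z - snd a)\<^sup>2)) * (2 / s ^ 4)"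
    by (simp add: pos_sq_def)
  then show "0 \<le> ball_bump a s z" "ball_bump a s z \<le> 1"
    unfolding ball_bump_def by (auto simp: pos_sq_def[of "1 - _"] power_le_one)
qed

lemma dist_sq_pair: "(fst z - fst a)\<^sup>2 + (snd z - snd a)\<^sup>2 = (dist a (z :: real \<times> real))\<^sup>2"
  by (simp add: dist_prod_def dist_real_def power2_commute)

lemma ball_bump_zero:
  assumes "0 < s" "z \<notin> cball a s" shows "ball_bump a s z = 0"
proof -
  have "s\<^sup>2 \<le> (dist a z)\<^sup>2" using assms by (intro power_mono) auto
  then show ?thesis by (simp add: ball_bump_def dist_sq_pair pos_sq_def)
qed

lemma ball_bump_one:
  assumes "0 < s" "z \<in> ball a (s / 2)" shows "ball_bump a s z = 1"
proof -
  have "(dist a z)\<^sup>2 \<le> (s / 2)\<^sup>2" using assms by (intro power_mono) auto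
  then have "3 / 4 * s\<^sup>2 \<le> s\<^sup>2 - (dist a z)\<^sup>2" by (simp add: power_divide)
  then have "(3 / 4 * s\<^sup>2)\<^sup>2 \<le> pos_sq (s\<^sup>2 - (dist a z)\<^sup>2)"
    unfolding pos_sq_def by (intro power_mono max.coboundedI2) auto
  then have "9 / 16 * s ^ 4 \<le> pos_sq (s\<^sup>2 - (dist a z)\<^sup>2)"
    by (simp add: power_mult_distrib power_divide flip: power_mult)
  moreover have "0 < s ^ 4" using assms(1) by simp
  ultimately have "s ^ 4 \<le> 2 * pos_sq (s\<^sup>2 - (dist a z)\<^sup>2)" by linarith
  with \<open>0 < s ^ 4\<close> have "1 \<le> pos_sq (s\<^sup>2 - (dist a z)\<^sup>2) * (2 / s ^ 4)"
    by (simp add: le_divide_eq mult.commute)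
  then show ?thesis by (simp add: ball_bump_def dist_sq_pair pos_sq_def[of "1 - _"])
qed

lemma integrable_continuous_lebesgue_on:
  fixes f :: "'a::euclidean_space \<Rightarrow> 'b::euclidean_space"
  assumes "open \<Omega>" "bounded \<Omega>" "continuous_on UNIV f"
  shows "integrable (lebesgue_on \<Omega>) f"
proof -
  interpret finite_measure "lebesgue_on \<Omega>" by (rule finite_measure_lebesgue_on_open[OF assms(1,2)])
  have "compact (f ` closure \<Omega>)"
    using assms by (intro compact_continuous_image continuous_on_subset[OF assms(3)]) (auto simp: compact_closure)
  then have "bounded (f ` closure \<Omega>)" by (rule compact_imp_bounded)
  then obtain B where B: "\<And>z. z \<in> closure \<Omega> \<Longrightarrow> norm (f z) \<le> B"
    unfolding bounded_iff by auto
  have "f \<in> borel_measurable (lebesgue_on \<Omega>)"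
    using borel_measurable_continuous_onI[OF assms(3)] by (intro measurable_restrict_space1 measurable_completion) simp
  then show ?thesis
    by (intro integrable_const_bound[of _ B]) (auto intro!: AE_I2 B subsetD[OF closure_subset])
qed

lemma L2_continuous_lebesgue_on:
  fixes f :: "'a::euclidean_space \<Rightarrow> 'b::euclidean_space"
  assumes "open \<Omega>" "bounded \<Omega>" "continuous_on UNIV f"
  shows "f \<in> L2 (lebesgue_on \<Omega>)"
  unfolding L2_def
  using integrable_continuous_lebesgue_on[OF assms] integrable_continuous_lebesgue_on[OF assms(1,2) continuous_on_power[OF continuous_on_norm[OF assms(3)]], of 2]
  by auto

lemma continuous_grad:
  assumes "Ck 1 u" shows "continuous_on UNIV (grad u)"
proof -
  have "continuous_on UNIV (\<lambda>z. (fst (grad u z), snd (grad u z)))"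
    using assms by (intro continuous_on_Pair) auto
  then show ?thesis by (simp add: prod.collapse[abs_def])
qed

lemma continuous_Jac:
  assumes "Ck 1 u" "Ck 1 v" shows "continuous_on UNIV (Jac u v)"
  using assms unfolding Jac_def[abs_def] by (auto intro!: continuous_intros)

lemma grad_cong_open:
  fixes u v :: "real \<times> real \<Rightarrow> real"
  assumes "open S" "z \<in> S" "\<And>x. x \<in> S \<Longrightarrow> u x = v x" "u differentiable (at z)"
  shows "grad v z = grad u z"
  using grad_eqI[OF has_derivative_transform_within_open[OF has_derivative_grad[OF assms(4)] assms(1,2,3)]] by simp

lemma Jac_add:
  assumes "Ck 1 u" "Ck 1 v"
  shows "Jac (\<lambda>z. u z + v z) \<psi> z = Jac u \<psi> z + Jac v \<psi> z"
  using assms by (simp add: Jac_def grad_add algebra_simps)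

text \<open>The cutoff \<theta> is a parameter so that local estimates can be glued, while
  \<open>w\<close> stays arbitrary.\<close>

definition jac_bound :: "(real \<times> real) set \<Rightarrow> (real \<times> real \<Rightarrow> real) \<Rightarrow> (real \<times> real \<Rightarrow> real) \<Rightarrow> real \<Rightarrow> bool" where
  "jac_bound \<Omega> \<psi> \<theta> C \<longleftrightarrow> (\<forall>w \<delta> k. Ck 1 w \<longrightarrow> 0 \<le> \<delta> \<longrightarrow>
     k \<in> L2 (boundary_measure \<Omega>) \<longrightarrow> (AE z in boundary_measure \<Omega>. \<bar>w z\<bar> \<le> \<delta> + k z) \<longrightarrow>
     \<bar>\<integral>z. Jac (\<lambda>z. w z * \<theta> z) \<psi> z \<partial>lebesgue_on \<Omega>\<bar> \<le> C * (\<delta> + L2norm (boundary_measure \<Omega>) k))"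

text \<open>
  Green's formula: \<open>Jac u \<psi> = \<partial>\<^sub>t (u \<partial>\<^sub>x \<psi>) - \<partial>\<^sub>x (u \<partial>\<^sub>t \<psi>)\<close>, where \<open>\<partial>\<^sub>t\<close> and \<open>\<partial>\<^sub>x\<close> are combinations of the
  derivatives in the two transversal directions.
\<close>

lemma jac_bound_local:
  assumes \<Omega>: "open \<Omega>" "bounded \<Omega>" and m: "m1 \<noteq> m2" "slope_bound \<Omega> z0 s m1" "slope_bound \<Omega> z0 s m2"
    and \<psi>: "Ck 2 \<psi>" and \<theta>: "Ck 1 \<theta>" "\<And>z. 0 \<le> \<theta> z" "\<And>z. \<theta> z \<le> 1" "\<And>z. z \<notin> cball z0 s \<Longrightarrow> \<theta> z = 0"
  shows "\<exists>C\<ge>0. jac_bound \<Omega> \<psi> \<theta> C"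
proof -
  let ?a = "\<lambda>z. fst (grad \<psi> z)" and ?b = "\<lambda>z. snd (grad \<psi> z)" and ?M = "boundary_measure \<Omega>"
  have ab: "Ck 1 ?a" "Ck 1 ?b" using \<psi> by (simp_all add: numeral_2_eq_2)
  from m(2)[unfolded slope_bound_def] obtain K1 where K1: "0 \<le> K1" "\<forall>u \<delta> k. Ck 1 u \<longrightarrow> (\<forall>z. z \<notin> cball z0 s \<longrightarrow> u z = 0) \<longrightarrow>
     0 \<le> \<delta> \<longrightarrow> k \<in> L2 ?M \<longrightarrow> (AE z in ?M. \<bar>u z\<bar> \<le> \<delta> + k z) \<longrightarrow>
     \<bar>\<integral>z. slope_deriv m1 u z \<partial>lebesgue_on \<Omega>\<bar> \<le> K1 * (\<delta> + L2norm ?M k)"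
    by (elim exE conjE) (rule that)
  from m(3)[unfolded slope_bound_def] obtain K2 where K2: "0 \<le> K2" "\<forall>u \<delta> k. Ck 1 u \<longrightarrow> (\<forall>z. z \<notin> cball z0 s \<longrightarrow> u z = 0) \<longrightarrow>
     0 \<le> \<delta> \<longrightarrow> k \<in> L2 ?M \<longrightarrow> (AE z in ?M. \<bar>u z\<bar> \<le> \<delta> + k z) \<longrightarrow>
     \<bar>\<integral>z. slope_deriv m2 u z \<partial>lebesgue_on \<Omega>\<bar> \<le> K2 * (\<delta> + L2norm ?M k)"
    by (elim exE conjE) (rule that)
  have "compact (grad \<psi> ` cball z0 s)"
    by (intro compact_continuous_image continuous_on_subset[OF continuous_grad]) (use \<psi> Ck_Suc_D[of 1 \<psi>] in \<open>auto simp: numeral_2_eq_2\<close>)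
  then have "bounded (grad \<psi> ` cball z0 s)" by (rule compact_imp_bounded)
  then obtain S where S: "0 < S" "\<And>z. z \<in> cball z0 s \<Longrightarrow> norm (grad \<psi> z) \<le> S"
    unfolding bounded_pos by auto
  have Sab: "\<bar>?a z\<bar> \<le> S" "\<bar>?b z\<bar> \<le> S" if "z \<in> cball z0 s" for z
    using S(2)[OF that] norm_fst_le[of "?a z" "?b z"] norm_snd_le[of "?b z" "?a z"] by auto
  \<comment> \<open>Solving for the partial derivatives in terms of the two slope derivatives
    divides by m2 - m1; \<open>S\<close> bounds the coefficients taken from the gradient of
    \<psi>.\<close>
  define C where "C = ((\<bar>m2\<bar> + 1) * K1 + (\<bar>m1\<bar> + 1) * K2) * S / \<bar>m2 - m1\<bar>"
  show ?thesis
  proof (intro exI[of _ C] conjI)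
    show "0 \<le> C" using K1 K2 S by (simp add: C_def)
    show "jac_bound \<Omega> \<psi> \<theta> C"
      unfolding jac_bound_def
    proof (intro allI impI)
      fix w \<delta> k
      assume w: "Ck 1 w" and \<delta>: "0 \<le> \<delta>" and k: "k \<in> L2 ?M" and ae: "AE z in ?M. \<bar>w z\<bar> \<le> \<delta> + k z"
      define u where "u z = w z * \<theta> z" for z
      have u: "Ck 1 u" unfolding u_def[abs_def] by (intro Ck_mult w \<theta>)
      let ?U = "\<lambda>z. u z * ?b z" and ?V = "\<lambda>z. u z * ?a z"
      have UV: "Ck 1 ?U" "Ck 1 ?V" by (intro Ck_mult u ab)+
      have UV0: "?U z = 0" "?V z = 0" if "z \<notin> cball z0 s" for z using \<theta>(4)[OF that] by (auto simp: u_def)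
      have uw: "\<bar>u z\<bar> \<le> \<bar>w z\<bar>" for z
        using mult_left_le[of "\<theta> z" "\<bar>w z\<bar>"] \<theta>(2,3)[of z] by (simp add: u_def abs_mult)
      have "\<bar>u z * c\<bar> \<le> S * \<bar>w z\<bar>" if "z \<in> cball z0 s \<Longrightarrow> \<bar>c\<bar> \<le> S" for z c
      proof (cases "z \<in> cball z0 s")
        case True
        then show ?thesis using mult_mono[OF uw[of z] that[OF True]] S by (simp add: abs_mult mult.commute)
      next
        case False
        then show ?thesis using S \<theta>(4)[OF False] by (simp add: u_def)
      qed
      then have bd: "\<bar>?U z\<bar> \<le> S * \<bar>w z\<bar>" "\<bar>?V z\<bar> \<le> S * \<bar>w z\<bar>" for z using Sab by blast+
      have aeS: "AE z in ?M. S * \<bar>w z\<bar> \<le> S * \<delta> + S * k z"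
        using ae by eventually_elim (use S in \<open>simp flip: distrib_left\<close>)
      have aeUV: "AE z in ?M. \<bar>?U z\<bar> \<le> S * \<delta> + S * k z" "AE z in ?M. \<bar>?V z\<bar> \<le> S * \<delta> + S * k z"
        using aeS by (eventually_elim, use bd order_trans in blast)+
      have S\<delta>: "0 \<le> S * \<delta>" using S \<delta> by simp
      define E where "E = S * (\<delta> + L2norm ?M k)"
      have E: "S * \<delta> + L2norm ?M (\<lambda>z. S * k z) = E" using S by (simp add: E_def L2norm_cmult distrib_left)
      note b1 = K1(2)[rule_format, OF _ _ S\<delta> L2_cmult[OF k, of S], unfolded E] and b2 = K2(2)[rule_format, OF _ _ S\<delta> L2_cmult[OF k, of S], unfolded E]
      have I: "integrable (lebesgue_on \<Omega>) (slope_deriv m v)" if "Ck 1 v" for m v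
        using continuous_slope_deriv[OF that] by (rule integrable_continuous_lebesgue_on[OF \<Omega>])
      \<comment> \<open>The t-derivative is (m2 X1 - m1 X2) / (m2 - m1) and the x-derivative (X2 -
        X1) / (m2 - m1), where X1 and X2 are the slope derivatives. The second derivatives of \<psi>
        cancel by symmetry.\<close>
      have "Jac u \<psi> z = (m2 * slope_deriv m1 ?U z - m1 * slope_deriv m2 ?U z + slope_deriv m1 ?V z - slope_deriv m2 ?V z) / (m2 - m1)" for z
      proof -
        have d: "u differentiable (at z)" "?a differentiable (at z)" "?b differentiable (at z)" using u ab by auto
        have "(m2 - m1) * Jac u \<psi> z = m2 * slope_deriv m1 ?U z - m1 * slope_deriv m2 ?U z + slope_deriv m1 ?V z - slope_deriv m2 ?V z"
          unfolding slope_deriv_def grad_mult[OF d(1) d(2)] grad_mult[OF d(1) d(3)] fst_conv snd_conv Jac_def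
            mixed_partials[OF \<psi>]
          by algebra
        then show ?thesis using m(1) by (simp add: field_simps)
      qed
      then have "(\<integral>z. Jac u \<psi> z \<partial>lebesgue_on \<Omega>) =
         (m2 * (\<integral>z. slope_deriv m1 ?U z \<partial>lebesgue_on \<Omega>) - m1 * (\<integral>z. slope_deriv m2 ?U z \<partial>lebesgue_on \<Omega>)
          + (\<integral>z. slope_deriv m1 ?V z \<partial>lebesgue_on \<Omega>) - (\<integral>z. slope_deriv m2 ?V z \<partial>lebesgue_on \<Omega>)) / (m2 - m1)"
        using I[OF UV(1)] I[OF UV(2)] by simp
      moreover have "\<bar>m2 * (\<integral>z. slope_deriv m1 ?U z \<partial>lebesgue_on \<Omega>)\<bar> \<le> \<bar>m2\<bar> * (K1 * E)"
        unfolding abs_mult by (intro mult_left_mono b1 UV UV0 aeUV) auto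
      moreover have "\<bar>m1 * (\<integral>z. slope_deriv m2 ?U z \<partial>lebesgue_on \<Omega>)\<bar> \<le> \<bar>m1\<bar> * (K2 * E)"
        unfolding abs_mult by (intro mult_left_mono b2 UV UV0 aeUV) auto
      moreover have "\<bar>\<integral>z. slope_deriv m1 ?V z \<partial>lebesgue_on \<Omega>\<bar> \<le> K1 * E" "\<bar>\<integral>z. slope_deriv m2 ?V z \<partial>lebesgue_on \<Omega>\<bar> \<le> K2 * E"
        by (intro b1 b2 UV UV0 aeUV; assumption)+
      ultimately have "\<bar>\<integral>z. Jac u \<psi> z \<partial>lebesgue_on \<Omega>\<bar> \<le>
          (\<bar>m2\<bar> * (K1 * E) + \<bar>m1\<bar> * (K2 * E) + K1 * E + K2 * E) / \<bar>m2 - m1\<bar>"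
        by (simp only: abs_divide) (intro divide_right_mono, linarith, simp)
      also have "\<dots> = C * (\<delta> + L2norm ?M k)"
        by (simp add: C_def E_def field_simps)
      finally show "\<bar>\<integral>z. Jac (\<lambda>z. w z * \<theta> z) \<psi> z \<partial>lebesgue_on \<Omega>\<bar> \<le> C * (\<delta> + L2norm ?M k)"
        unfolding u_def .
    qed
  qed
qed

text \<open>Finitely many half balls cover the closure of \<Omega>. The cutoffs are not normalised
  to a partition of unity: 1 - (product of 1 - \<eta>) equals 1 near the closure, and it splits into
  one local piece per ball.\<close>

lemma jac_bound_global:
  assumes \<Omega>: "open \<Omega>" "bounded \<Omega>" "lipschitz_boundary \<Omega>" and \<psi>: "Ck 2 \<psi>"
  shows "\<exists>C\<ge>0. jac_bound \<Omega> \<psi> (\<lambda>_. 1) C"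
proof -
  let ?M = "boundary_measure \<Omega>"
  have \<psi>1: "Ck 1 \<psi>" using \<psi> Ck_Suc_D[of 1 \<psi>] by (simp add: numeral_2_eq_2)
  have "\<exists>s>0. \<exists>m1 m2. m1 \<noteq> m2 \<and> slope_bound \<Omega> z s m1 \<and> slope_bound \<Omega> z s m2" if "z \<in> closure \<Omega>" for z
    using two_slope_bounds[OF \<Omega>(1,3) that] by metis
  then obtain s where s: "\<And>z. z \<in> closure \<Omega> \<Longrightarrow> 0 < s z"
    "\<And>z. z \<in> closure \<Omega> \<Longrightarrow> \<exists>m1 m2. m1 \<noteq> m2 \<and> slope_bound \<Omega> z (s z) m1 \<and> slope_bound \<Omega> z (s z) m2"
    by metis
  define \<eta> where "\<eta> a = ball_bump a (s a)" for a
  have \<eta>: "Ck 1 (\<eta> a)" "0 \<le> \<eta> a z" "\<eta> a z \<le> 1" for a z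
    unfolding \<eta>_def by (rule C1_ball_bump ball_bump_bounds)+
  have loc: "\<exists>C\<ge>0. jac_bound \<Omega> \<psi> (\<eta> a) C" if a: "a \<in> closure \<Omega>" for a
  proof -
    obtain m1 m2 where m: "m1 \<noteq> m2" "slope_bound \<Omega> a (s a) m1" "slope_bound \<Omega> a (s a) m2" using s(2)[OF a] by blast
    show ?thesis
      by (rule jac_bound_local[OF \<Omega>(1,2) m \<psi> \<eta>]) (simp add: \<eta>_def ball_bump_zero[OF s(1)[OF a]])
  qed
  have fin: "\<exists>C\<ge>0. jac_bound \<Omega> \<psi> (\<lambda>z. 1 - (\<Prod>a\<in>A. 1 - \<eta> a z)) C" if "finite A" "A \<subseteq> closure \<Omega>" for A
    using that
  proof (induction A rule: finite_induct)
    case empty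
    have "Jac (\<lambda>_. 0) \<psi> z = 0" for z by (simp add: Jac_def)
    then show ?case by (intro exI[of _ 0]) (simp add: jac_bound_def)
  next
    case (insert a A)
    obtain C1 where C1: "0 \<le> C1" "jac_bound \<Omega> \<psi> (\<lambda>z. 1 - (\<Prod>a\<in>A. 1 - \<eta> a z)) C1" using insert by auto
    obtain C2 where C2: "0 \<le> C2" "jac_bound \<Omega> \<psi> (\<eta> a) C2" using loc[of a] insert by auto
    let ?P = "\<lambda>z. \<Prod>a\<in>A. 1 - \<eta> a z"
    have P: "Ck 1 ?P" using insert(1) by (intro Ck_prod Ck_diff \<eta> Ck_const)
    have P01: "0 \<le> ?P z" "?P z \<le> 1" for z by (auto intro!: prod_nonneg prod_le_1 simp: \<eta>)
    show ?case
    proof (intro exI[of _ "C1 + C2"] conjI)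
      show "0 \<le> C1 + C2" using C1 C2 by simp
      show "jac_bound \<Omega> \<psi> (\<lambda>z. 1 - (\<Prod>a\<in>insert a A. 1 - \<eta> a z)) (C1 + C2)"
        unfolding jac_bound_def
      proof (intro allI impI)
        fix w \<delta> k
        assume w: "Ck 1 w" and \<delta>: "0 \<le> \<delta>" and k: "k \<in> L2 ?M" and ae: "AE z in ?M. \<bar>w z\<bar> \<le> \<delta> + k z"
        \<comment> \<open>Adding a ball adds the piece \<eta> a times the old product
          \<open>?P\<close>. Since \<open>?P\<close> lies between 0 and 1, \<open>w\<close> times
          \<open>?P\<close> obeys the same boundary bound as \<open>w\<close>.\<close>
        have eq: "(\<lambda>z. w z * (1 - (\<Prod>a\<in>insert a A. 1 - \<eta> a z))) = (\<lambda>z. w z * (1 - ?P z) + (w z * ?P z) * \<eta> a z)"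
          using insert(1,2) by (simp add: algebra_simps)
        have c: "Ck 1 (\<lambda>z. w z * (1 - ?P z))" "Ck 1 (\<lambda>z. (w z * ?P z) * \<eta> a z)" "Ck 1 (\<lambda>z. w z * ?P z)"
          by (intro Ck_mult Ck_diff Ck_const w P \<eta>)+
        have "\<bar>w z * ?P z\<bar> \<le> \<bar>w z\<bar>" for z
          using mult_left_le[of "?P z" "\<bar>w z\<bar>"] P01[of z] by (simp add: abs_mult)
        then have ae': "AE z in ?M. \<bar>w z * ?P z\<bar> \<le> \<delta> + k z"
          using ae by (auto elim!: eventually_mono intro: order_trans)
        have "(\<integral>z. Jac (\<lambda>z. w z * (1 - (\<Prod>a\<in>insert a A. 1 - \<eta> a z))) \<psi> z \<partial>lebesgue_on \<Omega>) =
           (\<integral>z. Jac (\<lambda>z. w z * (1 - ?P z)) \<psi> z \<partial>lebesgue_on \<Omega>) + (\<integral>z. Jac (\<lambda>z. (w z * ?P z) * \<eta> a z) \<psi> z \<partial>lebesgue_on \<Omega>)"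
          unfolding eq Jac_add[OF c(1,2)]
          by (intro Bochner_Integration.integral_add integrable_continuous_lebesgue_on[OF \<Omega>(1,2)] continuous_Jac c \<psi>1)
        moreover have "\<bar>\<integral>z. Jac (\<lambda>z. w z * (1 - ?P z)) \<psi> z \<partial>lebesgue_on \<Omega>\<bar> \<le> C1 * (\<delta> + L2norm ?M k)"
          using C1(2) w \<delta> k ae unfolding jac_bound_def by blast
        moreover have "\<bar>\<integral>z. Jac (\<lambda>z. (w z * ?P z) * \<eta> a z) \<psi> z \<partial>lebesgue_on \<Omega>\<bar> \<le> C2 * (\<delta> + L2norm ?M k)"
          using C2(2)[unfolded jac_bound_def, rule_format, OF c(3) \<delta> k ae'] .
        ultimately show "\<bar>\<integral>z. Jac (\<lambda>z. w z * (1 - (\<Prod>a\<in>insert a A. 1 - \<eta> a z))) \<psi> z \<partial>lebesgue_on \<Omega>\<bar>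
            \<le> (C1 + C2) * (\<delta> + L2norm ?M k)"
          by (simp add: distrib_right)
      qed
    qed
  qed
  have "compact (closure \<Omega>)" using \<Omega>(2) by (simp add: compact_closure)
  then obtain A where A: "A \<subseteq> closure \<Omega>" "finite A" "closure \<Omega> \<subseteq> (\<Union>a\<in>A. ball a (s a / 2))"
    by (rule compactE_image[of _ "closure \<Omega>" "\<lambda>a. ball a (s a / 2)"]) (use s(1) in \<open>auto intro!: bexI\<close>)
  let ?\<theta> = "\<lambda>z. 1 - (\<Prod>a\<in>A. 1 - \<eta> a z)"
  have "?\<theta> z = 1" if z: "z \<in> (\<Union>a\<in>A. ball a (s a / 2))" for z
  proof -
    obtain a where a: "a \<in> A" "z \<in> ball a (s a / 2)" using z by blast
    then have "\<eta> a z = 1" unfolding \<eta>_def using ball_bump_one[OF s(1)] A(1) by blast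
    then have "(\<Prod>a\<in>A. 1 - \<eta> a z) = 0" using a(1) A(2) by (intro prod_zero) auto
    then show ?thesis by simp
  qed
  note \<theta>1 = this
  obtain C where C: "0 \<le> C" "jac_bound \<Omega> \<psi> ?\<theta> C" using fin[OF A(2,1)] by blast
  have "(\<integral>z. Jac (\<lambda>z. w z * ?\<theta> z) \<psi> z \<partial>lebesgue_on \<Omega>) = (\<integral>z. Jac (\<lambda>z. w z * 1) \<psi> z \<partial>lebesgue_on \<Omega>)" if w: "Ck 1 w" for w
  proof (rule Bochner_Integration.integral_cong[OF refl])
    fix z assume "z \<in> space (lebesgue_on \<Omega>)"
    then have z: "z \<in> (\<Union>a\<in>A. ball a (s a / 2))" using A(3) closure_subset by fastforce
    \<comment> \<open>The cutoff is 1 on an open set around the point, so the gradients agree as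
      well as the values.\<close>
    have "grad (\<lambda>z. w z * ?\<theta> z) z = grad (\<lambda>z. w z * 1) z"
    proof (rule grad_cong_open[OF _ z])
      show "w x * 1 = w x * ?\<theta> x" if "x \<in> (\<Union>a\<in>A. ball a (s a / 2))" for x using \<theta>1[OF that] by simp
    qed (use w in auto)
    then show "Jac (\<lambda>z. w z * ?\<theta> z) \<psi> z = Jac (\<lambda>z. w z * 1) \<psi> z" by (simp only: Jac_def)
  qed
  with C show ?thesis unfolding jac_bound_def by (intro exI[of _ C]) simp
qed

subsection \<open>The end points of the boundary pieces\<close>

lemma finite_no_three:
  fixes S :: "'a::linorder set"
  assumes "\<And>a b c. a \<in> S \<Longrightarrow> b \<in> S \<Longrightarrow> c \<in> S \<Longrightarrow> a < b \<Longrightarrow> b < c \<Longrightarrow> False"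
  shows "finite S"
proof (rule ccontr)
  assume "infinite S"
  then obtain B where "finite B" "card B = 3" "B \<subseteq> S"
    using infinite_arbitrarily_large by blast
  then obtain x y z where d: "x \<noteq> y" "y \<noteq> z" "x \<noteq> z" "x \<in> S" "y \<in> S" "z \<in> S"
    by (auto simp: card_3_iff)
  show False
    using assms[of x y z] assms[of x z y] assms[of y x z] assms[of y z x] assms[of z x y] assms[of z y x] d
    by (metis neqE)
qed

text \<open>
  A connected piece of a curve can reach at most two of its missing limit points inside a chart: a third
  one would be cut off by an open arc between two of them.
\<close>

lemma finite_missing_limits_chart:
  fixes Q :: "real \<Rightarrow> 'a::metric_space"
  assumes F: "closed F" and Q: "continuous_on UNIV Q" and p: "continuous_on UNIV p" and B: "open B"
    and QB: "\<And>x. x \<in> {l<..<u} \<Longrightarrow> Q x \<in> B \<and> p (Q x) = x" and FQ: "\<And>w. w \<in> F \<Longrightarrow> w \<in> B \<Longrightarrow> w = Q (p w)"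
    and K: "connected K" "K \<subseteq> F"
  shows "finite ({w \<in> B. p w \<in> {l<..<u}} \<inter> (closure K - K))"
proof -
  let ?X = "{w \<in> B. p w \<in> {l<..<u}} \<inter> (closure K - K)"
  have clF: "closure K \<subseteq> F" using K(2) F by (rule closure_minimal)
  have XQ: "w = Q (p w)" if "w \<in> ?X" for w using that FQ clF by blast
  have arc: "closure K \<subseteq> Q ` {a..b}" if ab: "l < a" "b < u" "Q a \<notin> K" "Q b \<notin> K" and k: "k \<in> K" "k \<in> B" "a < p k" "p k < b" for a b k
  proof -
    define A where "A = {w \<in> B. a < p w \<and> p w < b}"
    have "A = B \<inter> ({w. a < p w} \<inter> {w. p w < b})" by (auto simp: A_def)
    then have "open A" using B by (auto intro!: open_Int open_Collect_less p continuous_intros)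
    have C: "compact (Q ` {a..b})"
      by (intro compact_continuous_image continuous_on_subset[OF Q]) auto
    \<comment> \<open>Both end points of the arc are missing from \<open>K\<close>, so an open set
      and a compact arc cut out the same part of \<open>K\<close>. This part is open and closed in
      the connected set \<open>K\<close>, hence everything.\<close>
    have eq: "K \<inter> A = K \<inter> Q ` {a..b}"
    proof (intro equalityI subsetI)
      fix w assume w: "w \<in> K \<inter> A"
      then have "w = Q (p w)" using FQ K(2) by (auto simp: A_def)
      moreover have "p w \<in> {a..b}" using w by (simp add: A_def)
      ultimately show "w \<in> K \<inter> Q ` {a..b}" using w by (auto intro: image_eqI)
    next
      fix w assume w: "w \<in> K \<inter> Q ` {a..b}"
      then obtain x where x: "a \<le> x" "x \<le> b" "w = Q x" by auto
      with w ab have "x \<noteq> a" "x \<noteq> b" by auto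
      with x have "a < x" "x < b" by auto
      moreover from this have "Q x \<in> B \<and> p (Q x) = x" using ab by (intro QB) auto
      ultimately show "w \<in> K \<inter> A" using w x by (auto simp: A_def)
    qed
    have "openin (top_of_set K) (K \<inter> A)" using \<open>open A\<close> by (rule openin_open_Int)
    moreover have "closedin (top_of_set K) (K \<inter> A)"
      unfolding eq using compact_imp_closed[OF C] by (rule closedin_closed_Int)
    moreover have "K \<inter> A \<noteq> {}" using k by (auto simp: A_def)
    ultimately have "K \<inter> A = K" using K(1) by (metis connected_clopen)
    then have "K \<subseteq> Q ` {a..b}" using eq by blast
    then show ?thesis using compact_imp_closed[OF C] by (rule closure_minimal)
  qed
  have "finite (p ` ?X)"
  proof (rule finite_no_three)
    fix e1 e2 e3 assume e: "e1 \<in> p ` ?X" "e2 \<in> p ` ?X" "e3 \<in> p ` ?X" "e1 < e2" "e2 < e3"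
    have Qe: "l < e \<and> e < u \<and> Q e \<in> closure K \<and> Q e \<notin> K" if mem: "e \<in> p ` ?X" for e
    proof -
      obtain w where w: "e = p w" "w \<in> ?X" using mem by (rule imageE)
      then have "Q e = w" using XQ by simp
      with w show ?thesis by auto
    qed
    note q = Qe[OF e(1)] Qe[OF e(2)] Qe[OF e(3)]
    define V where "V = B \<inter> ({w. e1 < p w} \<inter> {w. p w < e3})"
    have "open V" unfolding V_def using B by (auto intro!: open_Int open_Collect_less p continuous_intros)
    moreover have "Q e2 \<in> V" using QB[of e2] q e(4,5) by (auto simp: V_def)
    ultimately obtain k where k: "k \<in> K" "k \<in> V"
      using q(2) unfolding closure_iff_nhds_not_empty by (metis disjoint_iff subset_refl)
    have "k = Q (p k)" using FQ k K(2) by (auto simp: V_def)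
    then have "p k \<noteq> e2" using q(2) k(1) by metis
    \<comment> \<open>On whichever side \<open>k\<close> lies, \<open>K\<close> is trapped in the
      arc from the middle point to the outer point of that side, so its closure misses the other
      outer point.\<close>
    then consider "p k < e2" | "e2 < p k" by linarith
    then show False
    proof cases
      case 1
      then have "Q e3 \<in> Q ` {e1..e2}" using arc[of e1 e2 k] q k by (auto simp: V_def)
      then obtain x where "e1 \<le> x" "x \<le> e2" "Q e3 = Q x" by auto
      moreover from this have "p (Q x) = x" "p (Q e3) = e3" using q e(4,5) QB[of x] QB[of e3] by auto
      ultimately show False using e(5) by simp
    next
      case 2
      then have "Q e1 \<in> Q ` {e2..e3}" using arc[of e2 e3 k] q k by (auto simp: V_def)
      then obtain x where "e2 \<le> x" "x \<le> e3" "Q e1 = Q x" by auto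
      moreover from this have "p (Q x) = x" "p (Q e1) = e1" using q e(4,5) QB[of x] QB[of e1] by auto
      ultimately show False using e(4) by simp
    qed
  qed
  moreover have "inj_on p ?X"
  proof (rule inj_onI)
    fix v w assume vw: "v \<in> ?X" "w \<in> ?X" "p v = p w"
    show "v = w" using XQ[OF vw(1)] XQ[OF vw(2)] vw(3) by simp
  qed
  ultimately show ?thesis by (rule finite_imageD)
qed

text \<open>In a chart the boundary is the graph of \<gamma>: \<open>Q\<close> parametrises it and
  \<open>p\<close> reads off the parameter.\<close>

lemma finite_missing_limits_local:
  assumes \<Omega>: "open \<Omega>" "lipschitz_boundary \<Omega>" and z0: "z0 \<in> frontier \<Omega>"
  shows "\<exists>V. open V \<and> z0 \<in> V \<and> (\<forall>K. connected K \<longrightarrow> K \<subseteq> frontier \<Omega> \<longrightarrow> finite (V \<inter> (closure K - K)))"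
proof -
  from bspec[OF \<Omega>(2)[unfolded lipschitz_boundary_def] z0]
  obtain r T and \<gamma> :: "real \<Rightarrow> real" and L where r: "0 < r" and T: "orthogonal_transformation T" and \<gamma>: "L-lipschitz_on UNIV \<gamma>"
    and chart: "\<forall>w\<in>ball z0 r. w \<in> \<Omega> \<longleftrightarrow> \<gamma> (fst (T w)) < snd (T w)"
    by (elim exE conjE) (rule that)
  have L: "0 \<le> L" by (rule lipschitz_on_nonneg[OF \<gamma>])
  define p where "p = (\<lambda>w. fst (T w))"
  define Q where "Q = (\<lambda>x. inv T (x, \<gamma> x))"
  have inv: "orthogonal_transformation (inv T)" by (rule orthogonal_transformation_inv[OF T])
  have Tinv: "T (inv T y) = y" "inv T (T y) = y" for y
    using orthogonal_transformation_bij[OF T] by (simp_all add: bij_is_surj surj_f_inv_f bij_is_inj inv_f_f)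
  have cont: "continuous_on UNIV (f :: real \<times> real \<Rightarrow> real \<times> real)" if "orthogonal_transformation f" for f
    using orthogonal_transformation_linear[OF that] by (intro linear_continuous_on) (simp add: linear_conv_bounded_linear)
  have \<gamma>c: "continuous_on UNIV \<gamma>" using \<gamma> by (rule lipschitz_on_continuous_on)
  have pc: "continuous_on UNIV p" unfolding p_def by (intro continuous_intros cont T)
  have Qc: "continuous_on UNIV Q"
    unfolding Q_def by (intro continuous_on_compose2[OF cont[OF inv]] continuous_intros \<gamma>c) auto
  have FQ: "w = Q (p w)" if w: "w \<in> frontier \<Omega>" "w \<in> ball z0 r" for w
  proof -
    have "w \<notin> \<Omega>" using w(1) \<Omega>(1) by (simp add: frontier_def interior_open)
    then have "snd (T w) \<le> \<gamma> (p w)" using chart w(2) by (auto simp: p_def)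
    \<comment> \<open>The part of the ball strictly below the graph is open and misses \<Omega>, so
      it contains no limit point of \<Omega>.\<close>
    moreover have "\<not> snd (T w) < \<gamma> (p w)"
    proof
      assume less: "snd (T w) < \<gamma> (p w)"
      let ?W = "ball z0 r \<inter> {w. snd (T w) < \<gamma> (p w)}"
      have "open ?W"
        by (intro open_Int open_ball open_Collect_less continuous_intros cont T continuous_on_compose2[OF \<gamma>c pc]) auto
      moreover have "?W \<inter> \<Omega> = {}" using chart by (auto simp: p_def)
      ultimately have "?W \<inter> closure \<Omega> = {}" using open_Int_closure_eq_empty by blast
      then show False using w less by (auto simp: frontier_def)
    qed
    ultimately have "T w = (p w, \<gamma> (p w))" by (simp add: p_def prod_eq_iff)
    then show ?thesis unfolding Q_def by (metis Tinv(2))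
  qed
  \<comment> \<open>\<open>Q\<close> is Lipschitz with constant 1 + L, so parameters closer than
    this to that of \<open>z0\<close> stay in the chart ball.\<close>
  define a where "a = r / (1 + L)"
  have a: "0 < a" "(1 + L) * a = r" using r L by (auto simp: a_def)
  have QB: "Q x \<in> ball z0 r \<and> p (Q x) = x" if x: "x \<in> {p z0 - a<..<p z0 + a}" for x
  proof
    show "p (Q x) = x" by (simp add: p_def Q_def Tinv)
    have z: "z0 = Q (p z0)" using FQ[OF z0] r by simp
    have "dist z0 (Q x) = dist (inv T (p z0, \<gamma> (p z0))) (inv T (x, \<gamma> x))" using z by (simp add: Q_def)
    also have "\<dots> = dist (p z0, \<gamma> (p z0)) (x, \<gamma> x)"
      using inv unfolding orthogonal_transformation_isometry by blast
    also have "\<dots> \<le> \<bar>p z0 - x\<bar> + \<bar>\<gamma> (p z0) - \<gamma> x\<bar>"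
      unfolding dist_Pair_Pair dist_real_def by (rule order_trans[OF sqrt_sum_squares_le_sum_abs]) simp
    also have "\<dots> \<le> (1 + L) * \<bar>p z0 - x\<bar>"
      using lipschitz_onD[OF \<gamma>, of "p z0" x] by (simp add: dist_real_def distrib_right)
    also have "\<dots> < (1 + L) * a"
      using x L by (intro mult_strict_left_mono) auto
    finally show "Q x \<in> ball z0 r" using a(2) by simp
  qed
  show ?thesis
  proof (intro exI[of _ "{w \<in> ball z0 r. p w \<in> {p z0 - a<..<p z0 + a}}"] conjI allI impI)
    have "{w \<in> ball z0 r. p w \<in> {p z0 - a<..<p z0 + a}} = ball z0 r \<inter> ({w. p z0 - a < p w} \<inter> {w. p w < p z0 + a})" by auto
    then show "open {w \<in> ball z0 r. p w \<in> {p z0 - a<..<p z0 + a}}"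
      by (auto intro!: open_Int open_Collect_less pc continuous_intros)
    show "z0 \<in> {w \<in> ball z0 r. p w \<in> {p z0 - a<..<p z0 + a}}" using r a by simp
    show "finite ({w \<in> ball z0 r. p w \<in> {p z0 - a<..<p z0 + a}} \<inter> (closure K - K))"
      if "connected K" "K \<subseteq> frontier \<Omega>" for K
      by (rule finite_missing_limits_chart[OF frontier_closed Qc pc open_ball QB FQ that])
  qed
qed

lemma finite_missing_limits:
  assumes \<Omega>: "open \<Omega>" "bounded \<Omega>" "lipschitz_boundary \<Omega>" and K: "connected K" "K \<subseteq> frontier \<Omega>"
  shows "finite (closure K - K)"
proof -
  obtain V where V: "\<And>z. z \<in> frontier \<Omega> \<Longrightarrow> open (V z) \<and> z \<in> V z \<and> finite (V z \<inter> (closure K - K))"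
    using finite_missing_limits_local[OF \<Omega>(1,3)] K by metis
  have "compact (frontier \<Omega>)" using \<Omega>(2) by (rule compact_frontier_bounded)
  then obtain A where A: "A \<subseteq> frontier \<Omega>" "finite A" "frontier \<Omega> \<subseteq> (\<Union>z\<in>A. V z)"
    by (rule compactE_image[of _ "frontier \<Omega>" V]) (use V in \<open>auto intro!: bexI\<close>)
  have "closure K \<subseteq> frontier \<Omega>" using K(2) frontier_closed by (rule closure_minimal)
  then have "closure K - K \<subseteq> (\<Union>z\<in>A. V z \<inter> (closure K - K))" using A(3) by blast
  moreover have "finite (\<Union>z\<in>A. V z \<inter> (closure K - K))" using A V by blast
  ultimately show ?thesis by (rule finite_subset)
qed

text \<open>A finite union of closures is closed, so every limit point of \<open>S\<close> is a
  limit point of a single component.\<close>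

lemma finite_missing_limits_components:
  assumes \<Omega>: "open \<Omega>" "bounded \<Omega>" "lipschitz_boundary \<Omega>" and S: "S \<subseteq> frontier \<Omega>" "finite (components S)"
  shows "finite (closure S - S)"
proof -
  have "S \<subseteq> (\<Union>K\<in>components S. closure K)"
    using Union_components[of S] closure_subset by blast
  moreover have "closed (\<Union>K\<in>components S. closure K)" using S(2) by (intro closed_UN) auto
  ultimately have "closure S \<subseteq> (\<Union>K\<in>components S. closure K)" by (rule closure_minimal)
  moreover have "K \<subseteq> S" if "K \<in> components S" for K using that by (rule in_components_subset)
  ultimately have "closure S - S \<subseteq> (\<Union>K\<in>components S. closure K - K)" by blast
  moreover have "finite (\<Union>K\<in>components S. closure K - K)"
    using S(2) finite_missing_limits[OF \<Omega>] in_components_connected in_components_subset S(1) by blast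
  ultimately show ?thesis by (rule finite_subset)
qed

section \<open>Null sets of the boundary measure\<close>

lemma hausdorff_outer_singleton: "hausdorff_outer {x} = 0"
proof -
  have "hausdorff_content \<delta> {x} \<le> 0" if "0 < \<delta>" for \<delta>
  proof -
    have "hausdorff_content \<delta> {x} \<le> (\<Sum>i::nat. ennreal (diameter {x}))"
      unfolding hausdorff_content_def by (rule INF_lower2[of "\<lambda>_. {x}"]) (use that in auto)
    then show ?thesis by simp
  qed
  then have "hausdorff_outer {x} \<le> 0" unfolding hausdorff_outer_def by (intro SUP_least) auto
  then show ?thesis by simp
qed

lemma hausdorff_outer_finite: "finite A \<Longrightarrow> hausdorff_outer A = 0"
proof (induction A rule: finite_induct)
  case (insert x A)
  have "hausdorff_outer (insert x A) \<le> hausdorff_outer {x} + hausdorff_outer A"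
    using hausdorff_outer_Un_le[of "{x}" A] by simp
  then show ?case using insert by (simp add: hausdorff_outer_singleton)
qed simp

text \<open>A boundary point in neither piece is a missing limit point of one of them. This makes
  the two trace conditions, each given on one piece, cover almost all of the boundary.\<close>

lemma boundary_partition_AE:
  assumes \<Omega>: "open \<Omega>" "bounded \<Omega>" "lipschitz_boundary \<Omega>" and part: "boundary_partition \<Omega> \<Gamma>\<^sub>I \<Gamma>\<^sub>C"
  shows "AE z in boundary_measure \<Omega>. z \<in> \<Gamma>\<^sub>I \<or> z \<in> \<Gamma>\<^sub>C"
proof -
  let ?E = "frontier \<Omega> - (\<Gamma>\<^sub>I \<union> \<Gamma>\<^sub>C)"
  have sub: "\<Gamma>\<^sub>I \<subseteq> frontier \<Omega>" "\<Gamma>\<^sub>C \<subseteq> frontier \<Omega>"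
    using part openin_imp_subset unfolding boundary_partition_def by blast+
  have "finite (closure \<Gamma>\<^sub>I - \<Gamma>\<^sub>I)" "finite (closure \<Gamma>\<^sub>C - \<Gamma>\<^sub>C)"
    using part unfolding boundary_partition_def by (auto intro!: finite_missing_limits_components[OF \<Omega>] sub)
  then have fin: "finite ?E"
    using part unfolding boundary_partition_def by (auto intro: finite_subset[of _ "(closure \<Gamma>\<^sub>I - \<Gamma>\<^sub>I) \<union> (closure \<Gamma>\<^sub>C - \<Gamma>\<^sub>C)"])
  have "?E \<in> sets borel" using fin by (intro borel_closed finite_imp_closed)
  then have "?E \<in> sets (boundary_measure \<Omega>)"
    using borel_closed[OF frontier_closed, of \<Omega>] by (auto simp: sets_boundary_measure sets_restrict_space_iff)
  then have "?E \<in> null_sets (boundary_measure \<Omega>)"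
    by (simp add: null_sets_def emeasure_boundary_measure hausdorff_outer_finite[OF fin])
  then show ?thesis by (rule AE_I') auto
qed

subsection \<open>Orthogonality of gradients and rotated gradients\<close>

definition perp :: "real \<times> real \<Rightarrow> real \<times> real" where "perp w = (snd w, - fst w)"

lemma perp_diff: "perp (v - w) = perp v - perp w"
  by (simp add: perp_def)

lemma norm_perp [simp]: "norm (perp w) = norm w"
  by (simp add: perp_def norm_prod_def add.commute)

lemma Jac_eq_inner: "Jac u v z = grad u z \<bullet> perp (grad v z)"
  by (simp add: Jac_def perp_def inner_prod_def)

lemma perp_L2:
  assumes "w \<in> L2 M" shows "(\<lambda>z. perp (w z)) \<in> L2 M"
proof -
  have "perp \<in> borel_measurable borel"
    unfolding perp_def[abs_def] by (intro borel_measurable_continuous_onI continuous_intros)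
  then have "(\<lambda>z. perp (w z)) \<in> borel_measurable M"
    using measurable_compose[OF L2_D(1)[OF assms]] by blast
  then show ?thesis using L2_D(2)[OF assms] by (simp add: L2_def)
qed

lemma L2norm_perp: "L2norm M (\<lambda>z. perp (w z)) = L2norm M w"
  by (simp add: L2norm_def)

lemma L2_tendsto_perp:
  assumes "L2_tendsto M U u" shows "L2_tendsto M (\<lambda>n z. perp (U n z)) (\<lambda>z. perp (u z))"
  using L2_tendsto_D[OF assms] by (auto simp: L2_tendsto_def perp_L2 L2norm_perp simp flip: perp_diff)

text \<open>Replacing \<psi> n by a fixed \<psi> m changes the integral by at most a constant times
  the L2 distance of their gradients, as the gradients of the cut functions stay bounded. For fixed
  \<open>m\<close> the boundary estimate applies, and the boundary values of the cut functions tend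
  to zero.\<close>

lemma integral_Jac_cut_tendsto_0:
  assumes \<Omega>: "open \<Omega>" "bounded \<Omega>" "lipschitz_boundary \<Omega>"
    and \<phi>: "\<And>n. smooth (\<phi> n)" "L2_tendsto (lebesgue_on \<Omega>) (\<lambda>n. grad (\<phi> n)) P" "L2_tendsto (boundary_measure \<Omega>) \<phi> g"
    and \<psi>: "\<And>n. smooth (\<psi> n)" "L2_tendsto (lebesgue_on \<Omega>) (\<lambda>n. grad (\<psi> n)) G" "L2_tendsto (boundary_measure \<Omega>) \<psi> h"
    and gh: "AE z in boundary_measure \<Omega>. g z = 0 \<or> h z = 0" and d: "\<And>n. 0 < d n" "d \<longlonglongrightarrow> 0"
  shows "(\<lambda>n. \<integral>z. Jac (\<lambda>z. axis_cut (d n) (\<phi> n z) (\<psi> n z)) (\<psi> n) z \<partial>lebesgue_on \<Omega>) \<longlonglongrightarrow> 0"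
proof -
  let ?M = "boundary_measure \<Omega>" and ?L = "lebesgue_on \<Omega>"
  define D where "D n z = axis_cut (d n) (\<phi> n z) (\<psi> n z)" for n z
  have C1: "Ck 1 (\<phi> n)" "Ck 1 (\<psi> n)" "Ck 2 (\<psi> n)" for n
    using \<phi>(1) \<psi>(1) unfolding smooth_def by blast+
  have df: "\<phi> n differentiable (at z)" "\<psi> n differentiable (at z)" for n z using C1[of n] by auto
  have D1: "Ck 1 (D n)" for n unfolding D_def[abs_def] by (rule C1_axis_cut[OF d(1) C1(1,2)])
  have gradL2: "grad u \<in> L2 ?L" if "Ck 1 u" for u
    by (rule L2_continuous_lebesgue_on[OF \<Omega>(1,2) continuous_grad[OF that]])
  note \<phi>L = L2_tendsto_D[OF \<phi>(2)] and \<psi>L = L2_tendsto_D[OF \<psi>(2)]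
  note \<phi>M = L2_tendsto_D[OF \<phi>(3)] and \<psi>M = L2_tendsto_D[OF \<psi>(3)]
  obtain B1 where B1: "0 \<le> B1" "\<And>n. L2norm ?L (grad (\<phi> n)) \<le> B1" using L2_tendsto_bounded[OF \<phi>(2)] by blast
  obtain B2 where B2: "0 \<le> B2" "\<And>n. L2norm ?L (grad (\<psi> n)) \<le> B2" using L2_tendsto_bounded[OF \<psi>(2)] by blast
  define B where "B = 11 * B1 + 11 * B2"
  have B0: "0 \<le> B" using B1 B2 by (simp add: B_def)
  have B: "L2norm ?L (grad (D n)) \<le> B" for n
  proof -
    have n1: "(\<lambda>z. norm (grad (\<phi> n) z)) \<in> L2 ?L" "(\<lambda>z. norm (grad (\<psi> n) z)) \<in> L2 ?L"
      using L2_D[OF \<phi>L(1)[of n]] L2_D[OF \<psi>L(1)[of n]] by (auto simp: L2_def)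
    have n2: "L2norm ?L (\<lambda>z. norm (grad (\<phi> n) z)) = L2norm ?L (grad (\<phi> n))"
      "L2norm ?L (\<lambda>z. norm (grad (\<psi> n) z)) = L2norm ?L (grad (\<psi> n))"
      by (simp_all add: L2norm_def)
    have "L2norm ?L (grad (D n)) \<le> L2norm ?L (\<lambda>z. 11 * norm (grad (\<phi> n) z) + 11 * norm (grad (\<psi> n) z))"
    proof (rule L2norm_mono[OF gradL2[OF D1] L2_add[OF L2_cmult[OF n1(1)] L2_cmult[OF n1(2)]]])
      fix z
      show "norm (grad (D n) z) \<le> norm (11 * norm (grad (\<phi> n) z) + 11 * norm (grad (\<psi> n) z))"
        unfolding D_def[abs_def] using norm_grad_axis_cut_le[OF d(1) df] by simp
    qed
    also have "\<dots> \<le> 11 * L2norm ?L (grad (\<phi> n)) + 11 * L2norm ?L (grad (\<psi> n))"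
      using L2norm_triangle[OF L2_cmult[OF n1(1), of 11] L2_cmult[OF n1(2), of 11]] by (simp add: L2norm_cmult n2)
    also have "\<dots> \<le> B" unfolding B_def by (intro add_mono mult_left_mono B1 B2) auto
    finally show ?thesis .
  qed
  \<comment> \<open>Where one of the limit traces vanishes, the smaller of |\<phi> n| and |\<psi> n|
    is at most the sum of the two approximation errors; the factor 2 is that of
    \<open>abs_axis_cut_le\<close>.\<close>
  define k where "k n z = 2 * (\<bar>\<phi> n z - g z\<bar> + \<bar>\<psi> n z - h z\<bar>)" for n z
  have dif: "(\<lambda>z. \<bar>\<phi> n z - g z\<bar>) \<in> L2 ?M" "(\<lambda>z. \<bar>\<psi> n z - h z\<bar>) \<in> L2 ?M" for n
    by (intro L2_abs L2_diff \<phi>M \<psi>M)+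
  have k: "k n \<in> L2 ?M" for n
    unfolding k_def[abs_def] by (intro L2_cmult L2_add dif)
  have kn: "L2norm ?M (k n) \<le> 2 * (L2norm ?M (\<lambda>z. \<phi> n z - g z) + L2norm ?M (\<lambda>z. \<psi> n z - h z))" for n
  proof -
    have "L2norm ?M (k n) = 2 * L2norm ?M (\<lambda>z. \<bar>\<phi> n z - g z\<bar> + \<bar>\<psi> n z - h z\<bar>)"
      unfolding k_def[abs_def] by (rule L2norm_cmult) simp
    then show ?thesis using L2norm_triangle[OF dif(1)[of n] dif(2)[of n]] by simp
  qed
  have k0: "(\<lambda>n. L2norm ?M (k n)) \<longlonglongrightarrow> 0"
  proof (rule tendsto_sandwich[OF _ _ tendsto_const])
    show "(\<lambda>n. 2 * (L2norm ?M (\<lambda>z. \<phi> n z - g z) + L2norm ?M (\<lambda>z. \<psi> n z - h z))) \<longlonglongrightarrow> 0"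
      using tendsto_mult[OF tendsto_const[of 2] tendsto_add[OF \<phi>M(3) \<psi>M(3)]] by simp
  qed (use kn in \<open>auto intro: always_eventually\<close>)
  have ae: "AE z in ?M. \<bar>D n z\<bar> \<le> d n + k n z" for n
    using gh
  proof eventually_elim
    case (elim z)
    have "min \<bar>\<phi> n z\<bar> \<bar>\<psi> n z\<bar> \<le> \<bar>\<phi> n z - g z\<bar> + \<bar>\<psi> n z - h z\<bar>" using elim by auto
    then show ?case using abs_axis_cut_le[OF d(1), of n "\<phi> n z" "\<psi> n z"] by (simp add: D_def k_def)
  qed
  have I: "integrable ?L (Jac (D n) (\<psi> m))" for n m
    by (intro integrable_continuous_lebesgue_on[OF \<Omega>(1,2)] continuous_Jac D1 C1)
  let ?e = "\<lambda>n. L2norm ?L (\<lambda>z. grad (\<psi> n) z - G z)"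
  have diff: "\<bar>(\<integral>z. Jac (D n) (\<psi> n) z \<partial>?L) - (\<integral>z. Jac (D n) (\<psi> m) z \<partial>?L)\<bar> \<le> B * (?e n + ?e m)" for n m
  proof -
    have L: "(\<lambda>z. grad (\<psi> n) z - grad (\<psi> m) z) \<in> L2 ?L" by (intro L2_diff \<psi>L)
    have "(\<integral>z. Jac (D n) (\<psi> n) z \<partial>?L) - (\<integral>z. Jac (D n) (\<psi> m) z \<partial>?L) =
      (\<integral>z. grad (D n) z \<bullet> perp (grad (\<psi> n) z - grad (\<psi> m) z) \<partial>?L)"
      using I[of n n] I[of n m] by (subst Bochner_Integration.integral_diff[symmetric]) (simp_all add: Jac_eq_inner perp_diff inner_diff_right)
    also have "\<bar>\<dots>\<bar> \<le> L2norm ?L (grad (D n)) * L2norm ?L (\<lambda>z. grad (\<psi> n) z - grad (\<psi> m) z)"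
      using L2_Cauchy_Schwarz[OF gradL2[OF D1] perp_L2[OF L]] by (simp only: L2norm_perp)
    also have "\<dots> \<le> B * (?e n + ?e m)"
    proof (intro mult_mono B)
      show "L2norm ?L (\<lambda>z. grad (\<psi> n) z - grad (\<psi> m) z) \<le> ?e n + ?e m"
        using L2norm_triangle_diff[OF L2_diff[OF \<psi>L(1)[of n] \<psi>L(2)] L2_diff[OF \<psi>L(1)[of m] \<psi>L(2)]] by simp
    qed (use B0 in auto)
    finally show ?thesis .
  qed
  show ?thesis
    unfolding D_def[symmetric, abs_def]
  proof (rule LIMSEQ_I)
    fix r :: real assume r: "0 < r"
    have Be: "(\<lambda>n. B * ?e n) \<longlonglongrightarrow> 0" using tendsto_mult[OF tendsto_const[of B] \<psi>L(3)] by simp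
    then have ev: "\<forall>\<^sub>F n in sequentially. B * ?e n < r / 3"
      by (rule order_tendstoD) (use r in simp)
    \<comment> \<open>The index \<open>m\<close> is fixed before the constant \<open>C\<close>,
      which depends on \<psi> m; only then does \<open>n\<close> grow.\<close>
    then obtain m where m: "B * ?e m < r / 3" unfolding eventually_sequentially by blast
    obtain C where C: "0 \<le> C" "jac_bound \<Omega> (\<psi> m) (\<lambda>_. 1) C" using jac_bound_global[OF \<Omega> C1(3)] by blast
    have "(\<lambda>n. C * (d n + L2norm ?M (k n))) \<longlonglongrightarrow> 0"
      using tendsto_mult[OF tendsto_const[of C] tendsto_add[OF d(2) k0]] by simp
    then have "\<forall>\<^sub>F n in sequentially. C * (d n + L2norm ?M (k n)) < r / 3"
      by (rule order_tendstoD) (use r in simp)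
    with ev have "\<forall>\<^sub>F n in sequentially. norm ((\<integral>z. Jac (D n) (\<psi> n) z \<partial>?L) - 0) < r"
    proof eventually_elim
      case (elim n)
      have "\<bar>\<integral>z. Jac (\<lambda>z. D n z * 1) (\<psi> m) z \<partial>?L\<bar> \<le> C * (d n + L2norm ?M (k n))"
        by (rule C(2)[unfolded jac_bound_def, rule_format, OF D1 less_imp_le[OF d(1)] k ae])
      moreover have "B * (?e n + ?e m) = B * ?e n + B * ?e m" by (rule distrib_left)
      ultimately show ?case using diff[of n m] elim m by simp
    qed
    then show "\<exists>no. \<forall>n\<ge>no. norm ((\<integral>z. Jac (D n) (\<psi> n) z \<partial>?L) - 0) < r"
      by (simp add: eventually_sequentially)
  qed
qed

section \<open>Weak gradients and their orthogonality\<close>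

lemma H1_weak_grad:
  assumes "u \<in> H1 \<Omega>"
  shows "weak_grad \<Omega> u \<in> L2 (lebesgue_on \<Omega>)" "has_weak_gradient \<Omega> u (weak_grad \<Omega> u)"
proof -
  have "\<exists>g. g \<in> L2 (lebesgue_on \<Omega>) \<and> has_weak_gradient \<Omega> u g" using assms by (auto simp: H1_def)
  then have "weak_grad \<Omega> u \<in> L2 (lebesgue_on \<Omega>) \<and> has_weak_gradient \<Omega> u (weak_grad \<Omega> u)"
    unfolding weak_grad_def by (rule someI_ex)
  then show "weak_grad \<Omega> u \<in> L2 (lebesgue_on \<Omega>)" "has_weak_gradient \<Omega> u (weak_grad \<Omega> u)" by auto
qed

lemma weak_grad_zero_AE:
  assumes "open \<Omega>" "bounded \<Omega>"
  shows "weak_grad \<Omega> (\<lambda>_. 0) \<in> L2 (lebesgue_on \<Omega>)" "AE z in lebesgue_on \<Omega>. weak_grad \<Omega> (\<lambda>_. 0) z = 0"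
proof -
  have "(\<lambda>_. 0) \<in> H1 \<Omega>"
    unfolding H1_def by (auto simp: L2_def has_weak_gradient_def intro!: exI[of _ "\<lambda>_. 0"])
  note w = H1_weak_grad[OF this]
  show "weak_grad \<Omega> (\<lambda>_. 0) \<in> L2 (lebesgue_on \<Omega>)" by (rule w(1))
  show "AE z in lebesgue_on \<Omega>. weak_grad \<Omega> (\<lambda>_. 0) z = 0" by (rule weak_gradient_zero_AE[OF assms w])
qed

lemma weak_grad_perp_eq: "weak_grad_perp \<Omega> u = (\<lambda>z. perp (weak_grad \<Omega> u z))"
  by (rule ext) (simp add: weak_grad_perp_def perp_def)

lemma weak_grad_orthogonal:
  assumes \<Omega>: "open \<Omega>" "bounded \<Omega>" "lipschitz_boundary \<Omega>" and part: "boundary_partition \<Omega> \<Gamma>\<^sub>I \<Gamma>\<^sub>C"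
    and p: "p \<in> H1_0 \<Omega> \<Gamma>\<^sub>C" and \<mu>: "\<mu> \<in> H1_0 \<Omega> \<Gamma>\<^sub>I"
  shows "(\<integral>z. weak_grad \<Omega> p z \<bullet> weak_grad_perp \<Omega> \<mu> z \<partial>lebesgue_on \<Omega>) = 0"
proof -
  let ?M = "boundary_measure \<Omega>" and ?L = "lebesgue_on \<Omega>"
  obtain g where g: "has_trace \<Omega> p g" "AE z in ?M. z \<in> \<Gamma>\<^sub>C \<longrightarrow> g z = 0" using p by (auto simp: H1_0_def)
  obtain h where h: "has_trace \<Omega> \<mu> h" "AE z in ?M. z \<in> \<Gamma>\<^sub>I \<longrightarrow> h z = 0" using \<mu> by (auto simp: H1_0_def)
  obtain \<phi> where \<phi>: "\<And>n. smooth (\<phi> n)" "L2_tendsto ?L (\<lambda>n. grad (\<phi> n)) (weak_grad \<Omega> p)" "L2_tendsto ?M \<phi> g"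
    using g(1) unfolding has_trace_def by blast
  obtain \<psi> where \<psi>: "\<And>n. smooth (\<psi> n)" "L2_tendsto ?L (\<lambda>n. grad (\<psi> n)) (weak_grad \<Omega> \<mu>)" "L2_tendsto ?M \<psi> h"
    using h(1) unfolding has_trace_def by blast
  have gh: "AE z in ?M. g z = 0 \<or> h z = 0"
    using g(2) h(2) boundary_partition_AE[OF \<Omega> part] by eventually_elim auto
  then have hg: "AE z in ?M. h z = 0 \<or> g z = 0" by eventually_elim auto
  \<comment> \<open>The smoothing parameter shrinks along with the approximation, so that both
    errors vanish in one limit.\<close>
  define d where "d n = inverse (real (Suc n))" for n
  have d: "\<And>n. 0 < d n" "d \<longlonglongrightarrow> 0" using LIMSEQ_inverse_real_of_nat by (auto simp: d_def[abs_def])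
  have C1: "Ck 1 (\<phi> n)" "Ck 1 (\<psi> n)" for n using \<phi>(1) \<psi>(1) unfolding smooth_def by blast+
  have df: "\<phi> n differentiable (at z)" "\<psi> n differentiable (at z)" for n z using C1[of n] by auto
  let ?D = "\<lambda>n z. axis_cut (d n) (\<phi> n z) (\<psi> n z)" and ?D' = "\<lambda>n z. axis_cut (d n) (\<psi> n z) (\<phi> n z)"
  have "Jac (\<phi> n) (\<psi> n) z = Jac (?D n) (\<psi> n) z - Jac (?D' n) (\<phi> n) z" for n z
    by (rule Jac_split[OF d(1) df])
  then have "(\<integral>z. Jac (\<phi> n) (\<psi> n) z \<partial>?L) = (\<integral>z. Jac (?D n) (\<psi> n) z \<partial>?L) - (\<integral>z. Jac (?D' n) (\<phi> n) z \<partial>?L)" for n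
    by (simp only:) (intro Bochner_Integration.integral_diff integrable_continuous_lebesgue_on[OF \<Omega>(1,2)] continuous_Jac C1_axis_cut d C1)
  moreover have "(\<lambda>n. (\<integral>z. Jac (?D n) (\<psi> n) z \<partial>?L) - (\<integral>z. Jac (?D' n) (\<phi> n) z \<partial>?L)) \<longlonglongrightarrow> 0 - 0"
    by (intro tendsto_diff integral_Jac_cut_tendsto_0[OF \<Omega> \<phi> \<psi> gh d] integral_Jac_cut_tendsto_0[OF \<Omega> \<psi> \<phi> hg d])
  ultimately have "(\<lambda>n. \<integral>z. Jac (\<phi> n) (\<psi> n) z \<partial>?L) \<longlonglongrightarrow> 0" by simp
  moreover have "(\<lambda>n. \<integral>z. Jac (\<phi> n) (\<psi> n) z \<partial>?L) \<longlonglongrightarrow> (\<integral>z. weak_grad \<Omega> p z \<bullet> weak_grad_perp \<Omega> \<mu> z \<partial>?L)"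
    unfolding Jac_eq_inner weak_grad_perp_eq by (intro L2_tendsto_inner \<phi>(2) L2_tendsto_perp \<psi>(2))
  ultimately show ?thesis using LIMSEQ_unique by blast
qed

subsection \<open>The flux and the two estimates\<close>

lemma locally_lipschitz_flux_continuous:
  assumes "locally_lipschitz_flux f" shows "continuous_on UNIV f"
proof -
  have "continuous_on UNIV (\<lambda>x. (fst (f x), snd (f x)))"
  proof (rule continuous_at_imp_continuous_on, rule ballI)
    fix x :: real
    obtain K where K: "0 < K" "\<And>a b. a \<in> cball x 1 \<Longrightarrow> b \<in> cball x 1 \<Longrightarrow>
        \<bar>fst (f a) - fst (f b)\<bar> \<le> K * \<bar>a - b\<bar> \<and> \<bar>snd (f a) - snd (f b)\<bar> \<le> K * \<bar>a - b\<bar>"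
      using assms compact_cball[of x 1] unfolding locally_lipschitz_flux_def by metis
    have "K-lipschitz_on (cball x 1) (\<lambda>x. fst (f x))" "K-lipschitz_on (cball x 1) (\<lambda>x. snd (f x))"
      using K by (auto intro!: lipschitz_onI simp: dist_real_def)
    then have "continuous_on (cball x 1) (\<lambda>x. (fst (f x), snd (f x)))"
      by (intro continuous_on_Pair lipschitz_on_continuous_on)
    then show "isCont (\<lambda>x. (fst (f x), snd (f x))) x"
      by (rule continuous_on_interior) simp
  qed
  then show ?thesis by simp
qed

lemma flux_L2:
  assumes M: "finite_measure M" and f: "continuous_on UNIV f" and v: "v \<in> Linf M"
  shows "(\<lambda>z. f (v z) :: real \<times> real) \<in> L2 M"
proof -
  interpret finite_measure M by fact
  obtain C where C: "AE z in M. \<bar>v z\<bar> \<le> C" and vm: "v \<in> borel_measurable M" using v by (auto simp: Linf_def)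
  have m: "(\<lambda>z. f (v z)) \<in> borel_measurable M"
    by (rule measurable_compose[OF vm borel_measurable_continuous_onI[OF f]])
  have "compact (f ` {- C..C})" by (intro compact_continuous_image continuous_on_subset[OF f]) auto
  then have "bounded (f ` {- C..C})" by (rule compact_imp_bounded)
  then obtain B where B: "\<forall>x\<in>{- C..C}. norm (f x) \<le> B" unfolding bounded_iff by auto
  have "AE z in M. norm ((norm (f (v z)))\<^sup>2) \<le> B\<^sup>2"
    using C
  proof eventually_elim
    case (elim z)
    then have "norm (f (v z)) \<le> B" by (intro B[rule_format]) auto
    then show ?case by (simp add: power_mono)
  qed
  then have "integrable M (\<lambda>z. (norm (f (v z)))\<^sup>2)" using m by (intro integrable_const_bound) auto
  with m show ?thesis by (simp add: L2_def)
qed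

text \<open>Cauchy-Schwarz with weights 1, 2/3, e/2 gives the factor 1 + 3/2 + 2/e, that is 2 + 5/2
  e after multiplication by \<open>e\<close>. In the proof the first three squares account for the
  cross terms, and the last three terms are the slack e/2.\<close>

lemma weighted_square_sum_le:
  fixes x y z e :: real
  assumes "0 < e"
  shows "e * (x + y + z)\<^sup>2 \<le> (2 + 3 * e) * (x\<^sup>2 + 2 / 3 * y\<^sup>2 + e / 2 * z\<^sup>2)"
proof -
  have "0 \<le> e * (3 * x - 2 * y)\<^sup>2 / 6" "0 \<le> (2 * x - e * z)\<^sup>2 / 2" "0 \<le> (4 * y - 3 * e * z)\<^sup>2 / 12"
    "0 \<le> e * x\<^sup>2 / 2" "0 \<le> e * y\<^sup>2 / 3" "0 \<le> e\<^sup>2 * z\<^sup>2 / 4"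
    using assms by auto
  moreover have "(2 + 3 * e) * (x\<^sup>2 + 2 / 3 * y\<^sup>2 + e / 2 * z\<^sup>2) - e * (x + y + z)\<^sup>2 =
     e * (3 * x - 2 * y)\<^sup>2 / 6 + (2 * x - e * z)\<^sup>2 / 2 + (4 * y - 3 * e * z)\<^sup>2 / 12 +
     e * x\<^sup>2 / 2 + e * y\<^sup>2 / 3 + e\<^sup>2 * z\<^sup>2 / 4"
    by (simp add: power2_eq_square field_simps)
  ultimately show ?thesis by linarith
qed

theorem theorem5p7:
  fixes \<Omega> \<Gamma>\<^sub>I \<Gamma>\<^sub>C :: "(real \<times> real) set"
    and f :: "real \<Rightarrow> real \<times> real"
  assumes "open \<Omega>" and "bounded \<Omega>" and "simply_connected \<Omega>" and "lipschitz_boundary \<Omega>"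
    and "boundary_partition \<Omega> \<Gamma>\<^sub>I \<Gamma>\<^sub>C"
    and "locally_lipschitz_flux f"
  shows "\<forall>v \<in> Linf (lebesgue_on \<Omega>). \<forall>p \<in> H1_0 \<Omega> \<Gamma>\<^sub>C. \<forall>\<mu> \<in> H1_0 \<Omega> \<Gamma>\<^sub>I.
    (\<forall>\<epsilon>\<ge>0. F_reg \<Omega> f \<epsilon> v p \<mu> (\<lambda>_. 0) \<le>
       3 * ((L2norm (lebesgue_on \<Omega>) (\<lambda>z. f (v z)))\<^sup>2 + (L2norm (lebesgue_on \<Omega>) (weak_grad \<Omega> p))\<^sup>2) +
       (2 + \<epsilon>\<^sup>2) * (L2norm (lebesgue_on \<Omega>) (weak_grad \<Omega> \<mu>))\<^sup>2) \<and>
    (\<forall>\<epsilon>>0. \<epsilon>\<^sup>2 * (1 / (2 + 3 * \<epsilon>\<^sup>2) * (L2norm (lebesgue_on \<Omega>) (\<lambda>z. f (v z)))\<^sup>2 +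
               1 / 2 * (L2norm (lebesgue_on \<Omega>) (weak_grad \<Omega> \<mu>))\<^sup>2) +
       1 / 3 * (L2norm (lebesgue_on \<Omega>) (weak_grad \<Omega> p))\<^sup>2 \<le> F_reg \<Omega> f \<epsilon> v p \<mu> (\<lambda>_. 0))"
proof (intro ballI)
  fix v p \<mu>
  assume v: "v \<in> Linf (lebesgue_on \<Omega>)" and p: "p \<in> H1_0 \<Omega> \<Gamma>\<^sub>C" and \<mu>: "\<mu> \<in> H1_0 \<Omega> \<Gamma>\<^sub>I"
  let ?L = "lebesgue_on \<Omega>"
  let ?a = "\<lambda>z. f (v z)" and ?b = "weak_grad \<Omega> p" and ?c = "weak_grad_perp \<Omega> \<mu>"
  have a: "?a \<in> L2 ?L"
    by (rule flux_L2[OF finite_measure_lebesgue_on_open[OF assms(1,2)] locally_lipschitz_flux_continuous[OF assms(6)] v])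
  have b: "?b \<in> L2 ?L" using p by (intro H1_weak_grad) (simp add: H1_0_def)
  have "weak_grad \<Omega> \<mu> \<in> L2 ?L" using \<mu> by (intro H1_weak_grad) (simp add: H1_0_def)
  then have c: "?c \<in> L2 ?L" unfolding weak_grad_perp_eq by (rule perp_L2)
  define \<alpha> \<beta> \<gamma> \<rho> \<delta> where "\<alpha> = L2norm ?L ?a" and "\<beta> = L2norm ?L ?b" and "\<gamma> = L2norm ?L ?c"
    and "\<rho> = L2norm ?L (\<lambda>z. ?a z - ?b z - ?c z)" and "\<delta> = L2norm ?L (\<lambda>z. ?b z + ?c z)"
  note defs = this
  have nn: "0 \<le> \<alpha>" "0 \<le> \<beta>" "0 \<le> \<gamma>" "0 \<le> \<rho>" "0 \<le> \<delta>" by (simp_all add: defs)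
  have \<gamma>: "L2norm ?L (weak_grad \<Omega> \<mu>) = \<gamma>" by (simp add: defs weak_grad_perp_eq L2norm_perp)
  have bc: "(\<lambda>z. ?b z + ?c z) \<in> L2 ?L" by (rule L2_add[OF b c])
  \<comment> \<open>The cross term is the integral that orthogonality makes zero.\<close>
  have \<delta>2: "\<delta>\<^sup>2 = \<beta>\<^sup>2 + \<gamma>\<^sup>2"
    using L2norm_add_sq[OF b c, of 1] weak_grad_orthogonal[OF assms(1,2,4,5) p \<mu>] by (simp add: defs)
  have "\<rho> = L2norm ?L (\<lambda>z. ?a z - (?b z + ?c z))" by (simp add: defs diff_diff_eq)
  then have \<rho>: "\<rho> \<le> \<alpha> + \<delta>" using L2norm_triangle_diff[OF a bc] by (simp add: defs)
  have "\<alpha> = L2norm ?L (\<lambda>z. (?a z - ?b z - ?c z) + (?b z + ?c z))" by (simp add: defs)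
  then have "\<alpha> \<le> \<rho> + \<delta>" using L2norm_triangle[OF L2_diff[OF L2_diff[OF a b] c] bc] by (simp add: defs)
  moreover have "\<delta> \<le> \<beta> + \<gamma>" using L2norm_triangle[OF b c] by (simp add: defs)
  ultimately have \<alpha>: "\<alpha> \<le> \<rho> + \<beta> + \<gamma>" by simp
  \<comment> \<open>The chosen gradient of q = 0 vanishes only almost everywhere.\<close>
  have "L2norm ?L (\<lambda>z. ?b z - weak_grad \<Omega> (\<lambda>_. 0) z) = \<beta>"
    unfolding defs
  proof (rule L2norm_cong_AE)
    show "AE z in ?L. norm (?b z - weak_grad \<Omega> (\<lambda>_. 0) z) = norm (?b z)"
      using weak_grad_zero_AE(2)[OF assms(1,2)] by eventually_elim simp
  qed (use L2_D(1)[OF b] L2_D(1)[OF weak_grad_zero_AE(1)[OF assms(1,2)]] in auto)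
  then have F: "F_reg \<Omega> f \<epsilon> v p \<mu> (\<lambda>_. 0) = \<rho>\<^sup>2 + \<beta>\<^sup>2 + \<epsilon>\<^sup>2 * \<gamma>\<^sup>2" for \<epsilon>
    by (simp add: F_reg_def defs)
  show "(\<forall>\<epsilon>\<ge>0. F_reg \<Omega> f \<epsilon> v p \<mu> (\<lambda>_. 0) \<le> 3 * ((L2norm ?L ?a)\<^sup>2 + (L2norm ?L ?b)\<^sup>2) +
       (2 + \<epsilon>\<^sup>2) * (L2norm ?L (weak_grad \<Omega> \<mu>))\<^sup>2) \<and>
    (\<forall>\<epsilon>>0. \<epsilon>\<^sup>2 * (1 / (2 + 3 * \<epsilon>\<^sup>2) * (L2norm ?L ?a)\<^sup>2 + 1 / 2 * (L2norm ?L (weak_grad \<Omega> \<mu>))\<^sup>2) +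
       1 / 3 * (L2norm ?L ?b)\<^sup>2 \<le> F_reg \<Omega> f \<epsilon> v p \<mu> (\<lambda>_. 0))"
    unfolding F \<gamma> \<alpha>_def[symmetric] \<beta>_def[symmetric]
  proof (intro conjI allI impI)
    fix \<epsilon> :: real
    have "\<rho>\<^sup>2 \<le> (\<alpha> + \<delta>)\<^sup>2" using \<rho> nn by (intro power_mono)
    \<comment> \<open>The difference of the two sides is half the square of 2 \<alpha> - \<delta>.
      With the separate term the coefficient of the square of \<beta> becomes 5/2, below 3, and
      \<gamma> gets 3/2, below 2.\<close>
    also have "\<dots> \<le> 3 * \<alpha>\<^sup>2 + 3 / 2 * \<delta>\<^sup>2"
      using zero_le_power2[of "2 * \<alpha> - \<delta>"] by (simp add: power2_eq_square algebra_simps)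
    finally have "\<rho>\<^sup>2 \<le> 3 * \<alpha>\<^sup>2 + 3 / 2 * (\<beta>\<^sup>2 + \<gamma>\<^sup>2)" unfolding \<delta>2 .
    moreover have "0 \<le> \<beta>\<^sup>2" "0 \<le> \<gamma>\<^sup>2" by simp_all
    ultimately show "\<rho>\<^sup>2 + \<beta>\<^sup>2 + \<epsilon>\<^sup>2 * \<gamma>\<^sup>2 \<le> 3 * (\<alpha>\<^sup>2 + \<beta>\<^sup>2) + (2 + \<epsilon>\<^sup>2) * \<gamma>\<^sup>2"
      unfolding distrib_left distrib_right by linarith
  next
    fix \<epsilon> :: real assume "0 < \<epsilon>"
    define e where "e = \<epsilon>\<^sup>2"
    have e: "0 < e" using \<open>0 < \<epsilon>\<close> by (simp add: e_def)
    have "e * \<alpha>\<^sup>2 \<le> e * (\<rho> + \<beta> + \<gamma>)\<^sup>2"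
      using \<alpha> nn e by (intro mult_left_mono power_mono) auto
    also have "\<dots> \<le> (2 + 3 * e) * (\<rho>\<^sup>2 + 2 / 3 * \<beta>\<^sup>2 + e / 2 * \<gamma>\<^sup>2)" by (rule weighted_square_sum_le[OF e])
    \<comment> \<open>The weights leave over one third of the square of \<beta> and half of the
      regularising term, which are the remaining terms of the lower bound.\<close>
    finally have "e * \<alpha>\<^sup>2 / (2 + 3 * e) \<le> \<rho>\<^sup>2 + 2 / 3 * \<beta>\<^sup>2 + e / 2 * \<gamma>\<^sup>2"
      using e by (simp add: pos_divide_le_eq mult.commute)
    moreover have "e * (1 / (2 + 3 * e) * \<alpha>\<^sup>2 + 1 / 2 * \<gamma>\<^sup>2) = e * \<alpha>\<^sup>2 / (2 + 3 * e) + e / 2 * \<gamma>\<^sup>2"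
      by (simp add: distrib_left)
    moreover have "e * \<gamma>\<^sup>2 = e / 2 * \<gamma>\<^sup>2 + e / 2 * \<gamma>\<^sup>2" by simp
    ultimately show "\<epsilon>\<^sup>2 * (1 / (2 + 3 * \<epsilon>\<^sup>2) * \<alpha>\<^sup>2 + 1 / 2 * \<gamma>\<^sup>2) + 1 / 3 * \<beta>\<^sup>2 \<le> \<rho>\<^sup>2 + \<beta>\<^sup>2 + \<epsilon>\<^sup>2 * \<gamma>\<^sup>2"
      unfolding e_def[symmetric] by linarith
  qed
qed

end
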